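(* Let $f=a/d^{\,j}\in\mathbb K(t,\mathbf x)$ where $j\ge1$, $a\in\mathbb K(t,x_2,\dots,x_m)[x_1]$, $d\in\mathbb K[t,\mathbf x]$ is irreducible with $\deg_{x_1}(d)>0$, $\deg_{x_1}(a)<\deg_{x_1}(d)$, and $\operatorname{rank}(G_{t,d}/G_d)=1$. Let $\{\tau_0,\tau_1,\dots,\tau_r\}$ be a basis of $G_{t,d}$ such that $G_{t,d}/G_d$ is generated by the coset $\tau_0G_d$ and $\{\tau_1,\dots,\tau_r\}$ is a basis of $G_d$ (if $G_d=\{\mathbf 1\}$ take $r=1$, $\tau_1=\mathbf 1$). Then $f$ has a telescoper of type $(\sigma_t;\sigma_{x_1},\dots,\sigma_{x_n})$ if and only if there exists a nonzero operator $L=\sum_{i=0}^{\rho}\ell_iT_0^i$ with $\ell_i\in\mathbb K(t)$ such that $$L(a)=\Delta_{\tau_1}(b_1)+\cdots+\Delta_{\tau_r}(b_r)$$ for some $b_i\in\mathbb K(t,x_2,\dots,x_m)[x_1]$ with $\deg_{x_1}(b_i)<\deg_{x_1}(d)$, $1\le i\le r$. Here $L(a):=\sum_i\ell_i\,\tau_0^i(a)$.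
   Context: $\mathbb K$ is a field of characteristic zero, $\mathbf x=(x_1,\dots,x_m)$, $1\le n\le m$; $\sigma_t,\sigma_{x_i}$ are the $\mathbb K$-automorphisms of $\mathbb K(t,\mathbf x)$ shifting $t$, resp. $x_i$, by $1$ and fixing the other variables. $G=\langle\sigma_{x_1},\dots,\sigma_{x_n}\rangle$, $G_t=\langle\sigma_t,\sigma_{x_1},\dots,\sigma_{x_n}\rangle$ (free abelian under composition); $G_d=\{\tau\in G:\tau(d)=d\}$, $G_{t,d}=\{\tau\in G_t:\tau(d)=d\}$. For $\tau$ in $G_t$, $\Delta_\tau(g)=\tau(g)-g$. $T_0$ denotes the shift operator corresponding to $\tau_0$, i.e. if $\tau_0=\sigma_t^{k_0}\sigma_{x_1}^{k_1}\cdots\sigma_{x_n}^{k_n}$ then $T_0=S_t^{k_0}S_{x_1}^{k_1}\cdots S_{x_n}^{k_n}$, acting as $\tau_0$. A telescoper of type $(\sigma_t;\sigma_{x_1},\dots,\sigma_{x_n})$ for $f$ is a nonzero $L=\sum_\ell e_\ell S_t^\ell$, $e_\ell\in\mathbb K(t)$, such that $\sum_\ell e_\ell\sigma_t^\ell(f)=\sum_{i=1}^n\Delta_{\sigma_{x_i}}(g_i)$ for some $g_i\in\mathbb K(t,\mathbf x)$. *)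

theory Defs
  imports "HOL-Library.Poly_Mapping" "HOL-Computational_Algebra.Fraction_Field" "HOL-Computational_Algebra.Factorial_Ring"
begin

text \<open>Multivariate polynomials over 'k: variable 0 is t, variable i (i \<ge> 1) is x_i.\<close>
type_synonym 'k mpoly = "(nat \<Rightarrow>\<^sub>0 nat) \<Rightarrow>\<^sub>0 'k"
type_synonym 'k rfun = "'k mpoly fract"

definition Var :: "nat \<Rightarrow> 'k::comm_ring_1 mpoly" where
  "Var w = Poly_Mapping.single (Poly_Mapping.single w 1) 1"

definition Const :: "'k::comm_ring_1 \<Rightarrow> 'k mpoly" where
  "Const c = Poly_Mapping.single 0 c"

abbreviation rf :: "'k::field mpoly \<Rightarrow> 'k rfun" where
  "rf p \<equiv> Fract p 1"

definition shift_poly :: "(nat \<Rightarrow> int) \<Rightarrow> 'k::field mpoly \<Rightarrow> 'k mpoly" where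
  "shift_poly k p = (\<Sum>mo\<in>Poly_Mapping.keys p. Const (Poly_Mapping.lookup p mo) *
      (\<Prod>w\<in>Poly_Mapping.keys mo. (Var w + of_int (k w)) ^ (Poly_Mapping.lookup mo w)))"

definition shift_rf :: "(nat \<Rightarrow> int) \<Rightarrow> 'k::field rfun \<Rightarrow> 'k rfun" where
  "shift_rf k f = (let (p, q) = (SOME (p, q). q \<noteq> 0 \<and> f = Fract p q)
                   in Fract (shift_poly k p) (shift_poly k q))"

definition Delta :: "(nat \<Rightarrow> int) \<Rightarrow> 'k::field rfun \<Rightarrow> 'k rfun" where
  "Delta k g = shift_rf k g - g"

definition vars :: "'k::zero mpoly \<Rightarrow> nat set" where
  "vars p = (\<Union>mo\<in>Poly_Mapping.keys p. Poly_Mapping.keys mo)"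

definition rf_in :: "nat set \<Rightarrow> 'k::field rfun \<Rightarrow> bool" where
  "rf_in V f = (\<exists>p q. q \<noteq> 0 \<and> vars p \<subseteq> V \<and> vars q \<subseteq> V \<and> f = Fract p q)"

definition degx1 :: "'k::zero mpoly \<Rightarrow> nat" where
  "degx1 p = Max (insert 0 ((\<lambda>mo. Poly_Mapping.lookup mo 1) ` Poly_Mapping.keys p))"

definition x1poly_deg_lt :: "nat \<Rightarrow> nat \<Rightarrow> 'k::field rfun \<Rightarrow> bool" where
  "x1poly_deg_lt m D a = (\<exists>c. (\<forall>i<D. rf_in ({0..m} - {1}) (c i)) \<and>
       a = (\<Sum>i<D. c i * rf (Var 1) ^ i))"

text \<open>Elements of G_t are encoded by exponent vectors:
  sigma_t^{k 0} sigma_{x_1}^{k 1} ... sigma_{x_n}^{k n}.\<close>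
definition in_Gt :: "nat \<Rightarrow> (nat \<Rightarrow> int) \<Rightarrow> bool" where
  "in_Gt n k = (\<forall>w>n. k w = 0)"

definition Gtd :: "nat \<Rightarrow> 'k::field mpoly \<Rightarrow> (nat \<Rightarrow> int) set" where
  "Gtd n d = {k. in_Gt n k \<and> shift_rf k (rf d) = rf d}"

definition Gd :: "nat \<Rightarrow> 'k::field mpoly \<Rightarrow> (nat \<Rightarrow> int) set" where
  "Gd n d = {k \<in> Gtd n d. k 0 = 0}"

definition unitv :: "nat \<Rightarrow> int \<Rightarrow> (nat \<Rightarrow> int)" where
  "unitv w l = (\<lambda>v. if v = w then l else 0)"

definition zlin :: "(nat \<Rightarrow> int) \<Rightarrow> nat set \<Rightarrow> (nat \<Rightarrow> nat \<Rightarrow> int) \<Rightarrow> (nat \<Rightarrow> int)" where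
  "zlin c I tau = (\<lambda>w. \<Sum>i\<in>I. c i * tau i w)"

definition is_basis :: "(nat \<Rightarrow> int) set \<Rightarrow> nat set \<Rightarrow> (nat \<Rightarrow> nat \<Rightarrow> int) \<Rightarrow> bool" where
  "is_basis H I tau = (finite I \<and> (\<forall>i\<in>I. tau i \<in> H) \<and> H = {zlin c I tau | c. True} \<and>
      (\<forall>c. zlin c I tau = (\<lambda>_. 0) \<longrightarrow> (\<forall>i\<in>I. c i = 0)))"

definition indep_mod :: "(nat \<Rightarrow> int) set \<Rightarrow> (nat \<Rightarrow> int) set \<Rightarrow> bool" where
  "indep_mod K S = (\<forall>c :: (nat \<Rightarrow> int) \<Rightarrow> int.
      (\<lambda>w. \<Sum>s\<in>S. c s * s w) \<in> K \<longrightarrow> (\<forall>s\<in>S. c s = 0))"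

definition quot_rank :: "(nat \<Rightarrow> int) set \<Rightarrow> (nat \<Rightarrow> int) set \<Rightarrow> nat" where
  "quot_rank H K = Max {card S | S. S \<subseteq> H \<and> finite S \<and> indep_mod K S}"

definition has_telescoper :: "nat \<Rightarrow> nat \<Rightarrow> 'k::field rfun \<Rightarrow> bool" where
  "has_telescoper m n f = (\<exists>(e :: nat \<Rightarrow> 'k rfun) N.
      (\<forall>l\<le>N. rf_in {0} (e l)) \<and> (\<exists>l\<le>N. e l \<noteq> 0) \<and>
      (\<exists>g. (\<forall>i\<in>{1..n}. rf_in {0..m} (g i)) \<and>
         (\<Sum>l\<le>N. e l * shift_rf (unitv 0 (int l)) f) = (\<Sum>i=1..n. Delta (unitv i 1) (g i))))"

end

theory Submission
  imports "HOL-Computational_Algebra.Polynomial" Defs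
begin

text \<open>
  By Gauss's lemma d is irreducible over F = K(t, x_2, ..., x_m), so every rational function g has
  a partial fraction expansion at d over F[x_1]; let R(g) be its numerator over d^j. This map is
  F-linear and commutes with G_{t,d}, it sends a/d^j to a, and it kills tau(a/d^j) for tau outside
  of G_{t,d}, because a shift of d that is divisible by d equals d. Let V be the numerators of
  degree below deg d and W the sum of the images of the Delta_{tau_i} on V. Since G_d acts
  trivially on V/W, the sum of R(c^{-1} g) over the cosets c G_d of G_d in G is a well-defined
  element of V/W (almost all terms vanish), and it is invariant under G. It therefore kills all
  Delta_{sigma_{x_i}}(g). Applied to a telescoped f, shifted in t such that the coefficient of
  f itself is nonzero, it yields an equation for powers of tau_0 applied to a, which a further power
  of tau_0 makes polynomial. Conversely, dividing the equation for a by d^j gives one for f,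
  in which tau_0 may be replaced by its power of sigma_t modulo differences.
\<close>

section \<open>Unique factorisation in polynomial rings over subrings\<close>

text \<open>The field K(t, x_2, ..., x_m) and its polynomial ring are not types but subsets of
  ambient types whose variables are indexed by all naturals. Hence divisibility, units and primes
  are taken relative to a carrier set, and Gauss's lemma and unique factorisation are proved for
  such carriers. Two obstacles shape the necessity proof. The sum over all cosets is never formed:
  each relation is tested on one finite set of representatives that contains every support occurring
  in it. Moreover, only those powers of \<open>\<sigma>_t\<close> survive whose exponent is
  divisible by \<open>tau 0 0\<close>, the t-component of \<open>\<tau>_0\<close>, because just
  these can be moved into \<open>G_{t,d}\<close> by an element of \<open>G\<close>. A telescoper
  might have zero coefficients at all such exponents; placing a nonzero coefficient at exponent 0 by
  a shift in t keeps the resulting operator nonzero. Coefficients in K(t) are fixed by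
  \<open>G\<close>, so the difference spans are closed under multiplication by them, but they are
  moved by \<open>\<sigma>_t\<close> and in general by \<open>\<tau>_0\<close>, so every such
  normalising shift changes the coefficients too.\<close>

locale sub_ring =
  fixes R :: "'a::idom set"
  assumes zero_closed [simp, intro]: "0 \<in> R"
    and one_closed [simp, intro]: "1 \<in> R"
    and diff_closed [simp, intro]: "a \<in> R \<Longrightarrow> b \<in> R \<Longrightarrow> a - b \<in> R"
    and mult_closed [simp, intro]: "a \<in> R \<Longrightarrow> b \<in> R \<Longrightarrow> a * b \<in> R"
begin

lemma uminus_closed [simp, intro]: "a \<in> R \<Longrightarrow> - a \<in> R"
  using diff_closed[of 0 a] by simp

lemma add_closed [simp, intro]: "a \<in> R \<Longrightarrow> b \<in> R \<Longrightarrow> a + b \<in> R"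
  using diff_closed[of a "- b"] by simp

lemma sum_closed [intro]: "(\<And>i. i \<in> A \<Longrightarrow> f i \<in> R) \<Longrightarrow> sum f A \<in> R"
  by (induction A rule: infinite_finite_induct) auto

lemma prod_closed [intro]: "(\<And>i. i \<in> A \<Longrightarrow> f i \<in> R) \<Longrightarrow> prod f A \<in> R"
  by (induction A rule: infinite_finite_induct) auto

lemma power_closed [simp, intro]: "a \<in> R \<Longrightarrow> a ^ n \<in> R"
  by (induction n) auto

lemma prod_list_closed [intro]: "set ps \<subseteq> R \<Longrightarrow> prod_list ps \<in> R"
  by (induction ps) auto

end

text \<open>The cofactor has to lie in \<open>R\<close>; divisibility in the ambient ring would be a
  weaker relation.\<close>

definition rdvd :: "'a::idom set \<Rightarrow> 'a \<Rightarrow> 'a \<Rightarrow> bool" where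
  "rdvd R a b \<longleftrightarrow> (\<exists>c\<in>R. b = a * c)"

definition unit_in :: "'a::idom set \<Rightarrow> 'a \<Rightarrow> bool" where
  "unit_in R u \<longleftrightarrow> u \<in> R \<and> rdvd R u 1"

definition prime_in :: "'a::idom set \<Rightarrow> 'a \<Rightarrow> bool" where
  "prime_in R p \<longleftrightarrow> p \<in> R \<and> p \<noteq> 0 \<and> \<not> unit_in R p \<and>
     (\<forall>a\<in>R. \<forall>b\<in>R. rdvd R p (a * b) \<longrightarrow> rdvd R p a \<or> rdvd R p b)"

text \<open>The number of prime factors is recorded because it is the induction measure for
  cancelling primes and for extracting contents.\<close>

definition prime_product :: "'a::idom set \<Rightarrow> nat \<Rightarrow> 'a \<Rightarrow> bool" where
  "prime_product R n s \<longleftrightarrow> (\<exists>u ps. unit_in R u \<and> set ps \<subseteq> Collect (prime_in R) \<and>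
     length ps = n \<and> s = u * prod_list ps)"

text \<open>Kaplansky's characterisation of unique factorisation domains.\<close>
definition ufd_in :: "'a::idom set \<Rightarrow> bool" where
  "ufd_in R \<longleftrightarrow> sub_ring R \<and> (\<forall>s\<in>R. s \<noteq> 0 \<longrightarrow> (\<exists>n. prime_product R n s))"

lemma prime_inD:
  assumes "prime_in R p"
  shows "p \<in> R" "p \<noteq> 0" "\<not> unit_in R p"
    "a \<in> R \<Longrightarrow> b \<in> R \<Longrightarrow> rdvd R p (a * b) \<Longrightarrow> rdvd R p a \<or> rdvd R p b"
  using assms by (auto simp: prime_in_def)

context sub_ring
begin

lemma unit_in_1 [simp]: "unit_in R 1"
  by (auto simp: unit_in_def rdvd_def)

lemma unit_in_mult: "unit_in R u \<Longrightarrow> unit_in R v \<Longrightarrow> unit_in R (u * v)"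
proof -
  assume "unit_in R u" "unit_in R v"
  then obtain c e where ce: "u \<in> R" "v \<in> R" "c \<in> R" "e \<in> R" "1 = u * c" "1 = v * e"
    by (auto simp: unit_in_def rdvd_def)
  have "1 = (u * c) * (v * e)"
    using ce(5,6) by simp
  then have "1 = (u * v) * (c * e)"
    by (simp add: algebra_simps)
  with ce show ?thesis
    unfolding unit_in_def rdvd_def by blast
qed

lemma unit_in_factor:
  assumes "a \<in> R" "b \<in> R" "unit_in R (a * b)"
  shows "unit_in R a"
proof -
  from assms(3) obtain c where "c \<in> R" "1 = a * b * c"
    by (auto simp: unit_in_def rdvd_def)
  then show ?thesis
    using assms unfolding unit_in_def rdvd_def
    by (intro conjI bexI[of _ "b * c"]) (auto simp: mult.assoc)
qed

lemma prime_product_unit: "unit_in R u \<Longrightarrow> prime_product R 0 u"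
  by (auto simp: prime_product_def)

lemma prime_product_prime: "prime_in R p \<Longrightarrow> prime_product R 1 p"
  unfolding prime_product_def
  by (intro exI[of _ 1] exI[of _ "[p]"]) auto

lemma prime_product_mult:
  assumes "prime_product R k a" "prime_product R l b"
  shows "prime_product R (k + l) (a * b)"
proof -
  obtain u ps v qs where *: "unit_in R u" "set ps \<subseteq> Collect (prime_in R)" "length ps = k"
      "a = u * prod_list ps" "unit_in R v" "set qs \<subseteq> Collect (prime_in R)" "length qs = l"
      "b = v * prod_list qs"
    using assms unfolding prime_product_def by blast
  then show ?thesis
    unfolding prime_product_def
    by (intro exI[of _ "u * v"] exI[of _ "ps @ qs"]) (auto simp: unit_in_mult algebra_simps)
qed

lemma prime_product_Suc:
  assumes "prime_product R (Suc k) s"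
  obtains p t where "prime_in R p" "prime_product R k t" "s = p * t"
proof -
  obtain u ps where *: "unit_in R u" "set ps \<subseteq> Collect (prime_in R)" "length ps = Suc k"
      "s = u * prod_list ps"
    using assms unfolding prime_product_def by blast
  then obtain p qs where "ps = p # qs" by (cases ps) auto
  with * show ?thesis
    by (intro that[of p "u * prod_list qs"]) (auto simp: prime_product_def algebra_simps)
qed

lemma prime_product_0: "prime_product R 0 s \<Longrightarrow> unit_in R s"
  by (auto simp: prime_product_def)

lemma prime_product_closed: "prime_product R k s \<Longrightarrow> s \<in> R"
  by (auto simp: prime_product_def unit_in_def prime_in_def intro!: mult_closed prod_list_closed)

lemma prime_product_nonzero: "prime_product R k s \<Longrightarrow> s \<noteq> 0"
  by (force simp: prime_product_def unit_in_def prime_in_def rdvd_def prod_list_zero_iff)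

text \<open>Products of a unit and primes form a saturated set: a prime of the product divides
  \<open>a\<close> or \<open>b\<close>, and after cancelling it there the induction continues. This
  later recovers a factorisation of a polynomial from one of a constant multiple of it.\<close>

lemma prime_product_dvd:
  assumes "prime_product R k (a * b)" "a \<in> R" "b \<in> R"
  shows "\<exists>l. prime_product R l a"
  using assms
proof (induction k arbitrary: a b)
  case 0
  then have "unit_in R a"
    by (intro unit_in_factor[OF _ _ prime_product_0])
  then show ?case
    by (blast intro: prime_product_unit)
next
  case (Suc k)
  obtain p t where p: "prime_in R p" "prime_product R k t" "a * b = p * t"
    using prime_product_Suc[OF Suc.prems(1)] .
  have "rdvd R p (a * b)"
    using p prime_product_closed by (auto simp: rdvd_def)
  then consider c where "c \<in> R" "a = p * c" | c where "c \<in> R" "b = p * c"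
    using prime_inD(4)[OF p(1) Suc.prems(2,3)] by (auto simp: rdvd_def)
  then show ?case
  proof cases
    case 1
    with p prime_inD(2)[OF p(1)] have "t = c * b" by simp
    then obtain l where "prime_product R l c"
      using Suc.IH[of c b] p(2) 1 Suc.prems by auto
    then have "prime_product R (1 + l) (p * c)"
      using prime_product_mult prime_product_prime p(1) by blast
    with 1 show ?thesis by blast
  next
    case 2
    with p prime_inD(2)[OF p(1)] have "t = a * c" by simp
    then show ?thesis
      using Suc.IH[of a c] p(2) 2 Suc.prems by auto
  qed
qed

text \<open>A prime \<open>p\<close> of the factorisation divides \<open>q\<close> or
  \<open>s\<close>. In the first case \<open>p\<close> and \<open>q\<close> are associated and the
  remaining factors are left up to a unit; in the second the induction applies to \<open>s\<close>
  divided by \<open>p\<close>. The strict decrease is what makes \<open>primitive_part\<close>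
  terminate.\<close>

lemma prime_product_cancel_prime:
  assumes "prime_product R k (q * s)" "prime_in R q" "s \<in> R"
  shows "\<exists>l<k. prime_product R l s"
  using assms
proof (induction k arbitrary: s)
  case 0
  then have "unit_in R q"
    by (intro unit_in_factor[OF prime_inD(1)[OF 0(2)] 0(3) prime_product_0])
  then show ?case
    using prime_inD(3)[OF 0(2)] by simp
next
  case (Suc k)
  obtain p t where p: "prime_in R p" "prime_product R k t" "q * s = p * t"
    using prime_product_Suc[OF Suc.prems(1)] .
  note p0 = prime_inD(1,2,3)[OF p(1)] and q0 = prime_inD(1,2,3)[OF Suc.prems(2)]
  have tR: "t \<in> R" using p prime_product_closed by blast
  have "rdvd R p (q * s)"
    using p tR by (auto simp: rdvd_def)
  then consider y where "y \<in> R" "q = p * y" | y where "y \<in> R" "s = p * y"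
    using prime_inD(4)[OF p(1) q0(1) Suc.prems(3)] by (auto simp: rdvd_def)
  then show ?case
  proof cases
    case 1
    have "rdvd R q (p * y)"
      using 1 by (auto simp: rdvd_def intro!: bexI[of _ 1])
    then consider z where "z \<in> R" "p = q * z" | z where "z \<in> R" "y = q * z"
      using prime_inD(4)[OF Suc.prems(2) p0(1) 1(1)] by (auto simp: rdvd_def)
    then show ?thesis
    proof cases
      fix z assume z: "z \<in> R" "p = q * z"
      have "q * 1 = q * (z * y)" using 1 z by (simp add: mult.assoc)
      then have zy: "z * y = 1" using q0 by (metis mult_cancel_left)
      have "q * s = q * (z * t)" using p(3) z by (simp add: mult.assoc)
      then have "s = z * t" using q0 by simp
      moreover have "unit_in R z" using zy z 1 by (auto simp: unit_in_def rdvd_def)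
      ultimately have "prime_product R (0 + k) s"
        using prime_product_mult prime_product_unit p(2) by blast
      then show ?thesis by auto
    next
      \<comment> \<open>This case is impossible: \<open>q = p * (q * z)\<close> makes the prime
        \<open>p\<close> a unit.\<close>
      fix z assume z: "z \<in> R" "y = q * z"
      have "q = p * (q * z)" using 1(2) unfolding z(2) .
      then have "q * 1 = q * (p * z)" by (simp add: mult.left_commute)
      then have "1 = p * z" using q0 by (metis mult_cancel_left)
      then show ?thesis using p0 z by (auto simp: unit_in_def rdvd_def)
    qed
  next
    case 2
    have "p * (q * y) = p * t" using 2 p(3) by (simp add: algebra_simps)
    then have "q * y = t" using p0 by simp
    then obtain l where "l < k" "prime_product R l y"
      using Suc.IH[of y] p(2) 2 Suc.prems by auto
    then have "prime_product R (1 + l) (p * y)"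
      using prime_product_mult prime_product_prime p(1) by blast
    with 2 \<open>l < k\<close> show ?thesis by auto
  qed
qed

end

text \<open>A prime factor \<open>q\<close> of the irreducible \<open>p\<close> leaves a unit as
  cofactor. So \<open>p\<close> and \<open>q\<close> have the same multiples, and primality of
  \<open>q\<close> carries over.\<close>

lemma ufd_in_irreducible_prime:
  assumes "ufd_in R" "p \<in> R" "p \<noteq> 0" "\<not> unit_in R p"
    and irr: "\<And>a b. a \<in> R \<Longrightarrow> b \<in> R \<Longrightarrow> p = a * b \<Longrightarrow> unit_in R a \<or> unit_in R b"
  shows "prime_in R p"
proof -
  interpret sub_ring R using assms by (simp add: ufd_in_def)
  obtain k where k: "prime_product R k p"
    using assms by (auto simp: ufd_in_def)
  obtain l where l: "k = Suc l"
    using k assms(4) prime_product_0 by (cases k) auto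
  obtain q t where q: "prime_in R q" "prime_product R l t" "p = q * t"
    using prime_product_Suc k l by metis
  have t: "t \<in> R" using q prime_product_closed by blast
  have "unit_in R t"
    using irr[OF prime_inD(1)[OF q(1)] t q(3)] prime_inD(3)[OF q(1)] by blast
  then obtain v where v: "v \<in> R" "t * v = 1"
    by (auto simp: unit_in_def rdvd_def)
  have rd: "rdvd R p a \<longleftrightarrow> rdvd R q a" for a
  proof
    assume "rdvd R p a"
    then obtain c where "c \<in> R" "a = q * (t * c)"
      by (auto simp: rdvd_def q(3) mult.assoc)
    with t show "rdvd R q a" unfolding rdvd_def by blast
  next
    assume "rdvd R q a"
    then obtain c where "c \<in> R" "a = q * c"
      by (auto simp: rdvd_def)
    moreover from this have "a = p * (v * c)"
      using v q(3) by (metis mult.assoc mult.right_neutral mult.commute)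
    ultimately show "rdvd R p a" using v unfolding rdvd_def by blast
  qed
  show ?thesis
    using q(1) assms(2-4) unfolding prime_in_def rd by blast
qed

section \<open>Polynomials with coefficients in a subring: Gauss's lemma and pseudo-division\<close>

definition polys_over :: "'a::zero set \<Rightarrow> 'a poly set" where
  "polys_over R = {p. \<forall>i. coeff p i \<in> R}"

lemma polys_overI [intro?]: "(\<And>i. coeff p i \<in> R) \<Longrightarrow> p \<in> polys_over R"
  by (simp add: polys_over_def)

lemma polys_overD [dest?]: "p \<in> polys_over R \<Longrightarrow> coeff p i \<in> R"
  by (simp add: polys_over_def)

context sub_ring
begin

lemma zero_in_polys_over [simp, intro]: "0 \<in> polys_over R"
  by (rule polys_overI) simp

lemma const_in_polys_over [simp]: "[:c:] \<in> polys_over R \<longleftrightarrow> c \<in> R"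
proof
  assume "[:c:] \<in> polys_over R"
  from polys_overD[OF this, of 0] show "c \<in> R" by simp
qed (auto simp: polys_over_def coeff_pCons split: nat.split)

lemma pCons_in_polys_over [simp]: "pCons c p \<in> polys_over R \<longleftrightarrow> c \<in> R \<and> p \<in> polys_over R"
  unfolding polys_over_def
proof safe
  assume *: "\<forall>i. coeff (pCons c p) i \<in> R"
  show "c \<in> R" using spec[OF *, of 0] by simp
  show "coeff p i \<in> R" for i using spec[OF *, of "Suc i"] by simp
qed (auto simp: coeff_pCons split: nat.split)

lemma monom_in_polys_over [simp]: "c \<in> R \<Longrightarrow> monom c n \<in> polys_over R"
  by (auto simp: polys_over_def)

lemma sub_ring_polys_over: "sub_ring (polys_over R)"
proof
  show "0 \<in> polys_over R" by simp
  show "1 \<in> polys_over R" by (rule polys_overI) simp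
  show "a - b \<in> polys_over R" if "a \<in> polys_over R" "b \<in> polys_over R" for a b
    using that by (auto simp: polys_over_def)
  show "a * b \<in> polys_over R" if "a \<in> polys_over R" "b \<in> polys_over R" for a b
    using that by (auto simp: polys_over_def coeff_mult intro!: sum_closed)
qed

interpretation polys: sub_ring "polys_over R"
  by (rule sub_ring_polys_over)

lemma smult_in_polys_over [simp, intro]:
  "c \<in> R \<Longrightarrow> p \<in> polys_over R \<Longrightarrow> smult c p \<in> polys_over R"
  by (auto simp: polys_over_def)

lemma rdvd_const_polys:
  assumes "f \<in> polys_over R" "q \<noteq> 0"
  shows "rdvd (polys_over R) [:q:] f \<longleftrightarrow> (\<forall>i. rdvd R q (coeff f i))"
proof
  assume "rdvd (polys_over R) [:q:] f"
  then show "\<forall>i. rdvd R q (coeff f i)"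
    by (auto simp: rdvd_def polys_over_def)
next
  assume "\<forall>i. rdvd R q (coeff f i)"
  then obtain c where c: "\<And>i. c i \<in> R" "\<And>i. coeff f i = q * c i"
    by (auto simp: rdvd_def) metis
  \<comment> \<open>Wait-free gluing of the chosen cofactors is possible because cancelling
    \<open>q\<close> forces them to vanish beyond the degree of \<open>f\<close>.\<close>
  define g where "g = (\<Sum>i\<le>degree f. monom (c i) i)"
  have "c i = 0" if "i > degree f" for i
    using c(2)[of i] that assms(2) by (simp add: coeff_eq_0)
  then have cg: "coeff g i = c i" for i
    unfolding g_def by (cases "i \<le> degree f") (auto simp: coeff_sum sum.delta)
  have "f = [:q:] * g"
    by (rule poly_eqI) (simp add: c cg)
  moreover have "g \<in> polys_over R"
    using c cg by (auto simp: polys_over_def)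
  ultimately show "rdvd (polys_over R) [:q:] f"
    by (auto simp: rdvd_def)
qed

lemma rdvd_sum: "(\<And>i. i \<in> A \<Longrightarrow> rdvd R q (f i)) \<Longrightarrow> rdvd R q (sum f A)"
proof (induction A rule: infinite_finite_induct)
  case (insert x F)
  obtain c e where "c \<in> R" "e \<in> R" "f x = q * c" "sum f F = q * e"
    using insert unfolding rdvd_def by blast
  then show ?case
    using insert by (auto simp: rdvd_def algebra_simps intro!: bexI[of _ "c + e"])
qed (auto simp: rdvd_def intro!: bexI[of _ 0])

lemma rdvd_mult_left: "rdvd R q a \<Longrightarrow> b \<in> R \<Longrightarrow> rdvd R q (a * b)"
  by (auto simp: rdvd_def mult.assoc)

lemma rdvd_mult_right: "rdvd R q a \<Longrightarrow> b \<in> R \<Longrightarrow> rdvd R q (b * a)"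
  by (metis rdvd_mult_left mult.commute)

lemma rdvd_diff: "rdvd R q a \<Longrightarrow> rdvd R q b \<Longrightarrow> rdvd R q (a - b)"
  unfolding rdvd_def by (metis diff_closed right_diff_distrib)

text \<open>Gauss's lemma. If \<open>i\<close> and \<open>j\<close> are the least indices of
  coefficients not divisible by \<open>q\<close>, then in coefficient \<open>i + j\<close> of the
  product every term except \<open>coeff f i * coeff g j\<close> is divisible by
  \<open>q\<close>.\<close>

lemma prime_in_const_poly:
  assumes q: "prime_in R q"
  shows "prime_in (polys_over R) [:q:]"
proof -
  note q0 = prime_inD(1-3)[OF q]
  have nu: "\<not> unit_in (polys_over R) [:q:]"
  proof
    assume "unit_in (polys_over R) [:q:]"
    then have "rdvd R q (coeff 1 0)"
      using rdvd_const_polys[of 1 q] q0 unfolding unit_in_def by blast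
    then have "rdvd R q 1" by simp
    with q0 show False by (simp add: unit_in_def)
  qed
  have "rdvd (polys_over R) [:q:] f \<or> rdvd (polys_over R) [:q:] g"
    if fg: "f \<in> polys_over R" "g \<in> polys_over R" "rdvd (polys_over R) [:q:] (f * g)" for f g
  proof (rule ccontr)
    assume "\<not> ?thesis"
    then obtain i' j' where "\<not> rdvd R q (coeff f i')" "\<not> rdvd R q (coeff g j')"
      using rdvd_const_polys[OF fg(1) q0(2)] rdvd_const_polys[OF fg(2) q0(2)] by auto
    then obtain i j where i: "\<not> rdvd R q (coeff f i)" "\<And>k. k < i \<Longrightarrow> rdvd R q (coeff f k)"
      and j: "\<not> rdvd R q (coeff g j)" "\<And>k. k < j \<Longrightarrow> rdvd R q (coeff g k)"
      using exists_least_iff[of "\<lambda>i. \<not> rdvd R q (coeff f i)"]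
        exists_least_iff[of "\<lambda>j. \<not> rdvd R q (coeff g j)"] by blast
    have fgR: "coeff f k \<in> R" "coeff g k \<in> R" for k
      using polys_overD[OF fg(1), of k] polys_overD[OF fg(2), of k] by simp_all
    define T where "T = (\<Sum>k\<in>{..i+j} - {i}. coeff f k * coeff g (i + j - k))"
    have "rdvd R q T"
      unfolding T_def
    proof (rule rdvd_sum)
      fix k assume k: "k \<in> {..i+j} - {i}"
      show "rdvd R q (coeff f k * coeff g (i + j - k))"
      proof (cases "k < i")
        case True
        then show ?thesis by (intro rdvd_mult_left i(2) fgR)
      next
        case False
        with k have "i + j - k < j" by auto
        then show ?thesis by (intro rdvd_mult_right j(2) fgR)
      qed
    qed
    moreover have "rdvd R q (coeff (f * g) (i + j))"
      using rdvd_const_polys[of "f * g" q] fg q0 by auto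
    moreover have "coeff (f * g) (i + j) = coeff f i * coeff g j + T"
      unfolding T_def coeff_mult by (subst sum.remove[of _ i]) auto
    ultimately have "rdvd R q (coeff f i * coeff g j)"
      using rdvd_diff by (metis add_diff_cancel_right')
    then show False
      using prime_inD(4)[OF q fgR(1) fgR(2)] i j by blast
  qed
  then show ?thesis
    using q0 nu by (auto simp: prime_in_def)
qed

text \<open>Without inverses, the leading term of \<open>p\<close> is cancelled only after
  multiplying \<open>p\<close> by the leading coefficient of \<open>h\<close>; these multipliers
  accumulate in \<open>s\<close>.\<close>

lemma pseudo_division:
  assumes "p \<in> polys_over R" "h \<in> polys_over R" "h \<noteq> 0"
  shows "\<exists>s q r. s \<in> R \<and> s \<noteq> 0 \<and> q \<in> polys_over R \<and> r \<in> polys_over R \<and>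
    smult s p = q * h + r \<and> (r = 0 \<or> degree r < degree h)"
  using assms
\<comment> \<open>The measure puts 0 below the nonzero constants: for constant \<open>p\<close> and
  \<open>h\<close> the reduction reaches 0 without lowering the degree.\<close>
proof (induction "if p = 0 then 0 else Suc (degree p)" arbitrary: p rule: less_induct)
  case less
  show ?case
  proof (cases "p = 0 \<or> degree p < degree h")
    case True
    then show ?thesis
      using less.prems
      by (intro exI[of _ 1] exI[of _ 0] exI[of _ p]) (auto simp: one_pCons)
  next
    case False
    define e where "e = degree p - degree h"
    define p' where "p' = smult (lead_coeff h) p - monom (lead_coeff p) e * h"
    have lcR: "lead_coeff h \<in> R" "lead_coeff p \<in> R"
      using less.prems by (auto dest: polys_overD)
    have p'R: "p' \<in> polys_over R"
      using less.prems lcR unfolding p'_def by auto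
    have "coeff (monom (lead_coeff p) e * h) (degree p) = lead_coeff p * lead_coeff h"
      using False by (simp add: e_def coeff_monom_mult)
    then have c0: "coeff p' (degree p) = 0"
      by (simp add: p'_def)
    have "degree (monom (lead_coeff p) e * h) \<le> degree p"
      using False degree_mult_le[of "monom (lead_coeff p) e" h] degree_monom_le[of "lead_coeff p" e]
      unfolding e_def by linarith
    then have "degree p' \<le> degree p"
      unfolding p'_def by (intro degree_diff_le) (auto intro: order_trans[OF degree_smult_le])
    with c0 have "p' = 0 \<or> degree p' < degree p"
      by (metis le_neq_implies_less leading_coeff_0_iff)
    then have "(if p' = 0 then 0 else Suc (degree p')) < (if p = 0 then 0 else Suc (degree p))"
      using False by auto
    then obtain s q r where *: "s \<in> R" "s \<noteq> 0" "q \<in> polys_over R" "r \<in> polys_over R"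
      "smult s p' = q * h + r" "r = 0 \<or> degree r < degree h"
      using less.hyps p'R less.prems by blast
    have "smult (s * lead_coeff h) p = (q + smult s (monom (lead_coeff p) e)) * h + r"
    proof -
      have "smult s (smult (lead_coeff h) p) = smult s p' + smult s (monom (lead_coeff p) e * h)"
        by (simp add: p'_def smult_diff_right)
      then show ?thesis
        using *(5) by (simp add: algebra_simps)
    qed
    moreover have "s * lead_coeff h \<in> R" "s * lead_coeff h \<noteq> 0"
      using * lcR less.prems by auto
    moreover have "q + smult s (monom (lead_coeff p) e) \<in> polys_over R"
      using * lcR by auto
    ultimately show ?thesis
      using * by blast
  qed
qed

text \<open>A substitute for the gcd over the fraction field: \<open>g\<close> is a nonzero
  combination of \<open>h\<close> and \<open>a\<close> of least degree. The pseudo-remainder of a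
  combination by \<open>g\<close> is again a combination, so it vanishes.\<close>

lemma ideal_generator:
  assumes h: "h \<in> polys_over R" "h \<noteq> 0" and a: "a \<in> polys_over R"
  obtains g u v s1 q1 s2 q2 where
    "g \<in> polys_over R" "g \<noteq> 0" "u \<in> polys_over R" "v \<in> polys_over R" "g = u * h + v * a"
    "s1 \<in> R" "s1 \<noteq> 0" "q1 \<in> polys_over R" "smult s1 h = q1 * g"
    "s2 \<in> R" "s2 \<noteq> 0" "q2 \<in> polys_over R" "smult s2 a = q2 * g"
proof -
  define I where "I = {g. g \<noteq> 0 \<and> (\<exists>u\<in>polys_over R. \<exists>v\<in>polys_over R. g = u * h + v * a)}"
  have "h \<in> I"
    unfolding I_def using h
    by (intro CollectI conjI bexI[of _ "1 :: 'a poly"] bexI[of _ "0 :: 'a poly"]) simp_all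
  then obtain g where g: "g \<in> I" "\<And>g'. g' \<in> I \<Longrightarrow> degree g \<le> degree g'"
    using exists_least_iff[of "\<lambda>n. \<exists>g\<in>I. degree g = n"] by (metis not_less)
  then obtain u v where uv: "u \<in> polys_over R" "v \<in> polys_over R" "g = u * h + v * a" "g \<noteq> 0"
    by (auto simp: I_def)
  have gP: "g \<in> polys_over R" using uv h a by auto
  have "\<exists>s q. s \<in> R \<and> s \<noteq> 0 \<and> q \<in> polys_over R \<and> smult s w = q * g"
    if w: "w = u' * h + v' * a" "u' \<in> polys_over R" "v' \<in> polys_over R" for w u' v'
  proof -
    have "w \<in> polys_over R" using w h a by auto
    then obtain s q r where *: "s \<in> R" "s \<noteq> 0" "q \<in> polys_over R" "r \<in> polys_over R"
      "smult s w = q * g + r" "r = 0 \<or> degree r < degree g"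
      using pseudo_division gP uv(4) by blast
    have "r = smult s w - q * g" using *(5) by simp
    also have "\<dots> = (smult s u' - q * u) * h + (smult s v' - q * v) * a"
      by (simp add: w(1) uv(3) algebra_simps smult_add_right)
    finally have "r = \<dots>" .
    then have "r \<noteq> 0 \<Longrightarrow> r \<in> I"
      unfolding I_def using w uv * by blast
    then have "r = 0" using g(2) *(6) by force
    with * show ?thesis by auto
  qed
  from this[of h 1 0] this[of a 0 1] show ?thesis
    using that gP uv by (auto simp: one_pCons)
qed

end

section \<open>Polynomial rings over factorial rings are factorial\<close>

locale ufd_poly = sub_ring R for R :: "'a::idom set" +
  assumes ufd: "ufd_in R"
begin

interpretation polys: sub_ring "polys_over R"
  by (rule sub_ring_polys_over)

definition primitive :: "'a poly \<Rightarrow> bool" where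
  "primitive h \<longleftrightarrow> (\<forall>q. prime_in R q \<longrightarrow> \<not> rdvd (polys_over R) [:q:] h)"

lemma prime_product_exists:
  assumes "s \<in> R" "s \<noteq> 0"
  obtains k where "prime_product R k s"
  using ufd assms by (auto simp: ufd_in_def)

lemma unit_in_const: "unit_in R u \<Longrightarrow> unit_in (polys_over R) [:u:]"
proof -
  assume "unit_in R u"
  then obtain v where "u \<in> R" "v \<in> R" "1 = u * v" by (auto simp: unit_in_def rdvd_def)
  then have "1 = [:u:] * [:v:]" "[:v:] \<in> polys_over R" "[:u:] \<in> polys_over R"
    by (simp_all add: one_pCons mult.commute)
  then show ?thesis unfolding unit_in_def rdvd_def by blast
qed

lemma prime_product_const:
  assumes "prime_product R k s"
  shows "prime_product (polys_over R) k [:s:]"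
proof -
  obtain u ps where *: "unit_in R u" "set ps \<subseteq> Collect (prime_in R)" "length ps = k"
      "s = u * prod_list ps"
    using assms unfolding prime_product_def by blast
  have "[:prod_list ps:] = prod_list (map (\<lambda>p. [:p:]) ps)"
  proof (induction ps)
    case (Cons p ps)
    have "[:p * prod_list ps:] = [:p:] * [:prod_list ps:]" by simp
    then show ?case using Cons by (simp only: list.map prod_list.Cons)
  qed (simp add: one_pCons)
  then show ?thesis
    unfolding prime_product_def
    by (intro exI[of _ "[:u:]"] exI[of _ "map (\<lambda>p. [:p:]) ps"])
      (use * in \<open>auto simp: unit_in_const prime_in_const_poly simp flip: \<open>[:prod_list ps:] = _\<close>\<close>)
qed

text \<open>Splitting off a prime constant removes a prime factor from the leading coefficient, so
  the induction runs on the number of these factors.\<close>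

lemma primitive_part:
  assumes "h \<in> polys_over R" "h \<noteq> 0"
  shows "\<exists>c h'. c \<in> R \<and> c \<noteq> 0 \<and> h' \<in> polys_over R \<and> primitive h' \<and> h = smult c h'"
proof -
  obtain k where "prime_product R k (lead_coeff h)"
    using prime_product_exists[of "lead_coeff h"] assms polys_overD[OF assms(1)] by auto
  then show ?thesis
    using assms
  proof (induction k arbitrary: h rule: less_induct)
    case (less k)
    show ?case
    proof (cases "primitive h")
      case True
      then show ?thesis
        using less.prems by (intro exI[of _ 1] exI[of _ h]) auto
    next
      case False
      then obtain q h1 where q: "prime_in R q" "h1 \<in> polys_over R" "h = [:q:] * h1"
        by (auto simp: primitive_def rdvd_def)
      note q0 = prime_inD(1,2)[OF q(1)]
      have "lead_coeff h = q * lead_coeff h1"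
        using q q0 by simp
      then have "\<exists>l<k. prime_product R l (lead_coeff h1)"
        using less.prems(1) q(1) polys_overD[OF q(2)] by (intro prime_product_cancel_prime) simp_all
      then obtain l where l: "l < k" "prime_product R l (lead_coeff h1)"
        by blast
      have "h1 \<noteq> 0" using q less.prems by auto
      then obtain c h' where "c \<in> R" "c \<noteq> 0" "h' \<in> polys_over R" "primitive h'" "h1 = smult c h'"
        using less.IH[OF l q(2)] by blast
      then show ?thesis
        using q q0 by (intro exI[of _ "q * c"] exI[of _ h']) (auto simp: mult.commute)
    qed
  qed
qed

text \<open>A prime factor \<open>q\<close> of \<open>c\<close> divides \<open>h\<close> times its
  cofactor. As a constant it is still prime and does not divide the primitive \<open>h\<close>, so
  it divides the cofactor and can be cancelled.\<close>

lemma primitive_cancel: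
  assumes "primitive h" "h \<in> polys_over R" "a \<in> polys_over R" "c \<in> R" "c \<noteq> 0"
    and "rdvd (polys_over R) h (smult c a)"
  shows "rdvd (polys_over R) h a"
proof -
  obtain k where "prime_product R k c"
    using prime_product_exists assms by blast
  then show ?thesis
    using assms(3-)
  proof (induction k arbitrary: c)
    case 0
    then have "unit_in R c" by (simp add: prime_product_0)
    then obtain v where v: "v \<in> R" "c * v = 1" by (auto simp: unit_in_def rdvd_def)
    obtain y where y: "y \<in> polys_over R" "smult c a = h * y"
      using 0 by (auto simp: rdvd_def)
    have "smult v (smult c a) = h * smult v y" using y by simp
    then have "a = h * smult v y" using v by (simp add: mult.commute)
    moreover have "smult v y \<in> polys_over R" using v y by simp
    ultimately show ?case unfolding rdvd_def by blast
  next
    case (Suc k)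
    obtain q t where q: "prime_in R q" "prime_product R k t" "c = q * t"
      using prime_product_Suc[OF Suc.prems(1)] .
    note q0 = prime_inD(1,2)[OF q(1)]
    have t: "t \<in> R" "t \<noteq> 0" using q prime_product_closed prime_product_nonzero by auto
    obtain y where y: "y \<in> polys_over R" "smult c a = h * y"
      using Suc.prems by (auto simp: rdvd_def)
    have "h * y = [:q:] * smult t a" using y(2) q(3) by (simp add: mult.commute)
    moreover have "smult t a \<in> polys_over R" using t Suc.prems by simp
    ultimately have "rdvd (polys_over R) [:q:] (h * y)"
      unfolding rdvd_def by blast
    then have "rdvd (polys_over R) [:q:] y"
      using prime_inD(4)[OF prime_in_const_poly[OF q(1)] assms(2) y(1)] assms(1) q(1)
      by (auto simp: primitive_def)
    then obtain y' where y': "y' \<in> polys_over R" "y = [:q:] * y'" by (auto simp: rdvd_def)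
    have "smult q (smult t a) = smult q (h * y')"
      using y y' q by simp
    then have "smult t a = h * y'"
      using q0 smult_cancel by blast
    then show ?case
      using Suc.IH[OF q(2) Suc.prems(2) t] y' by (auto simp: rdvd_def)
  qed
qed

text \<open>A positive-degree divisor of minimal degree is irreducible over the fraction field, and
  its primitive part is then prime over the ring.\<close>
lemma prime_divisor_exists:
  assumes s: "s \<in> polys_over R" "degree s > 0"
  obtains p y c where "prime_in (polys_over R) p" "degree p > 0" "y \<in> polys_over R"
    "c \<in> R" "c \<noteq> 0" "smult c s = p * y"
proof -
  define H where "H = {h \<in> polys_over R. degree h > 0 \<and>
    (\<exists>c\<in>R. c \<noteq> 0 \<and> rdvd (polys_over R) h (smult c s))}"
  have "s \<in> H"
    unfolding H_def using s by (auto simp: rdvd_def intro!: bexI[of _ 1])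
  then obtain h0 where h0: "h0 \<in> H" "\<And>g'. g' \<in> H \<Longrightarrow> degree h0 \<le> degree g'"
    using exists_least_iff[of "\<lambda>n. \<exists>g\<in>H. degree g = n"] by (metis not_less)
  from h0(1) obtain c0 y0 where c0: "c0 \<in> R" "c0 \<noteq> 0" "y0 \<in> polys_over R" "smult c0 s = h0 * y0"
    "h0 \<in> polys_over R" "degree h0 > 0"
    by (auto simp: H_def rdvd_def)
  obtain c p where p: "c \<in> R" "c \<noteq> 0" "p \<in> polys_over R" "primitive p" "h0 = smult c p"
    using primitive_part[of h0] c0 by fastforce
  have dp: "degree p = degree h0" "p \<noteq> 0" using p c0 by auto
  have py: "smult c0 s = p * smult c y0" using c0 p by simp
  have dvd_scaled: "h \<in> polys_over R \<Longrightarrow> degree h > 0 \<Longrightarrow> e \<in> R \<Longrightarrow> e \<noteq> 0 \<Longrightarrow>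
      rdvd (polys_over R) h (smult e p) \<Longrightarrow> degree p \<le> degree h" for h e
  proof -
    assume h: "h \<in> polys_over R" "degree h > 0" "e \<in> R" "e \<noteq> 0" "rdvd (polys_over R) h (smult e p)"
    then obtain z where z: "z \<in> polys_over R" "smult e p = h * z" by (auto simp: rdvd_def)
    have "smult (e * c0) s = smult e (smult c0 s)" by simp
    also have "\<dots> = smult e p * smult c y0" unfolding py by (simp add: algebra_simps)
    also have "\<dots> = h * (z * smult c y0)" using z by (simp add: algebra_simps)
    finally have "rdvd (polys_over R) h (smult (e * c0) s)"
      using z(1) p(1) c0(3) unfolding rdvd_def by blast
    moreover have "e * c0 \<in> R" "e * c0 \<noteq> 0" using h c0 by auto
    ultimately have "h \<in> H" using h(1,2) unfolding H_def by blast
    then show ?thesis using h0 dp by simp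
  qed
  have "rdvd (polys_over R) p a \<or> rdvd (polys_over R) p b"
    if ab: "a \<in> polys_over R" "b \<in> polys_over R" "rdvd (polys_over R) p (a * b)" for a b
  proof -
    obtain g u v s1 q1 s2 q2 where g:
      "g \<in> polys_over R" "g \<noteq> 0" "u \<in> polys_over R" "v \<in> polys_over R" "g = u * p + v * a"
      "s1 \<in> R" "s1 \<noteq> 0" "q1 \<in> polys_over R" "smult s1 p = q1 * g"
      "s2 \<in> R" "s2 \<noteq> 0" "q2 \<in> polys_over R" "smult s2 a = q2 * g"
      using ideal_generator[OF p(3) dp(2) ab(1)] by blast
    \<comment> \<open>If \<open>g\<close> is constant, \<open>p\<close> and \<open>a\<close> are
      coprime over the fraction field, and \<open>p\<close> divides a constant multiple of
      \<open>b\<close>. Otherwise the minimal degree of \<open>p\<close> makes \<open>q1\<close>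
      constant, and \<open>p\<close> divides a constant multiple of \<open>a\<close>. In both cases
      \<open>primitive_cancel\<close> removes the constant.\<close>
    show ?thesis
    proof (cases "degree g = 0")
      case True
      then obtain e where e: "g = [:e:]" by (auto elim: degree_eq_zeroE)
      obtain z where z: "z \<in> polys_over R" "a * b = p * z" using ab by (auto simp: rdvd_def)
      have "smult e b = g * b" using e by simp
      also have "\<dots> = u * p * b + v * (a * b)" by (simp add: g(5) algebra_simps)
      also have "\<dots> = p * (u * b + v * z)" by (simp add: z algebra_simps)
      finally have "rdvd (polys_over R) p (smult e b)"
        using z g ab by (auto simp: rdvd_def)
      then show ?thesis
        using primitive_cancel[OF p(4,3) ab(2), of e] g(1,2) unfolding e by auto
    next
      case False
      have "rdvd (polys_over R) g (smult s1 p)"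
        using g by (auto simp: rdvd_def mult.commute)
      then have "degree p \<le> degree g"
        using dvd_scaled g False by blast
      moreover have "degree p = degree q1 + degree g"
      proof -
        have "q1 \<noteq> 0" using g dp by auto
        then have "degree (smult s1 p) = degree q1 + degree g"
          using g(2,9) by (simp add: degree_mult_eq)
        then show ?thesis using g(7) by simp
      qed
      ultimately obtain e where e: "q1 = [:e:]" by (auto elim: degree_eq_zeroE)
      have e0: "e \<in> R" "e \<noteq> 0" using g e dp by auto
      have "smult (e * s2) a = q1 * (q2 * g)" using e g(13)[symmetric] by (simp add: mult.commute)
      also have "\<dots> = q2 * smult s1 p" using g(9) by simp
      also have "\<dots> = p * smult s1 q2" by (simp add: mult.commute)
      finally have "rdvd (polys_over R) p (smult (e * s2) a)"
        using g(6,12) unfolding rdvd_def by blast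
      then show ?thesis
        using primitive_cancel[OF p(4,3) ab(1), of "e * s2"] g e0 by auto
    qed
  qed
  moreover have "\<not> unit_in (polys_over R) p"
  proof
    assume "unit_in (polys_over R) p"
    then obtain z where z: "1 = p * z" by (auto simp: unit_in_def rdvd_def)
    then have "z \<noteq> 0" by auto
    then have "degree (p * z) > 0" using dp c0 by (simp add: degree_mult_eq)
    with z show False by (metis degree_1 less_irrefl)
  qed
  ultimately have "prime_in (polys_over R) p"
    using p dp by (auto simp: prime_in_def)
  then show ?thesis
    using that[OF _ _ _ c0(1,2) py] dp(1) c0(3,6) p(1) by simp
qed

text \<open>Only a constant multiple of \<open>s\<close> splits off a prime of positive degree. The
  cofactor has smaller degree, so this multiple is a product of primes, and by saturation its
  divisor \<open>s\<close> is one too.\<close>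

theorem ufd_in_polys_over: "ufd_in (polys_over R)"
  unfolding ufd_in_def
proof (intro conjI ballI impI sub_ring_polys_over)
  fix s assume "s \<in> polys_over R" "s \<noteq> 0"
  then show "\<exists>k. prime_product (polys_over R) k s"
  proof (induction "degree s" arbitrary: s rule: less_induct)
    case less
    show ?case
    proof (cases "degree s = 0")
      case True
      then obtain e where e: "s = [:e:]" by (auto elim: degree_eq_zeroE)
      then have "e \<in> R" "e \<noteq> 0" using less.prems by auto
      then show ?thesis
        unfolding e using prime_product_exists prime_product_const by metis
    next
      case False
      then obtain p y c where p: "prime_in (polys_over R) p" "degree p > 0" "y \<in> polys_over R"
        "c \<in> R" "c \<noteq> 0" "smult c s = p * y"
        using prime_divisor_exists less.prems by blast
      have "p \<noteq> 0" "y \<noteq> 0" using p less.prems by auto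
      then have "degree (smult c s) = degree p + degree y"
        using p(6) by (simp add: degree_mult_eq)
      then have "degree y < degree s" using p(2,5) by simp
      then obtain k where "prime_product (polys_over R) k y"
        using less.hyps[OF _ p(3) \<open>y \<noteq> 0\<close>] by blast
      then have "prime_product (polys_over R) (1 + k) (p * y)"
        using polys.prime_product_mult polys.prime_product_prime p(1) by blast
      then have "prime_product (polys_over R) (1 + k) (s * [:c:])"
        using p(6) by simp
      then show ?thesis
        using polys.prime_product_dvd[of "1 + k" s "[:c:]"] less.prems p(4) by simp
    qed
  qed
qed

end

text \<open>The common generator \<open>g\<close> turns out to be constant: \<open>d\<close> divides
  \<open>q1 * g\<close> but not \<open>g\<close>, so it divides \<open>q1\<close>, and cancelling
  \<open>d\<close> in \<open>smult s1 d = q1 * g\<close> leaves \<open>g\<close> as a divisor of a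
  constant. The constant \<open>s\<close> becomes invertible once the coefficients form a
  field.\<close>

lemma (in sub_ring) prime_bezout:
  assumes d: "prime_in (polys_over R) d" "degree d > 0"
    and w: "w \<in> polys_over R" "\<not> rdvd (polys_over R) d w"
  obtains s u v where "s \<in> R" "s \<noteq> 0" "u \<in> polys_over R" "v \<in> polys_over R" "u * d + v * w = [:s:]"
proof -
  interpret polys: sub_ring "polys_over R"
    by (rule sub_ring_polys_over)
  note d0 = prime_inD(1,2)[OF d(1)]
  obtain g u v s1 q1 s2 q2 where g:
    "g \<in> polys_over R" "g \<noteq> 0" "u \<in> polys_over R" "v \<in> polys_over R" "g = u * d + v * w"
    "s1 \<in> R" "s1 \<noteq> 0" "q1 \<in> polys_over R" "smult s1 d = q1 * g"
    "s2 \<in> R" "s2 \<noteq> 0" "q2 \<in> polys_over R" "smult s2 w = q2 * g"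
    using ideal_generator[OF d0 w(1)] by blast
  have no_const: "\<not> rdvd (polys_over R) d [:e:]" if "e \<noteq> 0" for e
  proof
    assume "rdvd (polys_over R) d [:e:]"
    then obtain z where z: "[:e:] = d * z" by (auto simp: rdvd_def)
    then have "z \<noteq> 0" using that by auto
    then have "degree (d * z) > 0" using d d0 by (simp add: degree_mult_eq)
    with z show False by (metis degree_pCons_0 less_irrefl)
  qed
  have "\<not> rdvd (polys_over R) d g"
  proof
    assume "rdvd (polys_over R) d g"
    then have "rdvd (polys_over R) d (smult s2 w)"
      using g polys.rdvd_mult_right by simp
    then have "rdvd (polys_over R) d ([:s2:] * w)" by simp
    then show False
      using prime_inD(4)[OF d(1) _ w(1), of "[:s2:]"] w(2) no_const[OF g(11)] g by auto
  qed
  moreover have "rdvd (polys_over R) d (q1 * g)"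
    using g by (auto simp: rdvd_def g(9)[symmetric] intro!: bexI[of _ "[:s1:]"])
  ultimately have "rdvd (polys_over R) d q1"
    using prime_inD(4)[OF d(1) g(8) g(1)] by blast
  then obtain z where z: "z \<in> polys_over R" "q1 = d * z" by (auto simp: rdvd_def)
  have "d * (z * g) = d * [:s1:]" using g(9) z by (simp add: algebra_simps)
  then have zg: "z * g = [:s1:]" using d0 by (metis mult_cancel_left)
  then have "z \<noteq> 0" using g by auto
  then have "degree z + degree g = 0" using zg g by (metis degree_mult_eq degree_pCons_0)
  then obtain e where e: "g = [:e:]" by (auto elim: degree_eq_zeroE)
  then show ?thesis using that[of e u v] g by auto
qed

section \<open>Multivariate polynomials in finitely many variables\<close>

definition ring_hom_on :: "('a::comm_ring_1 \<Rightarrow> 'b::comm_ring_1) \<Rightarrow> bool" where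
  "ring_hom_on h \<longleftrightarrow> h 0 = 0 \<and> h 1 = 1 \<and> (\<forall>a b. h (a + b) = h a + h b) \<and> (\<forall>a b. h (a * b) = h a * h b)"

lemma ring_hom_onD:
  assumes "ring_hom_on h"
  shows "h 0 = 0" "h 1 = 1" "h (a + b) = h a + h b" "h (a * b) = h a * h b"
    "h (- a) = - h a" "h (a - b) = h a - h b" "h (sum f A) = (\<Sum>i\<in>A. h (f i))"
    "h (prod f A) = (\<Prod>i\<in>A. h (f i))" "h (a ^ n) = h a ^ n" "h (of_int z) = of_int z"
proof -
  show *: "h 0 = 0" "h 1 = 1" "h (a + b) = h a + h b" "h (a * b) = h a * h b" for a b
    using assms by (auto simp: ring_hom_on_def)
  show **: "h (- a) = - h a" for a
    using *(3)[of "- a" a] *(1) by (simp add: eq_neg_iff_add_eq_0)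
  show ***: "h (a - b) = h a - h b" for a b
    using *(3)[of a "- b"] **[of b] by simp
  show "h (sum f A) = (\<Sum>i\<in>A. h (f i))"
    by (induction A rule: infinite_finite_induct) (auto simp: *)
  show "h (prod f A) = (\<Prod>i\<in>A. h (f i))"
    by (induction A rule: infinite_finite_induct) (auto simp: *)
  show "h (a ^ n) = h a ^ n"
    by (induction n) (auto simp: *)
  have "h (of_nat n) = of_nat n" for n
    by (induction n) (auto simp: *)
  then show "h (of_int z) = of_int z"
    by (cases z) (auto simp: * ** ***)
qed

definition power_product :: "(nat \<Rightarrow> 'b::comm_ring_1) \<Rightarrow> (nat \<Rightarrow>\<^sub>0 nat) \<Rightarrow> 'b" where
  "power_product s mo = (\<Prod>w\<in>Poly_Mapping.keys mo. s w ^ Poly_Mapping.lookup mo w)"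

text \<open>The homomorphism given by the universal property of polynomial rings. Shifts,
  restriction to a set of variables and separation of one variable are all instances of it.\<close>

definition mpoly_eval :: "('k::comm_ring_1 \<Rightarrow> 'b::comm_ring_1) \<Rightarrow> (nat \<Rightarrow> 'b) \<Rightarrow> 'k mpoly \<Rightarrow> 'b" where
  "mpoly_eval h s p = (\<Sum>mo\<in>Poly_Mapping.keys p. h (Poly_Mapping.lookup p mo) * power_product s mo)"

lemma power_product_superset:
  assumes "finite A" "Poly_Mapping.keys mo \<subseteq> A"
  shows "power_product s mo = (\<Prod>w\<in>A. s w ^ Poly_Mapping.lookup mo w)"
  unfolding power_product_def
  by (rule prod.mono_neutral_left) (use assms in \<open>auto simp: in_keys_iff\<close>)

lemma power_product_add: "power_product s (a + b) = power_product s a * power_product s b"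
proof -
  let ?A = "Poly_Mapping.keys a \<union> Poly_Mapping.keys b"
  have "power_product s (a + b) = (\<Prod>w\<in>?A. s w ^ Poly_Mapping.lookup (a + b) w)"
    by (rule power_product_superset) (use keys_add[of a b] in auto)
  also have "\<dots> = power_product s a * power_product s b"
    by (subst (1 2) power_product_superset[of ?A]) (auto simp: lookup_add power_add prod.distrib)
  finally show ?thesis .
qed

lemma power_product_0 [simp]: "power_product s 0 = 1"
  by (simp add: power_product_def)

lemma power_product_single [simp]: "power_product s (Poly_Mapping.single w e) = s w ^ e"
  by (simp add: power_product_def)

lemma sum_singles: "(p :: 'a \<Rightarrow>\<^sub>0 'b::comm_monoid_add) = (\<Sum>a\<in>Poly_Mapping.keys p. Poly_Mapping.single a (Poly_Mapping.lookup p a))"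
  by (rule poly_mapping_eqI) (auto simp: lookup_sum lookup_single when_def in_keys_iff sum.delta)

lemma mpoly_induct [case_names single add]:
  fixes p :: "'a::comm_ring_1 mpoly"
  assumes "\<And>mo c. P (Poly_Mapping.single mo c)" "\<And>p q. P p \<Longrightarrow> P q \<Longrightarrow> P (p + q)"
  shows "P p"
proof -
  have "P (\<Sum>a\<in>A. Poly_Mapping.single a (Poly_Mapping.lookup p a))" for A
    by (induction A rule: infinite_finite_induct)
      (auto intro: assms simp: assms(1)[of 0 0, simplified])
  then show ?thesis by (subst sum_singles)
qed

context
  fixes h :: "'k::comm_ring_1 \<Rightarrow> 'b::comm_ring_1"
  assumes h: "ring_hom_on h"
begin

lemma mpoly_eval_superset:
  assumes "finite A" "Poly_Mapping.keys p \<subseteq> A"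
  shows "mpoly_eval h s p = (\<Sum>mo\<in>A. h (Poly_Mapping.lookup p mo) * power_product s mo)"
  unfolding mpoly_eval_def
  by (rule sum.mono_neutral_left) (use assms in \<open>auto simp: in_keys_iff ring_hom_onD[OF h]\<close>)

lemma mpoly_eval_add: "mpoly_eval h s (p + q) = mpoly_eval h s p + mpoly_eval h s q"
proof -
  let ?A = "Poly_Mapping.keys p \<union> Poly_Mapping.keys q"
  have "mpoly_eval h s (p + q) = (\<Sum>mo\<in>?A. h (Poly_Mapping.lookup (p + q) mo) * power_product s mo)"
    by (rule mpoly_eval_superset) (use keys_add[of p q] in auto)
  also have "\<dots> = mpoly_eval h s p + mpoly_eval h s q"
    by (subst (1 2) mpoly_eval_superset[of ?A])
      (auto simp: lookup_add ring_hom_onD[OF h] distrib_right sum.distrib)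
  finally show ?thesis .
qed

lemma mpoly_eval_single [simp]:
  "mpoly_eval h s (Poly_Mapping.single mo c) = h c * power_product s mo"
  by (simp add: mpoly_eval_def ring_hom_onD[OF h])

lemma mpoly_eval_mult: "mpoly_eval h s (p * q) = mpoly_eval h s p * mpoly_eval h s q"
proof (induction p rule: mpoly_induct)
  case (single mo c)
  show ?case
    by (induction q rule: mpoly_induct)
      (simp_all add: mult_single power_product_add ring_hom_onD[OF h] distrib_left mpoly_eval_add algebra_simps)
qed (simp add: distrib_right mpoly_eval_add)

lemma ring_hom_mpoly_eval: "ring_hom_on (mpoly_eval h s)"
proof -
  have "mpoly_eval h s (Poly_Mapping.single 0 0) = 0" "mpoly_eval h s (Poly_Mapping.single 0 1) = 1"
    by (subst mpoly_eval_single, simp add: ring_hom_onD[OF h])+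
  then show ?thesis
    by (simp add: ring_hom_on_def mpoly_eval_add mpoly_eval_mult)
qed

lemma mpoly_eval_Const [simp]: "mpoly_eval h s (Const c) = h c"
  by (simp add: Const_def)

lemma mpoly_eval_Var [simp]: "mpoly_eval h s (Var w) = s w"
  by (simp add: Var_def ring_hom_onD[OF h])

end

lemma mpoly_eval_cong:
  assumes "\<And>w. w \<in> vars p \<Longrightarrow> s w = s' w"
  shows "mpoly_eval h s p = mpoly_eval h s' p"
  unfolding mpoly_eval_def power_product_def
  by (intro sum.cong prod.cong refl arg_cong2[where f = "(*)"] arg_cong2[where f = "(^)"])
    (use assms in \<open>auto simp: vars_def\<close>)

lemma hom_mpoly_eval:
  assumes "ring_hom_on g"
  shows "g (mpoly_eval h s p) = mpoly_eval (\<lambda>c. g (h c)) (\<lambda>w. g (s w)) p"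
  by (simp add: mpoly_eval_def power_product_def ring_hom_onD[OF assms])

lemma mpoly_eval_in_sub_ring:
  assumes "sub_ring S" "\<And>c. h c \<in> S" "\<And>w. w \<in> vars p \<Longrightarrow> s w \<in> S"
  shows "mpoly_eval h s p \<in> S"
proof -
  interpret sub_ring S by fact
  show ?thesis
    unfolding mpoly_eval_def power_product_def
    by (intro sum_closed mult_closed prod_closed power_closed assms) (auto simp: vars_def)
qed

lemma ring_hom_Const: "ring_hom_on Const"
  by (auto simp: ring_hom_on_def Const_def single_add mult_single)

lemma power_product_Var:
  "power_product Var mo = (Poly_Mapping.single mo 1 :: 'a::comm_ring_1 mpoly)"
proof (induction mo rule: update_induct)
  case const
  then show ?case by simp
next
  case (update f a b)
  have *: "Poly_Mapping.update a b f = f + Poly_Mapping.single a b"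
    by (rule poly_mapping_eqI)
      (use update in \<open>auto simp: lookup_add lookup_update lookup_single when_def in_keys_iff\<close>)
  have "Var a ^ b = (Poly_Mapping.single (Poly_Mapping.single a b) 1 :: 'a mpoly)" for b
  proof (induction b)
    case (Suc b)
    then show ?case by (simp add: Var_def mult_single flip: single_add)
  qed simp
  with update show ?case
    by (simp add: * power_product_add mult_single)
qed

lemma mpoly_eval_id: "mpoly_eval Const Var p = p"
proof -
  have "mpoly_eval Const Var p = (\<Sum>mo\<in>Poly_Mapping.keys p. Poly_Mapping.single mo (Poly_Mapping.lookup p mo))"
    by (simp add: mpoly_eval_def power_product_Var Const_def mult_single)
  then show ?thesis using sum_singles[of p] by simp
qed

section \<open>Polynomials in a prescribed set of variables\<close>

definition mpolys_in :: "nat set \<Rightarrow> 'k::field mpoly set" where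
  "mpolys_in V = {p. vars p \<subseteq> V}"

lemma vars_single: "vars (Poly_Mapping.single mo (c::'k::zero)) \<subseteq> Poly_Mapping.keys mo"
  by (auto simp: vars_def split: if_splits)

lemma sub_ring_mpolys_in: "sub_ring (mpolys_in V :: 'k::field mpoly set)"
proof
  show "(0 :: 'k mpoly) \<in> mpolys_in V" "(1 :: 'k mpoly) \<in> mpolys_in V"
    by (auto simp: mpolys_in_def vars_def)
  fix a b :: "'k mpoly"
  assume "a \<in> mpolys_in V" "b \<in> mpolys_in V"
  then have *: "\<And>mo. mo \<in> Poly_Mapping.keys a \<union> Poly_Mapping.keys b \<Longrightarrow> Poly_Mapping.keys mo \<subseteq> V"
    by (auto simp: mpolys_in_def vars_def)
  show "a - b \<in> mpolys_in V"
    using * keys_diff[of a b] by (fastforce simp: mpolys_in_def vars_def)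
  show "a * b \<in> mpolys_in V"
    unfolding mpolys_in_def vars_def
  proof (intro CollectI UN_least)
    fix mo assume "mo \<in> Poly_Mapping.keys (a * b)"
    then obtain m1 m2 where "m1 \<in> Poly_Mapping.keys a" "m2 \<in> Poly_Mapping.keys b" "mo = m1 + m2"
      using keys_mult[of a b] by blast
    then show "Poly_Mapping.keys mo \<subseteq> V"
      using *[of m1] *[of m2] keys_add[of m1 m2] by auto
  qed
qed

lemma mpolys_in_mono: "V \<subseteq> W \<Longrightarrow> p \<in> mpolys_in V \<Longrightarrow> p \<in> mpolys_in W"
  by (auto simp: mpolys_in_def)

lemma Const_in_mpolys_in [simp]: "Const c \<in> mpolys_in V"
  by (auto simp: mpolys_in_def Const_def vars_def split: if_splits)

lemma Var_in_mpolys_in [simp]: "w \<in> V \<Longrightarrow> Var w \<in> mpolys_in V"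
  by (auto simp: mpolys_in_def Var_def vars_def)

lemma of_int_in_mpolys_in [simp]: "of_int z \<in> mpolys_in V"
proof -
  have "(of_int z :: 'a mpoly) = Const (of_int z)"
    by (simp add: Const_def)
  then show ?thesis by simp
qed

lemma mpolys_in_empty:
  assumes "p \<in> mpolys_in {}"
  obtains c where "p = Const c"
proof -
  have "Poly_Mapping.lookup p mo = 0" if "mo \<noteq> 0" for mo
    using assms that by (force simp: mpolys_in_def vars_def in_keys_iff)
  then have "p = Const (Poly_Mapping.lookup p 0)"
    unfolding Const_def by (intro poly_mapping_eqI) (auto simp: lookup_single when_def)
  then show ?thesis using that by blast
qed

definition restrict_vars :: "nat set \<Rightarrow> 'k::field mpoly \<Rightarrow> 'k mpoly" where
  "restrict_vars V = mpoly_eval Const (\<lambda>w. if w \<in> V then Var w else 0)"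

lemma ring_hom_restrict_vars: "ring_hom_on (restrict_vars V)"
  unfolding restrict_vars_def by (rule ring_hom_mpoly_eval[OF ring_hom_Const])

lemma restrict_vars_in: "restrict_vars V p \<in> mpolys_in V"
  unfolding restrict_vars_def
  by (rule mpoly_eval_in_sub_ring[OF sub_ring_mpolys_in])
    (auto simp: sub_ring.zero_closed[OF sub_ring_mpolys_in])

lemma restrict_vars_id: "p \<in> mpolys_in V \<Longrightarrow> restrict_vars V p = p"
proof -
  assume "p \<in> mpolys_in V"
  then have "restrict_vars V p = mpoly_eval Const Var p"
    unfolding restrict_vars_def by (intro mpoly_eval_cong) (auto simp: mpolys_in_def)
  then show ?thesis by (simp add: mpoly_eval_id)
qed

text \<open>The retraction \<open>restrict_vars V\<close> fixes \<open>a\<close> and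
  \<open>b\<close> and carries any cofactor into the subring. Through this lemma the ambient
  \<open>dvd\<close> and \<open>irreducible\<close> can be used for finitely many variables.\<close>

lemma rdvd_mpolys_in:
  assumes "a \<in> mpolys_in V" "b \<in> mpolys_in V"
  shows "rdvd (mpolys_in V) a b \<longleftrightarrow> a dvd b"
proof
  assume "a dvd b"
  then obtain c where "b = a * c" by (rule dvdE)
  then have "b = a * restrict_vars V c"
    using ring_hom_onD(4)[OF ring_hom_restrict_vars, of V a c] assms restrict_vars_id by metis
  then show "rdvd (mpolys_in V) a b"
    using restrict_vars_in unfolding rdvd_def by blast
qed (auto simp: rdvd_def)

section \<open>Separating one variable\<close>

definition sep :: "nat \<Rightarrow> 'k::field mpoly \<Rightarrow> 'k mpoly poly" where
  "sep y = mpoly_eval (\<lambda>c. [:Const c:]) (\<lambda>w. if w = y then [:0, 1:] else [:Var w:])"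

lemma ring_hom_const_poly: "ring_hom_on (\<lambda>c::'a::comm_ring_1. [:c:])"
  by (auto simp: ring_hom_on_def one_pCons)

lemma ring_hom_comp: "ring_hom_on f \<Longrightarrow> ring_hom_on g \<Longrightarrow> ring_hom_on (\<lambda>x. f (g x))"
  by (auto simp: ring_hom_on_def)

lemma ring_hom_poly: "ring_hom_on (\<lambda>p. poly p (x::'a::comm_ring_1))"
  by (auto simp: ring_hom_on_def)

lemma ring_hom_sep: "ring_hom_on (sep y)"
  unfolding sep_def
  by (intro ring_hom_mpoly_eval ring_hom_comp[OF ring_hom_const_poly ring_hom_Const])

lemma poly_sep: "poly (sep y p) (Var y) = p"
proof -
  have "poly (sep y p) (Var y) =
      mpoly_eval Const (\<lambda>w. poly (if w = y then [:0, 1:] else [:Var w:]) (Var y)) p"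
    unfolding sep_def hom_mpoly_eval[OF ring_hom_poly] by simp
  also have "(\<lambda>w. poly (if w = y then [:0, 1:] else [:Var w:]) (Var y)) = Var"
    by (auto simp: fun_eq_iff)
  finally show ?thesis by (simp add: mpoly_eval_id)
qed

lemma sep_const: "p \<in> mpolys_in V \<Longrightarrow> y \<notin> V \<Longrightarrow> sep y p = [:p:]"
proof -
  assume *: "p \<in> mpolys_in V" "y \<notin> V"
  have "sep y p = mpoly_eval (\<lambda>c. [:Const c:]) (\<lambda>w. [:Var w:]) p"
    unfolding sep_def by (rule mpoly_eval_cong) (use * in \<open>auto simp: mpolys_in_def\<close>)
  also have "\<dots> = [:mpoly_eval Const Var p:]"
    using hom_mpoly_eval[OF ring_hom_const_poly, of Const Var p] by simp
  finally show ?thesis by (simp add: mpoly_eval_id)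
qed

lemma sep_Var: "sep y (Var y :: 'k::field mpoly) = [:0, 1:]"
  unfolding sep_def
  by (subst mpoly_eval_Var[OF ring_hom_comp[OF ring_hom_const_poly ring_hom_Const]]) simp

lemma sep_in_polys_over:
  assumes "p \<in> mpolys_in (insert y V)"
  shows "sep y p \<in> polys_over (mpolys_in V)"
proof -
  interpret sub_ring "mpolys_in V :: 'a mpoly set" by (rule sub_ring_mpolys_in)
  have "w \<in> insert y V" if "w \<in> vars p" for w
    using assms that by (auto simp: mpolys_in_def)
  then show ?thesis
    unfolding sep_def
    by (intro mpoly_eval_in_sub_ring[OF sub_ring_polys_over]) (auto intro!: Var_in_mpolys_in)
qed

lemma poly_in_mpolys_in:
  assumes "q \<in> polys_over (mpolys_in V)"
  shows "poly q (Var y) \<in> mpolys_in (insert y V)"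
proof -
  interpret sub_ring "mpolys_in (insert y V) :: 'a mpoly set" by (rule sub_ring_mpolys_in)
  have "coeff q i \<in> mpolys_in (insert y V)" for i
    using mpolys_in_mono polys_overD[OF assms] by blast
  then show ?thesis
    unfolding poly_altdef by (intro sum_closed) auto
qed

text \<open>Together with \<open>poly_sep\<close> this makes \<open>sep y\<close> and evaluation at
  \<open>Var y\<close> mutually inverse. The coefficients avoid \<open>y\<close> because evaluation
  would merge a \<open>Var y\<close> inside a coefficient with the polynomial variable.\<close>

lemma sep_poly:
  assumes "q \<in> polys_over (mpolys_in V)" "y \<notin> V"
  shows "sep y (poly q (Var y)) = q"
  using assms(1)
proof (induction q)
  case 0
  then show ?case by (simp add: ring_hom_onD[OF ring_hom_sep])
next
  case (pCons a q)
  interpret sub_ring "mpolys_in V :: 'a mpoly set" by (rule sub_ring_mpolys_in)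
  from pCons have "a \<in> mpolys_in V" "q \<in> polys_over (mpolys_in V)" by auto
  then show ?case
    using pCons.IH by (simp add: ring_hom_onD[OF ring_hom_sep] sep_Var sep_const[OF _ assms(2)])
qed

text \<open>\<open>f\<close> and \<open>g\<close> are homomorphisms of the ambient types but inverse
  to each other only between \<open>R\<close> and \<open>R'\<close>: evaluation at
  \<open>Var y\<close>, the intended \<open>f\<close>, is not injective on all polynomials.\<close>

lemma ufd_in_iso:
  fixes f :: "'a::idom \<Rightarrow> 'b::idom"
  assumes f: "ring_hom_on f" and g: "ring_hom_on g" and R': "sub_ring R'"
    and fR: "\<And>a. a \<in> R \<Longrightarrow> f a \<in> R'" "\<And>a. a \<in> R \<Longrightarrow> g (f a) = a"
    and gR: "\<And>b. b \<in> R' \<Longrightarrow> g b \<in> R" "\<And>b. b \<in> R' \<Longrightarrow> f (g b) = b"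
    and "ufd_in R"
  shows "ufd_in R'"
proof -
  have rd: "rdvd R' (f a) b \<longleftrightarrow> rdvd R a (g b)" if "a \<in> R" "b \<in> R'" for a b
    unfolding rdvd_def
    by (metis that fR gR ring_hom_onD(4)[OF f] ring_hom_onD(4)[OF g])
  have g1: "g 1 = 1" and one: "1 \<in> R'" and times: "\<And>a b. a \<in> R' \<Longrightarrow> b \<in> R' \<Longrightarrow> a * b \<in> R'"
    using ring_hom_onD(2)[OF g] R' by (auto simp: sub_ring_def)
  have un: "unit_in R' (f a)" if "unit_in R a" for a
    using that rd[of a 1] g1 one fR by (auto simp: unit_in_def)
  have un': "unit_in R a" if "unit_in R' (f a)" "a \<in> R" for a
    using that rd[of a 1] g1 one fR by (auto simp: unit_in_def)
  have pr: "prime_in R' (f p)" if p: "prime_in R p" for p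
  proof -
    note p0 = prime_inD[OF p]
    have "f p \<noteq> 0" using fR(2)[OF p0(1)] p0(2) ring_hom_onD(1)[OF g] by auto
    moreover have "rdvd R' (f p) a \<or> rdvd R' (f p) b"
      if "a \<in> R'" "b \<in> R'" "rdvd R' (f p) (a * b)" for a b
      using that p0(4)[of "g a" "g b"] rd p0(1) gR times by (simp add: ring_hom_onD(4)[OF g])
    ultimately show ?thesis
      using fR(1)[OF p0(1)] un'[OF _ p0(1)] p0(3) by (auto simp: prime_in_def)
  qed
  have "\<exists>n. prime_product R' n s" if s: "s \<in> R'" "s \<noteq> 0" for s
  proof -
    have "g s \<noteq> 0" using gR(2)[OF s(1)] s(2) ring_hom_onD(1)[OF f] by auto
    then obtain n where "prime_product R n (g s)"
      using \<open>ufd_in R\<close> gR(1)[OF s(1)] by (auto simp: ufd_in_def)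
    then obtain u ps where *: "unit_in R u" "set ps \<subseteq> Collect (prime_in R)" "length ps = n"
      "g s = u * prod_list ps"
      unfolding prime_product_def by blast
    have "f (prod_list ps) = prod_list (map f ps)"
      by (induction ps) (auto simp: ring_hom_onD[OF f])
    then have "s = f u * prod_list (map f ps)"
      using *(4) gR(2)[OF s(1)] by (metis ring_hom_onD(4)[OF f])
    then have "prime_product R' n s"
      unfolding prime_product_def using * un pr
      by (intro exI[of _ "f u"] exI[of _ "map f ps"]) auto
    then show ?thesis by blast
  qed
  then show ?thesis using R' by (simp add: ufd_in_def)
qed

text \<open>Variables are adjoined one at a time through \<open>sep\<close>. Without variables every
  nonzero element is a unit, that is, a product of no primes.\<close>

theorem ufd_in_mpolys_in:
  assumes "finite V"
  shows "ufd_in (mpolys_in V :: 'k::field mpoly set)"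
  using assms
proof (induction V rule: finite_induct)
  case empty
  have "prime_product (mpolys_in {}) 0 s" if s: "s \<in> mpolys_in {}" "s \<noteq> 0" for s :: "'k mpoly"
  proof -
    obtain c where c: "s = Const c" using mpolys_in_empty s by blast
    then have "c \<noteq> 0" using s ring_hom_onD(1)[OF ring_hom_Const] by auto
    then have "1 = s * Const (1 / c)"
      unfolding c by (simp add: ring_hom_onD[OF ring_hom_Const] flip: ring_hom_onD(4)[OF ring_hom_Const])
    then have "unit_in (mpolys_in {}) s"
      using s unfolding unit_in_def rdvd_def by (metis Const_in_mpolys_in)
    then show ?thesis
      by (rule sub_ring.prime_product_unit[OF sub_ring_mpolys_in])
  qed
  then show ?case
    using sub_ring_mpolys_in by (auto simp: ufd_in_def)
next
  case (insert y V)
  interpret ufd_poly "mpolys_in V :: 'k mpoly set"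
    using insert.IH sub_ring_mpolys_in by (simp add: ufd_poly_def ufd_poly_axioms_def)
  show ?case
    by (rule ufd_in_iso[OF ring_hom_poly[of "Var y"] ring_hom_sep[of y] sub_ring_mpolys_in _ _ _ _
        ufd_in_polys_over])
      (auto simp: poly_in_mpolys_in sep_poly[OF _ insert.hyps(2)] sep_in_polys_over poly_sep)
qed

text \<open>Irreducibility in all variables descends to the subring, since an element of the subring
  is a unit there exactly if it is an ambient unit.\<close>

lemma irreducible_prime_in:
  assumes "finite W" "d \<in> mpolys_in W" "irreducible d"
  shows "prime_in (mpolys_in W) d"
proof (rule ufd_in_irreducible_prime[OF ufd_in_mpolys_in])
  interpret sub_ring "mpolys_in W :: 'a mpoly set" by (rule sub_ring_mpolys_in)
  have unit: "unit_in (mpolys_in W) a \<longleftrightarrow> a dvd 1" if "a \<in> mpolys_in W" for a :: "'a mpoly"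
    using that rdvd_mpolys_in[of a W 1] by (auto simp: unit_in_def)
  show "d \<noteq> 0" "\<not> unit_in (mpolys_in W) d"
    using assms unit by (auto simp: irreducible_def)
  show "unit_in (mpolys_in W) a \<or> unit_in (mpolys_in W) b"
    if "a \<in> mpolys_in W" "b \<in> mpolys_in W" "d = a * b" for a b
    using that assms unit by (auto simp: irreducible_def)
qed (use assms in auto)

lemma irreducible_dvd_mult:
  assumes "finite W" "d \<in> mpolys_in W" "irreducible d" "a \<in> mpolys_in W" "b \<in> mpolys_in W"
    and "d dvd a * b"
  shows "d dvd a \<or> d dvd b"
  using prime_inD(4)[OF irreducible_prime_in[OF assms(1-3)] assms(4,5)] assms
    rdvd_mpolys_in sub_ring.mult_closed[OF sub_ring_mpolys_in] by blast

text \<open>Needed to identify the degree of \<open>sep 1 p\<close> with \<open>degx1 p\<close>,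
  which is defined by exponents. Each monomial is split into a power of \<open>y\<close> and a part
  \<open>mb\<close> free of \<open>y\<close>.\<close>

lemma lookup_coeff_sep:
  "Poly_Mapping.lookup (coeff (sep y p) i) mo =
    (if y \<in> Poly_Mapping.keys mo then 0 else Poly_Mapping.lookup p (mo + Poly_Mapping.single y i))"
proof (induction p rule: mpoly_induct)
  case (single ma c)
  define e where "e = Poly_Mapping.lookup ma y"
  define mb where "mb = ma - Poly_Mapping.single y e"
  have lmb: "Poly_Mapping.lookup mb w = (if w = y then 0 else Poly_Mapping.lookup ma w)" for w
    by (auto simp: mb_def lookup_minus lookup_single when_def e_def)
  have ma: "ma = mb + Poly_Mapping.single y e"
    by (rule poly_mapping_eqI) (auto simp: lookup_add lmb lookup_single when_def e_def)
  have y: "y \<notin> Poly_Mapping.keys mb" by (simp add: in_keys_iff lmb)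
  have "(Poly_Mapping.single ma c :: 'a mpoly) = Poly_Mapping.single mb c * Var y ^ e"
  proof -
    have "(Var y ^ e :: 'a mpoly) = Poly_Mapping.single (Poly_Mapping.single y e) 1"
      using power_product_Var[of "Poly_Mapping.single y e"] by simp
    then show ?thesis by (simp add: mult_single ma)
  qed
  moreover have "sep y (Poly_Mapping.single mb c) = [:Poly_Mapping.single mb c:]"
    by (rule sep_const[of _ "- {y}"]) (use y vars_single[of mb c] in \<open>auto simp: mpolys_in_def\<close>)
  ultimately have "sep y (Poly_Mapping.single ma c) = monom (Poly_Mapping.single mb c) e"
    by (simp add: ring_hom_onD[OF ring_hom_sep] sep_Var monom_altdef)
  moreover have "mb = mo \<and> e = i \<longleftrightarrow> ma = mo + Poly_Mapping.single y i \<and> y \<notin> Poly_Mapping.keys mo"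
  proof safe
    assume *: "ma = mo + Poly_Mapping.single y i" "y \<notin> Poly_Mapping.keys mo"
    show "e = i" using * by (simp add: e_def lookup_add in_keys_iff)
    show "mb = mo"
      by (rule poly_mapping_eqI)
        (use * in \<open>auto simp: lmb lookup_add lookup_single when_def in_keys_iff\<close>)
  qed (use ma y in auto)
  ultimately show ?case
    by (auto simp: lookup_single when_def)
qed (simp add: ring_hom_onD[OF ring_hom_sep] lookup_add)

lemma degree_sep: "degree (sep 1 p) = degx1 p"
proof (rule antisym)
  have fin: "finite (insert 0 ((\<lambda>mo. Poly_Mapping.lookup mo 1) ` Poly_Mapping.keys p))"
    "insert 0 ((\<lambda>mo. Poly_Mapping.lookup mo 1) ` Poly_Mapping.keys p) \<noteq> {}" by simp_all
  show "degree (sep 1 p) \<le> degx1 p"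
  proof (rule degree_le, intro allI impI)
    fix i assume i: "degx1 p < i"
    show "coeff (sep 1 p) i = 0"
    proof (rule poly_mapping_eqI)
      fix mo
      show "Poly_Mapping.lookup (coeff (sep 1 p) i) mo = Poly_Mapping.lookup 0 mo"
      proof (cases "1 \<in> Poly_Mapping.keys mo")
        case False
        then have "Poly_Mapping.lookup (mo + Poly_Mapping.single 1 i) 1 = i"
          by (simp add: lookup_add in_keys_iff)
        then have "mo + Poly_Mapping.single 1 i \<notin> Poly_Mapping.keys p"
          using i Max_ge[OF fin(1)] unfolding degx1_def by (metis image_eqI insertCI not_le)
        then show ?thesis by (auto simp: lookup_coeff_sep in_keys_iff)
      qed (simp add: lookup_coeff_sep)
    qed
  qed
  show "degx1 p \<le> degree (sep 1 p)"
    unfolding degx1_def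
  proof (rule Max.boundedI[OF fin])
    fix e assume "e \<in> insert 0 ((\<lambda>mo. Poly_Mapping.lookup mo 1) ` Poly_Mapping.keys p)"
    then consider "e = 0" | ma where "ma \<in> Poly_Mapping.keys p" "e = Poly_Mapping.lookup ma 1" by auto
    then show "e \<le> degree (sep 1 p)"
    proof cases
      case 2
      define mo where "mo = ma - Poly_Mapping.single 1 e"
      have "ma = mo + Poly_Mapping.single 1 e" "1 \<notin> Poly_Mapping.keys mo"
        by (auto simp: mo_def poly_mapping_eq_iff fun_eq_iff lookup_add lookup_minus lookup_single
            when_def 2 in_keys_iff)
      then have "Poly_Mapping.lookup (coeff (sep 1 p) e) mo \<noteq> 0"
        using 2 by (simp add: lookup_coeff_sep in_keys_iff)
      then show ?thesis by (metis le_degree lookup_zero)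
    qed simp
  qed
qed

section \<open>Shifts\<close>

lemma shift_poly_eval: "shift_poly k = mpoly_eval Const (\<lambda>w. Var w + of_int (k w))"
  by (rule ext) (simp add: shift_poly_def mpoly_eval_def power_product_def)

lemma ring_hom_shift_poly: "ring_hom_on (shift_poly k)"
  unfolding shift_poly_eval by (rule ring_hom_mpoly_eval[OF ring_hom_Const])

lemma shift_poly_add: "shift_poly k (shift_poly k' p) = shift_poly (\<lambda>w. k w + k' w) p"
proof -
  have C: "shift_poly k (Const c) = Const c" for c :: 'a
    by (simp add: shift_poly_eval mpoly_eval_Const[OF ring_hom_Const])
  have V: "shift_poly k (Var w + of_int (k' w)) = Var w + of_int (k w + k' w)" for w
    by (simp add: ring_hom_onD[OF ring_hom_shift_poly])
      (simp add: shift_poly_eval mpoly_eval_Var[OF ring_hom_Const])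
  show ?thesis
    unfolding shift_poly_eval[of k'] hom_mpoly_eval[OF ring_hom_shift_poly] C V
    by (simp only: shift_poly_eval)
qed

lemma shift_poly_id:
  assumes "\<And>w. w \<in> vars p \<Longrightarrow> k w = 0"
  shows "shift_poly k p = p"
proof -
  have "shift_poly k p = mpoly_eval Const Var p"
    unfolding shift_poly_eval by (rule mpoly_eval_cong) (use assms in auto)
  then show ?thesis by (simp add: mpoly_eval_id)
qed

lemma shift_poly_uminus: "shift_poly k (shift_poly (\<lambda>w. - k w) p) = p"
  "shift_poly (\<lambda>w. - k w) (shift_poly k p) = p"
  by (simp_all add: shift_poly_add shift_poly_id)

lemma shift_poly_eq_0_iff [simp]: "shift_poly k p = 0 \<longleftrightarrow> p = 0"
  by (metis ring_hom_onD(1)[OF ring_hom_shift_poly] shift_poly_uminus(2))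

lemma shift_poly_in: "p \<in> mpolys_in V \<Longrightarrow> shift_poly k p \<in> mpolys_in V"
proof -
  assume *: "p \<in> mpolys_in V"
  interpret sub_ring "mpolys_in V :: 'a mpoly set" by (rule sub_ring_mpolys_in)
  have "w \<in> V" if "w \<in> vars p" for w
    using * that by (auto simp: mpolys_in_def)
  then show ?thesis
    unfolding shift_poly_eval
    by (intro mpoly_eval_in_sub_ring[OF sub_ring_mpolys_in]) (auto intro!: Var_in_mpolys_in)
qed

lemma shift_poly_dvd_iff [simp]: "shift_poly k p dvd shift_poly k q \<longleftrightarrow> p dvd q"
proof -
  have "shift_poly k p dvd shift_poly k q" if "p dvd q" for k and p q :: "'a mpoly"
    using that by (auto simp: dvd_def ring_hom_onD[OF ring_hom_shift_poly])
  then show ?thesis by (metis shift_poly_uminus(2))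
qed

lemma irreducible_shift_poly:
  assumes "irreducible p"
  shows "irreducible (shift_poly k p)"
proof (rule irreducibleI)
  note hom = ring_hom_onD[OF ring_hom_shift_poly]
  have un: "shift_poly k p dvd 1 \<longleftrightarrow> p dvd 1" for k and p :: "'a mpoly"
    using shift_poly_dvd_iff[of k p 1] by (simp only: hom)
  show "shift_poly k p \<noteq> 0" "\<not> shift_poly k p dvd 1"
    using assms by (auto simp: un irreducible_def)
  fix a b assume "shift_poly k p = a * b"
  then have "p = shift_poly (\<lambda>w. - k w) a * shift_poly (\<lambda>w. - k w) b"
    by (metis hom(4) shift_poly_uminus(2))
  then show "a dvd 1 \<or> b dvd 1"
    using irreducibleD[OF assms] un by blast
qed

section \<open>Leading monomials in the lexicographic order and their behaviour under shifts\<close>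

lemma poly_mapping_nat_ge_0: "(0 :: nat \<Rightarrow>\<^sub>0 nat) \<le> mo"
proof (rule ccontr)
  assume "\<not> 0 \<le> mo"
  then have "mo < 0" by simp
  then show False
    by (transfer) (auto simp: less_fun_def)
qed

text \<open>Once the terms at \<open>a\<close> and \<open>b\<close> are split off, every other
  product of terms has a monomial strictly below \<open>a + b\<close>.\<close>

lemma lookup_mult_max:
  fixes p q :: "'k::comm_ring_1 mpoly"
  assumes "\<And>mo. mo \<in> Poly_Mapping.keys p \<Longrightarrow> mo \<le> a" "\<And>mo. mo \<in> Poly_Mapping.keys q \<Longrightarrow> mo \<le> b"
  shows "Poly_Mapping.lookup (p * q) (a + b) = Poly_Mapping.lookup p a * Poly_Mapping.lookup q b"
    and "mo \<in> Poly_Mapping.keys (p * q) \<Longrightarrow> mo \<le> a + b"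
proof -
  define p' where "p' = p - Poly_Mapping.single a (Poly_Mapping.lookup p a)"
  define q' where "q' = q - Poly_Mapping.single b (Poly_Mapping.lookup q b)"
  have p': "mo < a" if "mo \<in> Poly_Mapping.keys p'" for mo
    using that assms(1)[of mo]
    by (force simp: p'_def in_keys_iff lookup_minus lookup_single when_def order_le_less split: if_splits)
  have q': "mo < b" if "mo \<in> Poly_Mapping.keys q'" for mo
    using that assms(2)[of mo]
    by (force simp: q'_def in_keys_iff lookup_minus lookup_single when_def order_le_less split: if_splits)
  have "a + b \<notin> Poly_Mapping.keys (p' * q)"
  proof
    assume "a + b \<in> Poly_Mapping.keys (p' * q)"
    then obtain s t where "s \<in> Poly_Mapping.keys p'" "t \<in> Poly_Mapping.keys q" "a + b = s + t"
      using keys_mult by blast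
    then show False
      using add_less_le_mono[OF p'[of s] assms(2)[of t]] by simp
  qed
  moreover have "a + b \<notin> Poly_Mapping.keys (Poly_Mapping.single a (Poly_Mapping.lookup p a) * q')"
  proof
    assume "a + b \<in> Poly_Mapping.keys (Poly_Mapping.single a (Poly_Mapping.lookup p a) * q')"
    then obtain s t where "s \<in> Poly_Mapping.keys (Poly_Mapping.single a (Poly_Mapping.lookup p a))"
        "t \<in> Poly_Mapping.keys q'" "a + b = s + t"
      using keys_mult by blast
    then show False using q'[of t] by (auto split: if_splits)
  qed
  moreover have "p * q = Poly_Mapping.single (a + b) (Poly_Mapping.lookup p a * Poly_Mapping.lookup q b)
      + Poly_Mapping.single a (Poly_Mapping.lookup p a) * q' + p' * q"
    unfolding mult_single[symmetric] p'_def q'_def by (simp add: algebra_simps)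
  ultimately show "Poly_Mapping.lookup (p * q) (a + b) = Poly_Mapping.lookup p a * Poly_Mapping.lookup q b"
    by (simp add: lookup_add in_keys_iff)
  show "mo \<le> a + b" if mo: "mo \<in> Poly_Mapping.keys (p * q)"
  proof -
    obtain s t where "s \<in> Poly_Mapping.keys p" "t \<in> Poly_Mapping.keys q" "mo = s + t"
      using keys_mult mo by blast
    then show ?thesis using assms add_mono by blast
  qed
qed

lemma shift_power_product:
  fixes k :: "nat \<Rightarrow> int"
  defines "P \<equiv> power_product (\<lambda>w. Var w + of_int (k w) :: 'k::comm_ring_1 mpoly)"
  shows "Poly_Mapping.lookup (P mo) mo = 1 \<and> (\<forall>ma\<in>Poly_Mapping.keys (P mo). ma \<le> mo)"
proof -
  \<comment> \<open>\<open>LM mo p\<close> says that \<open>p\<close> is monic with leading monomial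
    \<open>mo\<close>. It holds for a shifted variable and is multiplicative, hence holds for
    shifted monomials.\<close>
  define LM :: "(nat \<Rightarrow>\<^sub>0 nat) \<Rightarrow> 'k mpoly \<Rightarrow> bool" where
    "LM mo p \<longleftrightarrow> Poly_Mapping.lookup p mo = 1 \<and> (\<forall>ma\<in>Poly_Mapping.keys p. ma \<le> mo)" for mo p
  have LM_1: "LM 0 1" by (simp add: LM_def lookup_one)
  have LM_mult: "LM (a + b) (p * q)" if "LM a p" "LM b q" for a b p q
    using that lookup_mult_max[of p a q b] by (auto simp: LM_def)
  have LM_var: "LM (Poly_Mapping.single w 1) (Var w + of_int (k w))" for w
  proof -
    have "LM (Poly_Mapping.single w 1) (Var w + Poly_Mapping.single 0 c)" for c
    proof -
      have "Poly_Mapping.single w (1::nat) \<noteq> 0"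
        by (metis lookup_single_eq lookup_zero zero_neq_one)
      then show ?thesis
        using poly_mapping_nat_ge_0
        by (auto simp: LM_def Var_def in_keys_iff lookup_add lookup_single when_def split: if_splits)
    qed
    from this[of "of_int (k w)"] show ?thesis by simp
  qed
  have LM_pow: "LM (Poly_Mapping.single w e) ((Var w + of_int (k w)) ^ e)" for w e
  proof (induction e)
    case (Suc e)
    then show ?case using LM_mult[OF LM_var[of w] Suc] by (simp flip: single_add)
  qed (simp add: LM_1)
  have "LM mo (P mo)"
  proof (induction mo rule: update_induct)
    case (update f a b)
    have "Poly_Mapping.update a b f = Poly_Mapping.single a b + f"
      by (rule poly_mapping_eqI)
        (use update in \<open>auto simp: lookup_add lookup_update lookup_single when_def in_keys_iff\<close>)
    then show ?case
      using LM_mult[OF LM_pow[of a b] update(3)] by (simp add: P_def power_product_add)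
  qed (simp add: P_def LM_1)
  then show ?thesis by (simp add: LM_def)
qed

text \<open>A shift replaces each monomial by itself plus smaller ones, so only the monomial
  \<open>a\<close> can contribute to the coefficient at \<open>a\<close>.\<close>

lemma shift_poly_lead:
  fixes p :: "'k::field mpoly"
  assumes le: "\<And>mo. mo \<in> Poly_Mapping.keys p \<Longrightarrow> mo \<le> a"
  shows "Poly_Mapping.lookup (shift_poly k p) a = Poly_Mapping.lookup p a"
    and "mo \<in> Poly_Mapping.keys (shift_poly k p) \<Longrightarrow> mo \<le> a"
proof -
  define P where "P = power_product (\<lambda>w. Var w + of_int (k w) :: 'k mpoly)"
  have P: "Poly_Mapping.lookup (P mo) mo = 1" "ma \<in> Poly_Mapping.keys (P mo) \<Longrightarrow> ma \<le> mo" for mo ma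
    using shift_power_product[of k mo, where ?'k = 'k] by (auto simp: P_def)
  have sh: "Poly_Mapping.lookup (shift_poly k p) ma =
    (\<Sum>mo\<in>Poly_Mapping.keys p. Poly_Mapping.lookup p mo * Poly_Mapping.lookup (P mo) ma)" for ma
  proof -
    have "Poly_Mapping.lookup (Const c * q) ma = c * Poly_Mapping.lookup q ma" for c :: 'k and q
      unfolding Const_def mult_map_scale_conv_mult[symmetric]
      by (cases "c = 0") (auto simp: map.rep_eq when_def)
    then show ?thesis
      by (simp add: shift_poly_eval mpoly_eval_def lookup_sum P_def)
  qed
  have "Poly_Mapping.lookup p mo * Poly_Mapping.lookup (P mo) a = (if mo = a then Poly_Mapping.lookup p a else 0)"
    if "mo \<in> Poly_Mapping.keys p" for mo
    using P(1)[of mo] P(2)[of a mo] le[OF that] by (auto simp: in_keys_iff)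
  then show "Poly_Mapping.lookup (shift_poly k p) a = Poly_Mapping.lookup p a"
    unfolding sh by (simp add: in_keys_iff)
  show "mo \<le> a" if "mo \<in> Poly_Mapping.keys (shift_poly k p)"
  proof -
    from that obtain ma where "ma \<in> Poly_Mapping.keys p" "Poly_Mapping.lookup (P ma) mo \<noteq> 0"
      unfolding in_keys_iff[of mo] sh by (elim sum.not_neutral_contains_not_neutral) auto
    then show ?thesis using le[of ma] P(2)[of mo ma] by (auto simp: in_keys_iff)
  qed
qed

text \<open>Shifts preserve the lexicographically leading term, so the cofactor must be 1.\<close>
lemma dvd_shift_poly_imp_eq:
  assumes "p dvd shift_poly k p"
  shows "shift_poly k p = p"
proof (cases "p = 0")
  case False
  obtain c where c: "shift_poly k p = p * c" using assms by (rule dvdE)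
  have "c \<noteq> 0" using False c by (metis mult_zero_right shift_poly_eq_0_iff)
  define a where "a = Max (Poly_Mapping.keys p)"
  define b where "b = Max (Poly_Mapping.keys c)"
  have a: "a \<in> Poly_Mapping.keys p" "\<And>mo. mo \<in> Poly_Mapping.keys p \<Longrightarrow> mo \<le> a"
    unfolding a_def using False by (auto intro!: Max_in)
  have b: "b \<in> Poly_Mapping.keys c" "\<And>mo. mo \<in> Poly_Mapping.keys c \<Longrightarrow> mo \<le> b"
    unfolding b_def using \<open>c \<noteq> 0\<close> by (auto intro!: Max_in)
  have ab: "Poly_Mapping.lookup (p * c) (a + b) = Poly_Mapping.lookup p a * Poly_Mapping.lookup c b"
    by (rule lookup_mult_max(1)[OF a(2) b(2)])
  then have "a + b \<in> Poly_Mapping.keys (shift_poly k p)"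
    using a(1) b(1) c by (simp add: in_keys_iff)
  then have "a + b \<le> a"
    using shift_poly_lead(2)[OF a(2)] by blast
  then have b0: "b = 0"
    using poly_mapping_nat_ge_0[of b] by (metis add.right_neutral add_le_cancel_left order_antisym)
  then have "Poly_Mapping.lookup c mo = 0" if "mo \<noteq> 0" for mo
    using b(2)[of mo] poly_mapping_nat_ge_0[of mo] that by (auto simp: in_keys_iff)
  moreover have "Poly_Mapping.lookup c 0 = 1"
    using ab shift_poly_lead(1)[of p a k, OF a(2)] a(1) by (simp add: b0 in_keys_iff flip: c)
  ultimately have "c = 1"
    by (intro poly_mapping_eqI) (simp add: lookup_one when_def)
  with c show ?thesis by simp
qed (simp add: ring_hom_onD[OF ring_hom_shift_poly])

lemma shift_rf_Fract:
  assumes "q \<noteq> 0"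
  shows "shift_rf k (Fract p q) = Fract (shift_poly k p) (shift_poly k q)"
proof -
  \<comment> \<open>The fraction chosen by \<open>SOME\<close> is immaterial: equality of fractions
    is a polynomial identity, which the shift preserves.\<close>
  define pq where "pq = (SOME (p', q'). q' \<noteq> 0 \<and> Fract p q = Fract p' q')"
  have "case pq of (p', q') \<Rightarrow> q' \<noteq> 0 \<and> Fract p q = Fract p' q'"
    unfolding pq_def by (rule someI[of _ "(p, q)"]) (use assms in auto)
  then obtain p' q' where pq: "pq = (p', q')" "q' \<noteq> 0" "Fract p q = Fract p' q'"
    by (cases pq) auto
  have "p * q' = p' * q" using pq assms by (simp add: eq_fract)
  then have "shift_poly k p * shift_poly k q' = shift_poly k p' * shift_poly k q"
    by (metis ring_hom_onD(4)[OF ring_hom_shift_poly])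
  then show ?thesis
    unfolding shift_rf_def pq_def[symmetric] pq(1) using pq assms by (simp add: eq_fract)
qed

lemma ring_hom_shift_rf: "ring_hom_on (shift_rf k)"
proof -
  note hom = ring_hom_onD[OF ring_hom_shift_poly]
  have "shift_rf k (a + b) = shift_rf k a + shift_rf k b" for a b :: "'a rfun"
    by (cases a; cases b) (simp add: shift_rf_Fract hom)
  moreover have "shift_rf k (a * b) = shift_rf k a * shift_rf k b" for a b :: "'a rfun"
    by (cases a; cases b) (simp add: shift_rf_Fract hom)
  ultimately show ?thesis
    by (auto simp: ring_hom_on_def Zero_fract_def One_fract_def shift_rf_Fract hom)
qed

lemma shift_rf_divide: "shift_rf k (a / b) = shift_rf k a / shift_rf k b"
proof (cases "b = 0")
  case False
  \<comment> \<open>The second identity shows that the shifted denominator is nonzero.\<close>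
  then have "shift_rf k (a / b) * shift_rf k b = shift_rf k a" "shift_rf k (1 / b) * shift_rf k b = 1"
    by (simp_all add: ring_hom_onD(2)[OF ring_hom_shift_rf] flip: ring_hom_onD(4)[OF ring_hom_shift_rf])
  then show ?thesis by (metis eq_divide_eq mult_zero_right zero_neq_one)
qed (simp add: ring_hom_onD[OF ring_hom_shift_rf])

lemma shift_rf_add: "shift_rf k (shift_rf k' f) = shift_rf (\<lambda>w. k w + k' w) f"
  by (cases f) (simp add: shift_rf_Fract shift_poly_add)

lemma shift_rf_rf: "shift_rf k (rf p) = rf (shift_poly k p)"
  by (simp add: shift_rf_Fract ring_hom_onD[OF ring_hom_shift_poly])

lemma rf_eq_iff [simp]: "rf p = rf q \<longleftrightarrow> p = q"
  by (simp add: eq_fract)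

lemma ring_hom_rf: "ring_hom_on rf"
  by (simp add: ring_hom_on_def Zero_fract_def One_fract_def)

lemma rf_eq_0_iff [simp]: "rf p = 0 \<longleftrightarrow> p = 0"
  by (simp add: Zero_fract_def)

lemma Fract_divide: "q \<noteq> 0 \<Longrightarrow> Fract p q = rf p / rf q"
  by simp

lemma rf_inE:
  assumes "rf_in V f"
  obtains p q where "p \<in> mpolys_in V" "q \<in> mpolys_in V" "q \<noteq> 0" "f = Fract p q"
  using assms by (auto simp: rf_in_def mpolys_in_def)

lemma rf_inI: "p \<in> mpolys_in V \<Longrightarrow> q \<in> mpolys_in V \<Longrightarrow> q \<noteq> 0 \<Longrightarrow> rf_in V (Fract p q)"
  by (auto simp: rf_in_def mpolys_in_def)

lemma rf_in_rf: "p \<in> mpolys_in V \<Longrightarrow> rf_in V (rf p)"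
  by (rule rf_inI) (auto simp: sub_ring.one_closed[OF sub_ring_mpolys_in])

lemma sub_ring_rf_in: "sub_ring {f::'k::field rfun. rf_in V f}"
proof
  interpret sub_ring "mpolys_in V :: 'k mpoly set" by (rule sub_ring_mpolys_in)
  show "0 \<in> {f::'k rfun. rf_in V f}" "1 \<in> {f::'k rfun. rf_in V f}"
    using rf_in_rf[of "0 :: 'k mpoly" V] rf_in_rf[of "1 :: 'k mpoly" V] by (simp_all add: Zero_fract_def One_fract_def)
  fix a b :: "'k rfun"
  assume "a \<in> {f. rf_in V f}" "b \<in> {f. rf_in V f}"
  then obtain p q p' q' where *: "p \<in> mpolys_in V" "q \<in> mpolys_in V" "q \<noteq> 0" "a = Fract p q"
    "p' \<in> mpolys_in V" "q' \<in> mpolys_in V" "q' \<noteq> 0" "b = Fract p' q'"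
    by (auto elim!: rf_inE)
  show "a - b \<in> {f. rf_in V f}" "a * b \<in> {f. rf_in V f}"
    using * by (auto intro!: rf_inI)
qed

lemma rf_in_divide: "rf_in V a \<Longrightarrow> rf_in V b \<Longrightarrow> rf_in V (a / b)"
proof (cases "b = 0")
  case False
  interpret sub_ring "mpolys_in V :: 'a mpoly set" by (rule sub_ring_mpolys_in)
  assume "rf_in V a" "rf_in V b"
  then obtain p q p' q' where *: "p \<in> mpolys_in V" "q \<in> mpolys_in V" "q \<noteq> 0" "a = Fract p q"
    "p' \<in> mpolys_in V" "q' \<in> mpolys_in V" "q' \<noteq> 0" "b = Fract p' q'"
    by (auto elim!: rf_inE)
  then have "p' \<noteq> 0" using False by (auto simp: Zero_fract_def eq_fract)
  then show ?thesis using * by (auto intro!: rf_inI)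
qed (use sub_ring.zero_closed[OF sub_ring_rf_in] in auto)

lemma rf_in_mono: "V \<subseteq> W \<Longrightarrow> rf_in V f \<Longrightarrow> rf_in W f"
  by (force simp: rf_in_def)

lemma rf_in_shift_rf: "rf_in V f \<Longrightarrow> rf_in V (shift_rf k f)"
  by (auto elim!: rf_inE simp: shift_rf_Fract shift_poly_in intro!: rf_inI)

lemma shift_rf_id:
  assumes "rf_in V f" "\<And>w. w \<in> V \<Longrightarrow> k w = 0"
  shows "shift_rf k f = f"
proof -
  obtain p q where *: "p \<in> mpolys_in V" "q \<in> mpolys_in V" "q \<noteq> 0" "f = Fract p q"
    using assms(1) by (rule rf_inE)
  have "shift_poly k p = p" "shift_poly k q = q"
    using * assms(2) by (auto intro!: shift_poly_id simp: mpolys_in_def)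
  then show ?thesis using * by (simp add: shift_rf_Fract)
qed

lemma shift_rf_0 [simp]: "shift_rf (\<lambda>_. 0) f = f"
  by (cases f) (simp add: shift_rf_Fract shift_poly_id)

section \<open>Partial fractions at one irreducible polynomial\<close>

text \<open>Polynomials over \<open>F\<close> are represented by their values at a transcendental
  \<open>x\<close>, so that they and their quotients live in one field, the one on which the shifts
  act.\<close>

locale partial_fractions = sub_ring F for F :: "'e::field set" +
  fixes x :: 'e and D :: "'e poly"
  assumes inverse_closed: "a \<in> F \<Longrightarrow> inverse a \<in> F"
    and D_over: "D \<in> polys_over F" and D_deg: "degree D > 0"
    and transcendental: "p \<in> polys_over F \<Longrightarrow> poly p x = 0 \<Longrightarrow> p = 0"
begin

definition P :: "'e set" where "P = (\<lambda>p. poly p x) ` polys_over F"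

definition V :: "'e set" where "V = (\<lambda>p. poly p x) ` {p \<in> polys_over F. degree p < degree D}"

definition \<delta> :: 'e where "\<delta> = poly D x"

text \<open>Coprimality to \<open>D\<close> in Bezout form, because a Bezout identity passes to
  products and to images under homomorphisms that fix \<open>\<delta>\<close>.\<close>

definition cop :: "'e \<Rightarrow> bool" where
  "cop w \<longleftrightarrow> w \<in> P \<and> (\<exists>\<alpha>\<in>P. \<exists>\<beta>\<in>P. \<alpha> * \<delta> + \<beta> * w = 1)"

definition Loc :: "'e set" where "Loc = {u / w | u w. u \<in> P \<and> cop w}"

text \<open>A is the sequence of numerators of the D-part of the partial fraction expansion of g:
  A i is the numerator over the power Suc i of D.\<close>
definition expansion :: "'e \<Rightarrow> (nat \<Rightarrow> 'e) \<Rightarrow> bool" where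
  "expansion g A \<longleftrightarrow> (\<forall>i. A i \<in> V) \<and>
     (\<exists>k. (\<forall>i\<ge>k. A i = 0) \<and> g - (\<Sum>i<k. A i / \<delta> ^ Suc i) \<in> Loc)"

definition numerator_at :: "nat \<Rightarrow> 'e \<Rightarrow> 'e" where
  "numerator_at i g = (THE A. expansion g A) i"

interpretation polys: sub_ring "polys_over F" by (rule sub_ring_polys_over)

lemma sub_ring_P: "sub_ring P"
proof
  show "0 \<in> P" "1 \<in> P"
    unfolding P_def by (rule image_eqI[of _ _ 0]; simp) (rule image_eqI[of _ _ 1]; simp)
  fix a b assume "a \<in> P" "b \<in> P"
  then obtain p q where "p \<in> polys_over F" "q \<in> polys_over F" "a = poly p x" "b = poly q x"
    by (auto simp: P_def)
  then show "a - b \<in> P" "a * b \<in> P"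
    unfolding P_def by (auto intro: image_eqI[of _ _ "p - q"] image_eqI[of _ _ "p * q"])
qed

interpretation P: sub_ring P by (rule sub_ring_P)

lemma F_subset_P: "a \<in> F \<Longrightarrow> a \<in> P"
  unfolding P_def by (rule image_eqI[of _ _ "[:a:]"]) auto

lemma delta_in_P [simp]: "\<delta> \<in> P"
  unfolding P_def \<delta>_def using D_over by blast

lemma V_subset_P: "a \<in> V \<Longrightarrow> a \<in> P"
  by (auto simp: V_def P_def)

lemma V_0 [simp]: "0 \<in> V"
  unfolding V_def by (rule image_eqI[of _ _ 0]) (use D_deg in auto)

lemma V_diff [intro]: "a \<in> V \<Longrightarrow> b \<in> V \<Longrightarrow> a - b \<in> V"
proof -
  assume "a \<in> V" "b \<in> V"
  then obtain p q where "p \<in> polys_over F" "q \<in> polys_over F" "a = poly p x" "b = poly q x"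
      "degree p < degree D" "degree q < degree D"
    by (auto simp: V_def)
  then show ?thesis
    unfolding V_def by (intro image_eqI[of _ _ "p - q"]) (auto intro: degree_diff_less)
qed

lemma V_scale [intro]: "e \<in> F \<Longrightarrow> a \<in> V \<Longrightarrow> e * a \<in> V"
proof -
  assume "e \<in> F" "a \<in> V"
  then obtain p where "p \<in> polys_over F" "a = poly p x" "degree p < degree D"
    by (auto simp: V_def)
  with \<open>e \<in> F\<close> show ?thesis
    unfolding V_def by (intro image_eqI[of _ _ "smult e p"]) (auto intro: le_less_trans[OF degree_smult_le])
qed

lemma inj_poly: "p \<in> polys_over F \<Longrightarrow> q \<in> polys_over F \<Longrightarrow> poly p x = poly q x \<Longrightarrow> p = q"
  using transcendental[of "p - q"] by auto

text \<open>By transcendence this is a comparison of degrees; uniqueness of the expansion rests on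
  it.\<close>

lemma V_multiple_delta: "a \<in> V \<Longrightarrow> b \<in> P \<Longrightarrow> a = b * \<delta> \<Longrightarrow> a = 0"
proof -
  assume "a \<in> V" "b \<in> P" and ab: "a = b * \<delta>"
  then obtain p q where pq: "p \<in> polys_over F" "q \<in> polys_over F" "a = poly p x" "b = poly q x"
      "degree p < degree D"
    by (auto simp: V_def P_def)
  then have "p = q * D" using ab D_over by (intro inj_poly) (auto simp: \<delta>_def)
  moreover have "q * D = 0"
  proof (rule ccontr)
    assume "q * D \<noteq> 0"
    then have "degree (q * D) = degree q + degree D" by (auto intro: degree_mult_eq)
    then show False using pq(5) \<open>p = q * D\<close> by simp
  qed
  ultimately show ?thesis using pq by simp
qed

lemma one_in_V: "1 \<in> V"
  unfolding V_def by (rule image_eqI[of _ _ 1]) (use D_deg in auto)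

lemma delta_nonzero [simp]: "\<delta> \<noteq> 0"
  using transcendental[OF D_over] D_deg by (auto simp: \<delta>_def)

lemma cop_nonzero: "cop w \<Longrightarrow> w \<noteq> 0"
  using V_multiple_delta[OF one_in_V] by (auto simp: cop_def)

lemma cop_1: "cop 1"
  unfolding cop_def by (intro conjI bexI[of _ 0] bexI[of _ 1]) auto

lemma cop_mult: "cop v \<Longrightarrow> cop w \<Longrightarrow> cop (v * w)"
proof -
  assume "cop v" "cop w"
  then obtain a b a' b' where *: "a \<in> P" "b \<in> P" "a' \<in> P" "b' \<in> P" "v \<in> P" "w \<in> P"
    "a * \<delta> + b * v = 1" "a' * \<delta> + b' * w = 1"
    by (auto simp: cop_def)
  have "(a * \<delta> + b * v) * (a' * \<delta> + b' * w) = 1" using *(7,8) by simp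
  then have "(a * a' * \<delta> + a * b' * w + b * v * a') * \<delta> + (b * b') * (v * w) = 1"
    by (simp add: algebra_simps)
  moreover have "a * a' * \<delta> + a * b' * w + b * v * a' \<in> P" "b * b' \<in> P" "v * w \<in> P"
    using * by auto
  ultimately show ?thesis unfolding cop_def by blast
qed

lemma cop_power: "cop w \<Longrightarrow> \<exists>\<alpha>\<in>P. \<exists>\<beta>\<in>P. \<alpha> * \<delta> ^ k + \<beta> * w = 1"
proof (induction k)
  case 0
  show ?case by (intro bexI[of _ 1] bexI[of _ 0]) auto
next
  case (Suc k)
  then obtain a b a' b' where *: "a \<in> P" "b \<in> P" "a' \<in> P" "b' \<in> P" "w \<in> P"
    "a * \<delta> + b * w = 1" "a' * \<delta> ^ k + b' * w = 1"
    by (auto simp: cop_def)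
  have "(a * \<delta> + b * w) * (a' * \<delta> ^ k + b' * w) = 1" using *(6,7) by simp
  then have "(a * a') * \<delta> ^ Suc k + (a * \<delta> * b' + b * a' * \<delta> ^ k + b * w * b') * w = 1"
    by (simp add: algebra_simps)
  moreover have "a * a' \<in> P" "a * \<delta> * b' + b * a' * \<delta> ^ k + b * w * b' \<in> P"
    using * by auto
  ultimately show ?case by blast
qed

lemma LocI: "u \<in> P \<Longrightarrow> cop w \<Longrightarrow> u / w \<in> Loc"
  by (auto simp: Loc_def)

lemma P_subset_Loc: "u \<in> P \<Longrightarrow> u \<in> Loc"
  using LocI[OF _ cop_1, of u] by simp

lemma sub_ring_Loc: "sub_ring Loc"
proof
  show "0 \<in> Loc" "1 \<in> Loc" by (auto intro: P_subset_Loc)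
  fix a b assume "a \<in> Loc" "b \<in> Loc"
  then obtain u v w z where *: "u \<in> P" "v \<in> P" "cop w" "cop z" "a = u / w" "b = v / z"
    by (auto simp: Loc_def)
  have wz: "w \<in> P" "z \<in> P" using * by (auto simp: cop_def)
  have "a - b = (u * z - v * w) / (w * z)" "a * b = (u * v) / (w * z)"
    using * cop_nonzero[of w] cop_nonzero[of z] by (auto simp: field_simps)
  then show "a - b \<in> Loc" "a * b \<in> Loc"
    using * wz by (auto intro!: LocI cop_mult)
qed

interpretation Loc: sub_ring Loc by (rule sub_ring_Loc)

text \<open>Multiplying the Bezout identity of the denominator \<open>w\<close> by \<open>a\<close>
  exhibits \<open>a\<close> as a multiple of \<open>\<delta>\<close>.\<close>

lemma V_div_delta: "a \<in> V \<Longrightarrow> a / \<delta> \<in> Loc \<Longrightarrow> a = 0"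
proof -
  assume a: "a \<in> V" "a / \<delta> \<in> Loc"
  then obtain u w where uw: "u \<in> P" "cop w" "a / \<delta> = u / w" by (auto simp: Loc_def)
  then obtain \<alpha> \<beta> where *: "\<alpha> \<in> P" "\<beta> \<in> P" "\<alpha> * \<delta> + \<beta> * w = 1" by (auto simp: cop_def)
  have "a * w = u * \<delta>" using uw cop_nonzero[OF uw(2)] by (simp add: field_simps)
  have "a = a * (\<alpha> * \<delta> + \<beta> * w)" using * by simp
  also have "\<dots> = a * \<alpha> * \<delta> + \<beta> * (a * w)" by (simp add: algebra_simps)
  also have "\<dots> = (a * \<alpha> + \<beta> * u) * \<delta>" by (simp add: \<open>a * w = u * \<delta>\<close> algebra_simps)
  finally show "a = 0"
    using V_multiple_delta[OF a(1), of "a * \<alpha> + \<beta> * u"] * uw V_subset_P[OF a(1)] by auto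
qed

lemma P_division:
  assumes "u \<in> P"
  obtains q a where "q \<in> P" "a \<in> V" "u = q * \<delta> + a"
proof -
  obtain p where p: "p \<in> polys_over F" "u = poly p x" using assms by (auto simp: P_def)
  have "D \<noteq> 0" using D_deg by auto
  then obtain s q r where *: "s \<in> F" "s \<noteq> 0" "q \<in> polys_over F" "r \<in> polys_over F"
    "smult s p = q * D + r" "r = 0 \<or> degree r < degree D"
    using pseudo_division[OF p(1) D_over] by blast
  define q' where "q' = smult (inverse s) q"
  define r' where "r' = smult (inverse s) r"
  have "smult (inverse s) (smult s p) = q' * D + r'"
    by (simp add: *(5) smult_add_right q'_def r'_def)
  then have "p = q' * D + r'" using *(2) by simp
  then have "u = poly q' x * \<delta> + poly r' x" by (simp add: p \<delta>_def)
  moreover have "q' \<in> polys_over F" "r' \<in> polys_over F"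
    using * inverse_closed by (auto simp: q'_def r'_def)
  moreover have "degree r' < degree D"
    using * D_deg by (auto simp: r'_def)
  ultimately show ?thesis using that[of "poly q' x" "poly r' x"] by (auto simp: P_def V_def)
qed

section \<open>Existence, uniqueness and naturality of the expansion at D\<close>

lemma expansionE:
  assumes "expansion g A"
  obtains k where "\<And>i. A i \<in> V" "\<And>i. i \<ge> k \<Longrightarrow> A i = 0"
    "\<And>l. l \<ge> k \<Longrightarrow> g - (\<Sum>i<l. A i / \<delta> ^ Suc i) \<in> Loc"
proof -
  obtain k where k: "\<And>i. A i \<in> V" "\<And>i. i \<ge> k \<Longrightarrow> A i = 0"
    "g - (\<Sum>i<k. A i / \<delta> ^ Suc i) \<in> Loc"
    using assms by (auto simp: expansion_def)
  have *: "(\<Sum>i<l. A i / \<delta> ^ Suc i) = (\<Sum>i<k. A i / \<delta> ^ Suc i)" if "l \<ge> k" for l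
    by (rule sum.mono_neutral_right) (use that k(2) in auto)
  have "g - (\<Sum>i<l. A i / \<delta> ^ Suc i) \<in> Loc" if "l \<ge> k" for l
    unfolding *[OF that] by (rule k(3))
  with k(1,2) show ?thesis by (rule that)
qed

lemma expansion_diff:
  assumes "expansion g A" "expansion h B"
  shows "expansion (g - h) (\<lambda>i. A i - B i)"
proof -
  obtain k where k: "\<And>i. A i \<in> V" "\<And>i. i \<ge> k \<Longrightarrow> A i = 0"
    "\<And>l. l \<ge> k \<Longrightarrow> g - (\<Sum>i<l. A i / \<delta> ^ Suc i) \<in> Loc"
    by (rule expansionE[OF assms(1)]) blast
  obtain m where m: "\<And>i. B i \<in> V" "\<And>i. i \<ge> m \<Longrightarrow> B i = 0"
    "\<And>l. l \<ge> m \<Longrightarrow> h - (\<Sum>i<l. B i / \<delta> ^ Suc i) \<in> Loc"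
    by (rule expansionE[OF assms(2)]) blast
  define l where "l = max k m"
  have "(g - h) - (\<Sum>i<l. (A i - B i) / \<delta> ^ Suc i) =
      (g - (\<Sum>i<l. A i / \<delta> ^ Suc i)) - (h - (\<Sum>i<l. B i / \<delta> ^ Suc i))"
    by (simp add: diff_divide_distrib sum_subtractf)
  also have "\<dots> \<in> Loc" using k(3)[of l] m(3)[of l] by (auto simp: l_def)
  finally show ?thesis
    unfolding expansion_def using k m by (intro conjI exI[of _ l]) (auto simp: l_def)
qed

lemma expansion_Loc: "g \<in> Loc \<Longrightarrow> expansion g (\<lambda>_. 0)"
  by (auto simp: expansion_def intro!: exI[of _ 0])

lemma expansion_add:
  assumes "expansion g A" "expansion h B"
  shows "expansion (g + h) (\<lambda>i. A i + B i)"
  using expansion_diff[OF assms(1) expansion_diff[OF expansion_Loc[of 0] assms(2)]] by simp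

lemma expansion_scale:
  assumes "expansion g A" "e \<in> F"
  shows "expansion (e * g) (\<lambda>i. e * A i)"
proof -
  obtain k where k: "\<And>i. A i \<in> V" "\<And>i. i \<ge> k \<Longrightarrow> A i = 0"
    "\<And>l. l \<ge> k \<Longrightarrow> g - (\<Sum>i<l. A i / \<delta> ^ Suc i) \<in> Loc"
    by (rule expansionE[OF assms(1)]) blast
  have "e * g - (\<Sum>i<k. e * A i / \<delta> ^ Suc i) = e * (g - (\<Sum>i<k. A i / \<delta> ^ Suc i))"
    by (simp add: right_diff_distrib sum_distrib_left)
  also have "\<dots> \<in> Loc"
    by (intro Loc.mult_closed P_subset_Loc F_subset_P assms(2) k(3)) simp
  finally show ?thesis
    unfolding expansion_def using k assms(2) by (intro conjI exI[of _ k]) auto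
qed

lemma expansion_term:
  assumes "a \<in> V"
  shows "expansion (a / \<delta> ^ Suc k) (\<lambda>i. if i = k then a else 0)"
proof -
  have "(\<Sum>i<Suc k. (if i = k then a else 0) / \<delta> ^ Suc i) = a / \<delta> ^ Suc k"
    by simp
  then show ?thesis
    unfolding expansion_def using assms by (intro conjI exI[of _ "Suc k"]) simp_all
qed

text \<open>A Bezout identity for \<open>\<delta> ^ k\<close> and \<open>w\<close> separates the two
  denominators; repeated division by \<open>\<delta>\<close> then yields the numerators over the
  powers of \<open>\<delta>\<close>.\<close>

lemma expansion_exists:
  assumes "u \<in> P" "cop w"
  shows "\<exists>A. expansion (u / (\<delta> ^ k * w)) A"
proof -
  have pow: "\<exists>A. expansion (v / \<delta> ^ k) A" if "v \<in> P" for v k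
    using that
  proof (induction k arbitrary: v)
    case 0
    then show ?case using expansion_Loc P_subset_Loc by auto
  next
    case (Suc k)
    obtain q a where qa: "q \<in> P" "a \<in> V" "v = q * \<delta> + a" using P_division Suc.prems by metis
    obtain A where "expansion (q / \<delta> ^ k) A" using Suc.IH qa by blast
    moreover have "v / \<delta> ^ Suc k = q / \<delta> ^ k + a / \<delta> ^ Suc k"
      by (simp add: qa(3) field_simps)
    ultimately show ?case using expansion_add expansion_term[OF qa(2)] by metis
  qed
  obtain \<alpha> \<beta> where *: "\<alpha> \<in> P" "\<beta> \<in> P" "\<alpha> * \<delta> ^ k + \<beta> * w = 1"
    using cop_power[OF assms(2)] by blast
  have w0: "w \<noteq> 0" using cop_nonzero assms by blast
  have "u / (\<delta> ^ k * w) = (\<alpha> * \<delta> ^ k + \<beta> * w) * u / (\<delta> ^ k * w)" using * by simp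
  also have "\<dots> = (\<alpha> * u) / w + (\<beta> * u) / \<delta> ^ k"
    using w0 by (simp add: field_simps)
  finally have "u / (\<delta> ^ k * w) = \<dots>" .
  moreover obtain A where "expansion ((\<beta> * u) / \<delta> ^ k) A" using pow * assms by blast
  moreover have "expansion ((\<alpha> * u) / w) (\<lambda>_. 0)"
    using * assms by (intro expansion_Loc LocI) auto
  ultimately show ?thesis using expansion_add by metis
qed

text \<open>Multiplication by a suitable power of \<open>\<delta>\<close> leaves the top numerator
  over a single \<open>\<delta>\<close> and everything else in \<open>Loc\<close>. So the top
  numerator vanishes by \<open>V_div_delta\<close>, and the lower ones follow by induction.\<close>

lemma expansion_zero:
  assumes "expansion g A" "g \<in> Loc"
  shows "A = (\<lambda>_. 0)"
proof -
  obtain k where k: "\<And>i. A i \<in> V" "\<And>i. i \<ge> k \<Longrightarrow> A i = 0"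
    "\<And>l. l \<ge> k \<Longrightarrow> g - (\<Sum>i<l. A i / \<delta> ^ Suc i) \<in> Loc"
    by (rule expansionE[OF assms(1)]) blast
  have "(\<Sum>i<k. A i / \<delta> ^ Suc i) \<in> Loc"
    using Loc.diff_closed[OF assms(2) k(3)[of k]] by simp
  then have "\<forall>i<k. A i = 0"
  proof (induction k)
    case (Suc k)
    have "\<delta> ^ k * (\<Sum>i<Suc k. A i / \<delta> ^ Suc i) \<in> Loc"
      by (intro Loc.mult_closed Suc.prems P_subset_Loc) simp
    moreover have "\<delta> ^ k * (A i / \<delta> ^ Suc i) = A i * \<delta> ^ (k - Suc i)" if "i < k" for i
      using that by (simp add: power_diff field_simps flip: power_Suc)
    then have "\<delta> ^ k * (\<Sum>i<Suc k. A i / \<delta> ^ Suc i) =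
        (\<Sum>i<k. A i * \<delta> ^ (k - Suc i)) + A k / \<delta>"
      by (simp add: distrib_left sum_distrib_left)
    moreover have "(\<Sum>i<k. A i * \<delta> ^ (k - Suc i)) \<in> Loc"
      by (intro Loc.sum_closed P_subset_Loc P.mult_closed V_subset_P[OF k(1)] P.power_closed) simp
    ultimately have "A k / \<delta> \<in> Loc"
      by (metis Loc.diff_closed add_diff_cancel_left')
    then have "A k = 0" using V_div_delta k(1) by blast
    with Suc show ?case by (auto simp: less_Suc_eq)
  qed simp
  with k(2) show ?thesis by (meson not_le ext)
qed

lemma expansion_unique:
  assumes "expansion g A" "expansion g B"
  shows "A = B"
proof -
  have "(\<lambda>i. A i - B i) = (\<lambda>_. 0)"
    by (rule expansion_zero[OF expansion_diff[OF assms]]) simp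
  then have "A i - B i = 0" for i by (rule fun_cong)
  then show ?thesis by (intro ext) simp
qed

lemma numerator_at_eq:
  assumes "expansion g A"
  shows "numerator_at i g = A i"
proof -
  have "(THE A. expansion g A) = A"
    using assms expansion_unique[OF _ assms] by (rule the_equality[of "expansion g"])
  then show ?thesis by (simp only: numerator_at_def)
qed

lemma numerator_at_Loc: "g \<in> Loc \<Longrightarrow> numerator_at i g = 0"
  by (rule numerator_at_eq[OF expansion_Loc])

lemma expansion_hom:
  assumes s: "ring_hom_on s" and sP: "\<And>u. u \<in> P \<Longrightarrow> s u \<in> P"
    and sV: "\<And>u. u \<in> V \<Longrightarrow> s u \<in> V" and sD: "s \<delta> = \<delta>" and A: "expansion g A"
  shows "expansion (s g) (\<lambda>i. s (A i))"
proof -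
  note hom = ring_hom_onD[OF s]
  have AV: "A i \<in> V" for i using A by (simp add: expansion_def)
  obtain k where k: "\<forall>i\<ge>k. A i = 0" "g - (\<Sum>i<k. A i / \<delta> ^ Suc i) \<in> Loc"
    using A unfolding expansion_def by metis
  have div: "s (a / b) = s a / s b" if "b \<noteq> 0" for a b
  proof -
    have "s (a / b) * s b = s a" "s (1 / b) * s b = 1"
      using that hom(4)[of "a / b" b] hom(4)[of "1 / b" b] hom(2) by simp_all
    then show ?thesis by (metis eq_divide_eq mult_zero_right zero_neq_one)
  qed
  have cop: "cop (s w)" if w: "cop w" for w
  proof -
    obtain \<alpha> \<beta> where *: "\<alpha> \<in> P" "\<beta> \<in> P" "\<alpha> * \<delta> + \<beta> * w = 1" "w \<in> P"
      using w by (auto simp: cop_def)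
    have "s \<alpha> * \<delta> + s \<beta> * s w = s (\<alpha> * \<delta> + \<beta> * w)"
      by (simp only: hom(3,4) sD)
    then have "s \<alpha> * \<delta> + s \<beta> * s w = 1" by (simp only: *(3) hom(2))
    then show ?thesis unfolding cop_def using sP * by blast
  qed
  have Loc: "s u \<in> Loc" if u: "u \<in> Loc" for u
  proof -
    obtain v w where vw: "v \<in> P" "cop w" "u = v / w" using u by (auto simp: Loc_def)
    then have "s u = s v / s w" by (simp only: div[OF cop_nonzero])
    then show ?thesis using LocI[OF sP[OF vw(1)] cop[OF vw(2)]] by simp
  qed
  have "s (g - (\<Sum>i<k. A i / \<delta> ^ Suc i)) = s g - (\<Sum>i<k. s (A i) / \<delta> ^ Suc i)"
    by (simp add: hom(4,6,7,9) div sD)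
  then have "s g - (\<Sum>i<k. s (A i) / \<delta> ^ Suc i) \<in> Loc"
    using Loc[OF k(2)] by simp
  then show ?thesis
    unfolding expansion_def using k(1)
    by (intro conjI exI[of _ k] allI sV[OF AV]) (simp_all add: hom(1))
qed

end

section \<open>Numerators of rational functions\<close>

locale shift_setting =
  fixes m n :: nat and d :: "'k::field mpoly"
  assumes n: "1 \<le> n" "n \<le> m"
    and d_in: "d \<in> mpolys_in {0..m}" and d_irr: "irreducible d" and d_deg: "degx1 d > 0"
begin

declare One_nat_def [simp del] add_fract [simp del] mult_fract [simp del] diff_fract [simp del]
  minus_fract [simp del] divide_fract [simp del]

abbreviation V0 :: "nat set" where "V0 \<equiv> {0..m} - {1}"
abbreviation F :: "'k rfun set" where "F \<equiv> {f. rf_in V0 f}"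
abbreviation x1 :: "'k rfun" where "x1 \<equiv> rf (Var 1)"
abbreviation D :: "'k rfun poly" where "D \<equiv> map_poly rf (sep 1 d)"

lemma insert_V0: "insert 1 V0 = {0..m}"
  using n by auto

lemma poly_map_rf: "poly (map_poly rf q) x1 = rf (poly q (Var 1))" for q :: "'k mpoly poly"
  by (induction q) (simp_all add: map_poly_pCons ring_hom_onD[OF ring_hom_rf])

lemma map_rf_over: "q \<in> polys_over (mpolys_in V0) \<Longrightarrow> map_poly rf q \<in> polys_over F"
  by (rule polys_overI)
    (auto simp: coeff_map_poly ring_hom_onD[OF ring_hom_rf] dest: polys_overD intro!: rf_in_rf)

lemma degree_map_rf: "degree (map_poly rf q) = degree (q :: 'k mpoly poly)"
  by (cases "q = 0") (auto intro!: degree_map_poly simp: ring_hom_onD[OF ring_hom_rf])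

lemma clear_denominators:
  fixes p :: "'k rfun poly"
  assumes "p \<in> polys_over F"
  shows "\<exists>s q. s \<noteq> 0 \<and> s \<in> mpolys_in V0 \<and> q \<in> polys_over (mpolys_in V0) \<and>
    smult (rf s) p = map_poly rf q"
  using assms
proof (induction p)
  case 0
  show ?case
    by (intro exI[of _ 1] exI[of _ 0])
      (auto simp: sub_ring.one_closed[OF sub_ring_mpolys_in] sub_ring.zero_in_polys_over[OF sub_ring_mpolys_in])
next
  case (pCons a p)
  interpret R: sub_ring "mpolys_in V0 :: 'k mpoly set" by (rule sub_ring_mpolys_in)
  interpret K: sub_ring F by (rule sub_ring_rf_in)
  obtain s q where sq: "s \<noteq> 0" "s \<in> mpolys_in V0" "q \<in> polys_over (mpolys_in V0)"
    "smult (rf s) p = map_poly rf q"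
    using pCons.IH pCons.prems K.pCons_in_polys_over by blast
  obtain u v where uv: "u \<in> mpolys_in V0" "v \<in> mpolys_in V0" "v \<noteq> 0" "a = Fract u v"
    using pCons.prems by (auto elim!: rf_inE)
  have "smult (rf (s * v)) (pCons a p) = map_poly rf (pCons (s * u) (smult v q))"
  proof (rule poly_eqI)
    fix i
    have "rf (s * v) * coeff p i = rf v * coeff (smult (rf s) p) i" for i
      by (simp add: ring_hom_onD[OF ring_hom_rf] mult_ac)
    then have "rf (s * v) * coeff p i = rf (v * coeff q i)" for i
      unfolding sq(4) by (simp add: coeff_map_poly ring_hom_onD[OF ring_hom_rf])
    moreover have "rf (s * v) * a = rf (s * u)"
      using uv by (simp add: eq_fract mult_fract)
    ultimately show "coeff (smult (rf (s * v)) (pCons a p)) i =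
        coeff (map_poly rf (pCons (s * u) (smult v q))) i"
      by (cases i) (simp_all add: coeff_map_poly ring_hom_onD[OF ring_hom_rf])
  qed
  moreover have "pCons (s * u) (smult v q) \<in> polys_over (mpolys_in V0)"
    using sq uv by auto
  ultimately show ?case
    using sq uv by (intro exI[of _ "s * v"] exI[of _ "pCons (s * u) (smult v q)"]) auto
qed

sublocale pf: partial_fractions F x1 D
proof (intro partial_fractions.intro partial_fractions_axioms.intro sub_ring_rf_in)
  show "inverse a \<in> F" if "a \<in> F" for a
    using that rf_in_divide[of V0 1 a] sub_ring.one_closed[OF sub_ring_rf_in, of V0]
    by (simp add: inverse_eq_divide)
  show "D \<in> polys_over F"
    by (rule map_rf_over, rule sep_in_polys_over) (use d_in insert_V0 in simp)
  show "degree D > 0"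
    using d_deg by (simp only: degree_map_rf degree_sep)
  \<comment> \<open>After clearing denominators, a relation for \<open>x1\<close> becomes a
    polynomial identity with coefficients free of variable 1, and \<open>sep\<close> reads off that
    all of them vanish.\<close>
  show "p = 0" if p: "p \<in> polys_over F" "poly p x1 = 0" for p
  proof -
    obtain s q where sq: "s \<noteq> 0" "s \<in> mpolys_in V0" "q \<in> polys_over (mpolys_in V0)"
      "smult (rf s) p = map_poly rf q"
      using clear_denominators[OF p(1)] by blast
    have "rf (poly q (Var 1)) = poly (smult (rf s) p) x1"
      by (simp only: sq(4) poly_map_rf)
    then have "poly q (Var 1) = 0" using p(2) by simp
    then have "q = 0" using sep_poly[OF sq(3), of 1] by (simp add: ring_hom_onD[OF ring_hom_sep])
    then have "smult (rf s) p = 0" using sq by simp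
    then show ?thesis using sq(1) by simp
  qed
qed

lemma degree_D: "degree D = degx1 d"
  by (simp only: degree_map_rf degree_sep)

lemma delta: "pf.\<delta> = rf d"
  by (simp only: pf.\<delta>_def poly_map_rf poly_sep)

lemma rf_in_P: "p \<in> mpolys_in {0..m} \<Longrightarrow> rf p \<in> pf.P"
proof -
  assume "p \<in> mpolys_in {0..m}"
  then have "sep 1 p \<in> polys_over (mpolys_in V0)"
    using insert_V0 by (intro sep_in_polys_over) simp
  moreover have "rf p = poly (map_poly rf (sep 1 p)) x1"
    by (simp only: poly_map_rf poly_sep)
  ultimately show ?thesis
    unfolding pf.P_def by (blast intro: map_rf_over)
qed

lemma x1poly_deg_lt_iff: "x1poly_deg_lt m (degx1 d) a \<longleftrightarrow> a \<in> pf.V"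
proof
  assume "x1poly_deg_lt m (degx1 d) a"
  then obtain c where c: "\<And>i. i < degx1 d \<Longrightarrow> rf_in V0 (c i)" "a = (\<Sum>i<degx1 d. c i * x1 ^ i)"
    by (auto simp: x1poly_deg_lt_def)
  define p where "p = (\<Sum>i<degx1 d. monom (c i) i)"
  have cp: "coeff p i = (if i < degx1 d then c i else 0)" for i
    by (auto simp: p_def coeff_sum)
  have "a = poly p x1" by (simp add: p_def c poly_sum poly_monom)
  moreover have "p \<in> polys_over F"
    by (rule polys_overI) (use c sub_ring.zero_closed[OF sub_ring_rf_in] in \<open>auto simp: cp\<close>)
  moreover have "degree p < degx1 d"
    using d_deg by (intro degree_lessI) (auto simp: cp)
  ultimately show "a \<in> pf.V" unfolding pf.V_def degree_D by blast
next
  assume "a \<in> pf.V"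
  then obtain p where p: "p \<in> polys_over F" "degree p < degx1 d" "a = poly p x1"
    unfolding pf.V_def degree_D by blast
  have "a = (\<Sum>i\<le>degree p. coeff p i * x1 ^ i)" by (simp add: p poly_altdef)
  also have "\<dots> = (\<Sum>i<degx1 d. coeff p i * x1 ^ i)"
    by (rule sum.mono_neutral_left) (use p in \<open>auto simp: coeff_eq_0\<close>)
  finally show "x1poly_deg_lt m (degx1 d) a"
    unfolding x1poly_deg_lt_def using polys_overD[OF p(1)] by (intro exI[of _ "coeff p"]) auto
qed

text \<open>A shift introduces no new variables into the coefficients and sends \<open>x1\<close> to
  \<open>x1\<close> plus an integer. This makes both \<open>pf.P\<close> and \<open>pf.V\<close>
  stable under shifts.\<close>

lemma shift_poly_x1:
  assumes "p \<in> polys_over F"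
  shows "\<exists>q\<in>polys_over F. degree q \<le> degree p \<and> shift_rf k (poly p x1) = poly q x1"
proof -
  interpret KP: sub_ring "polys_over F" by (rule pf.sub_ring_polys_over)
  define y where "y = [: of_int (k 1), 1 :: 'k rfun :]"
  define q where "q = (\<Sum>i\<le>degree p. smult (shift_rf k (coeff p i)) (y ^ i))"
  have ofint: "(of_int z :: 'k rfun) \<in> F" for z
  proof -
    have "(of_int z :: 'k rfun) = rf (of_int z)" by (rule ring_hom_onD(10)[OF ring_hom_rf, symmetric])
    then show ?thesis using rf_in_rf[OF of_int_in_mpolys_in] by simp
  qed
  have "shift_rf k x1 = rf (Var 1 + of_int (k 1))"
    unfolding shift_rf_rf by (simp add: shift_poly_eval mpoly_eval_Var[OF ring_hom_Const])
  also have "\<dots> = x1 + of_int (k 1)"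
    by (simp only: ring_hom_onD[OF ring_hom_rf])
  finally have sx: "shift_rf k x1 = poly y x1" by (simp add: y_def)
  have "shift_rf k (poly p x1) = poly q x1"
    unfolding poly_altdef[of p] q_def
    by (simp only: ring_hom_onD[OF ring_hom_shift_rf] sx poly_sum poly_smult poly_power)
  moreover have "q \<in> polys_over F"
    unfolding q_def y_def using polys_overD[OF assms] ofint ofint[of 1]
    by (intro KP.sum_closed pf.smult_in_polys_over KP.power_closed) (auto intro: rf_in_shift_rf)
  moreover have "degree q \<le> degree p"
    unfolding q_def
  proof (rule degree_sum_le)
    fix i assume "i \<in> {..degree p}"
    then show "degree (smult (shift_rf k (coeff p i)) (y ^ i)) \<le> degree p"
      using degree_smult_le[of "shift_rf k (coeff p i)" "y ^ i"] degree_power_le[of y i]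
      by (simp add: y_def)
  qed auto
  ultimately show ?thesis by blast
qed

lemma shift_P:
  assumes "a \<in> pf.P"
  shows "shift_rf k a \<in> pf.P"
proof -
  obtain p where p: "p \<in> polys_over F" "a = poly p x1"
    using assms unfolding pf.P_def by blast
  obtain q where "q \<in> polys_over F" "shift_rf k a = poly q x1"
    using shift_poly_x1[OF p(1), of k] p(2) by blast
  then show ?thesis
    unfolding pf.P_def by blast
qed

lemma shift_V: "a \<in> pf.V \<Longrightarrow> shift_rf k a \<in> pf.V"
proof -
  assume "a \<in> pf.V"
  then obtain p where p: "p \<in> polys_over F" "degree p < degree D" "a = poly p x1"
    unfolding pf.V_def by blast
  obtain q where "q \<in> polys_over F" "degree q \<le> degree p" "shift_rf k a = poly q x1"
    using shift_poly_x1[OF p(1), of k] p(3) by blast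
  then show ?thesis
    unfolding pf.V_def using p(2) le_less_trans[of "degree q" "degree p"] by auto
qed

section \<open>Coprimality to d over the coefficient field\<close>

lemma sep_dvd_iff:
  assumes "a \<in> mpolys_in {0..m}" "b \<in> mpolys_in {0..m}"
  shows "rdvd (polys_over (mpolys_in V0)) (sep 1 a) (sep 1 b) \<longleftrightarrow> a dvd b"
proof
  assume "rdvd (polys_over (mpolys_in V0)) (sep 1 a) (sep 1 b)"
  then obtain c where "sep 1 b = sep 1 a * c" unfolding rdvd_def by blast
  then have "poly (sep 1 b) (Var 1) = poly (sep 1 a * c) (Var 1)" by simp
  then have "b = a * poly c (Var 1)" by (simp only: poly_mult poly_sep)
  then show "a dvd b" by simp
next
  assume "a dvd b"
  then obtain c where c: "c \<in> mpolys_in {0..m}" "b = a * c"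
    using rdvd_mpolys_in[OF assms] unfolding rdvd_def by blast
  then show "rdvd (polys_over (mpolys_in V0)) (sep 1 a) (sep 1 b)"
    using sep_in_polys_over[of c 1 V0] ring_hom_onD(4)[OF ring_hom_sep, of 1 a c]
    unfolding insert_V0 rdvd_def by blast
qed

lemma sep_d_prime: "prime_in (polys_over (mpolys_in V0)) (sep 1 d)"
proof -
  have sepV: "sep 1 p \<in> polys_over (mpolys_in V0)" if "p \<in> mpolys_in {0..m}" for p :: "'k mpoly"
    using sep_in_polys_over[of p 1 V0] that unfolding insert_V0 by simp
  have sep_surj: "\<exists>p\<in>mpolys_in {0..m}. f = sep 1 p" if "f \<in> polys_over (mpolys_in V0)" for f :: "'k mpoly poly"
  proof (rule bexI)
    show "f = sep 1 (poly f (Var 1))" by (rule sep_poly[OF that, symmetric]) simp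
    show "poly f (Var 1) \<in> mpolys_in {0..m}"
      using poly_in_mpolys_in[OF that, of 1] unfolding insert_V0 .
  qed
  have one: "(1 :: 'k mpoly) \<in> mpolys_in {0..m}" by (rule sub_ring.one_closed[OF sub_ring_mpolys_in])
  have "sep 1 d \<noteq> 0" using d_deg unfolding degree_sep[symmetric] by auto
  moreover have "\<not> unit_in (polys_over (mpolys_in V0)) (sep 1 d)"
    using sep_dvd_iff[OF d_in one] d_irr
    unfolding unit_in_def ring_hom_onD(2)[OF ring_hom_sep] irreducible_def by blast
  moreover have "rdvd (polys_over (mpolys_in V0)) (sep 1 d) f \<or> rdvd (polys_over (mpolys_in V0)) (sep 1 d) g"
    if fg: "f \<in> polys_over (mpolys_in V0)" "g \<in> polys_over (mpolys_in V0)"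
      "rdvd (polys_over (mpolys_in V0)) (sep 1 d) (f * g)" for f g
  proof -
    obtain p q where pq: "p \<in> mpolys_in {0..m}" "f = sep 1 p" "q \<in> mpolys_in {0..m}" "g = sep 1 q"
      using sep_surj[OF fg(1)] sep_surj[OF fg(2)] by blast
    have "p * q \<in> mpolys_in {0..m}" using pq sub_ring.mult_closed[OF sub_ring_mpolys_in] by blast
    then have "d dvd p * q"
      using fg(3) sep_dvd_iff[OF d_in, of "p * q"]
      unfolding pq(2,4) ring_hom_onD(4)[OF ring_hom_sep] by blast
    then show ?thesis
      using irreducible_dvd_mult[OF _ d_in d_irr pq(1,3)] sep_dvd_iff[OF d_in pq(1)]
        sep_dvd_iff[OF d_in pq(3)] unfolding pq(2,4) by simp
  qed
  ultimately show ?thesis using sepV[OF d_in] unfolding prime_in_def by blast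
qed

text \<open>The point where Gauss's lemma enters: over polynomial coefficients the Bezout identity
  holds up to a nonzero \<open>s\<close> free of variable 1, and \<open>rf s\<close> is invertible
  in \<open>F\<close>.\<close>

lemma cop_rf:
  assumes w: "w \<in> mpolys_in {0..m}" "\<not> d dvd w"
  shows "pf.cop (rf w)"
proof -
  interpret R: sub_ring "mpolys_in V0 :: 'k mpoly set" by (rule sub_ring_mpolys_in)
  have "degree (sep 1 d) > 0" using d_deg degree_sep[of d] by simp
  moreover have "sep 1 w \<in> polys_over (mpolys_in V0)"
    using sep_in_polys_over[of w 1 V0] w(1) unfolding insert_V0 by simp
  ultimately obtain s u v where *: "s \<in> mpolys_in V0" "s \<noteq> 0" "u \<in> polys_over (mpolys_in V0)"
    "v \<in> polys_over (mpolys_in V0)" "u * sep 1 d + v * sep 1 w = [:s:]"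
    using R.prime_bezout[OF sep_d_prime _ _ ] w sep_dvd_iff[OF d_in w(1)] by metis
  define u' v' where "u' = poly u (Var 1)" and "v' = poly v (Var 1)"
  have uv: "u' \<in> mpolys_in {0..m}" "v' \<in> mpolys_in {0..m}"
    unfolding u'_def v'_def using poly_in_mpolys_in[OF *(3), of 1] poly_in_mpolys_in[OF *(4), of 1]
    unfolding insert_V0 by auto
  have "poly (u * sep 1 d + v * sep 1 w) (Var 1) = s" using *(5) by simp
  then have "u' * d + v' * w = s" by (simp add: poly_sep u'_def v'_def)
  then have "rf u' * rf d + rf v' * rf w = rf s"
    by (metis ring_hom_onD(3,4)[OF ring_hom_rf])
  then have "(rf u' * rf d + rf v' * rf w) / rf s = 1" using *(2) by simp
  then have "(rf u' / rf s) * rf d + (rf v' / rf s) * rf w = 1"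
    by (simp only: add_divide_distrib times_divide_eq_left)
  moreover have "inverse (rf s) \<in> pf.P"
    by (intro pf.F_subset_P pf.inverse_closed CollectI rf_in_rf *(1))
  then have "rf u' / rf s \<in> pf.P" "rf v' / rf s \<in> pf.P"
    unfolding divide_inverse by (intro sub_ring.mult_closed[OF pf.sub_ring_P] rf_in_P uv; assumption)+
  ultimately show ?thesis
    unfolding pf.cop_def delta using rf_in_P[OF w(1)] by blast
qed

lemma factor_d:
  assumes "q \<in> mpolys_in {0..m}" "q \<noteq> 0"
  shows "\<exists>k w. w \<in> mpolys_in {0..m} \<and> \<not> d dvd w \<and> q = d ^ k * w"
  using assms
proof (induction "degx1 q" arbitrary: q rule: less_induct)
  case less
  show ?case
  proof (cases "d dvd q")
    case False
    then show ?thesis using less.prems by (intro exI[of _ 0] exI[of _ q]) auto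
  next
    case True
    then obtain c where c: "c \<in> mpolys_in {0..m}" "q = d * c"
      using rdvd_mpolys_in[OF d_in less.prems(1)] unfolding rdvd_def by blast
    have "c \<noteq> 0" "d \<noteq> 0" using less.prems c by auto
    then have "degx1 q = degx1 d + degx1 c"
      unfolding c degree_sep[symmetric] ring_hom_onD[OF ring_hom_sep]
      by (metis degree_mult_eq poly_0 poly_sep)
    then obtain k w where "w \<in> mpolys_in {0..m}" "\<not> d dvd w" "c = d ^ k * w"
      using less.hyps[OF _ c(1) \<open>c \<noteq> 0\<close>] d_deg by auto
    then show ?thesis using c by (intro exI[of _ "Suc k"] exI[of _ w]) auto
  qed
qed

lemma expansion_rf_in:
  assumes "rf_in {0..m} g"
  shows "\<exists>A. pf.expansion g A"
proof -
  obtain p q where pq: "p \<in> mpolys_in {0..m}" "q \<in> mpolys_in {0..m}" "q \<noteq> 0" "g = Fract p q"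
    using assms by (rule rf_inE)
  obtain k w where w: "w \<in> mpolys_in {0..m}" "\<not> d dvd w" "q = d ^ k * w"
    using factor_d pq by blast
  have "g = rf p / rf q" unfolding pq(4) by (rule Fract_divide[OF pq(3)])
  also have "rf q = rf d ^ k * rf w" by (simp only: w ring_hom_onD[OF ring_hom_rf])
  finally show ?thesis
    using pf.expansion_exists[OF rf_in_P[OF pq(1)] cop_rf[OF w(1,2)], of k] unfolding delta by simp
qed

section \<open>The numerator operators and their behaviour under shifts\<close>

lemma numerator_in_V:
  assumes "rf_in {0..m} g"
  shows "pf.numerator_at i g \<in> pf.V"
proof -
  obtain A where A: "pf.expansion g A" using expansion_rf_in[OF assms] by blast
  then show ?thesis unfolding pf.numerator_at_eq[OF A] by (simp add: pf.expansion_def)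
qed

lemma numerator_add:
  assumes "rf_in {0..m} g" "rf_in {0..m} h"
  shows "pf.numerator_at i (g + h) = pf.numerator_at i g + pf.numerator_at i h"
proof -
  obtain A B where AB: "pf.expansion g A" "pf.expansion h B"
    using expansion_rf_in assms by blast
  show ?thesis
    unfolding pf.numerator_at_eq[OF AB(1)] pf.numerator_at_eq[OF AB(2)]
      pf.numerator_at_eq[OF pf.expansion_add[OF AB]] ..
qed

lemma numerator_diff:
  assumes "rf_in {0..m} g" "rf_in {0..m} h"
  shows "pf.numerator_at i (g - h) = pf.numerator_at i g - pf.numerator_at i h"
proof -
  obtain A B where AB: "pf.expansion g A" "pf.expansion h B"
    using expansion_rf_in assms by blast
  show ?thesis
    unfolding pf.numerator_at_eq[OF AB(1)] pf.numerator_at_eq[OF AB(2)]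
      pf.numerator_at_eq[OF pf.expansion_diff[OF AB]] ..
qed

lemma numerator_scale:
  assumes "rf_in {0..m} g" "rf_in V0 e"
  shows "pf.numerator_at i (e * g) = e * pf.numerator_at i g"
proof -
  obtain A where A: "pf.expansion g A" using expansion_rf_in[OF assms(1)] by blast
  have "e \<in> F" using assms(2) by simp
  show ?thesis
    unfolding pf.numerator_at_eq[OF A] pf.numerator_at_eq[OF pf.expansion_scale[OF A \<open>e \<in> F\<close>]] ..
qed

lemma numerator_sum:
  assumes "\<And>l. l \<in> I \<Longrightarrow> rf_in {0..m} (g l)"
  shows "pf.numerator_at i (\<Sum>l\<in>I. g l) = (\<Sum>l\<in>I. pf.numerator_at i (g l))"
  using assms
proof (induction I rule: infinite_finite_induct)
  case (insert y I)
  have "rf_in {0..m} (sum g I)"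
    using sub_ring.sum_closed[OF sub_ring_rf_in, of I g "{0..m}"] insert by auto
  with insert show ?case by (simp add: numerator_add)
qed (auto intro!: pf.numerator_at_Loc sub_ring.zero_closed[OF pf.sub_ring_Loc])

lemma numerator_shift:
  assumes "rf_in {0..m} g" "shift_rf k (rf d) = rf d"
  shows "pf.numerator_at i (shift_rf k g) = shift_rf k (pf.numerator_at i g)"
proof -
  obtain A where A: "pf.expansion g A" using expansion_rf_in[OF assms(1)] by blast
  have "pf.expansion (shift_rf k g) (\<lambda>i. shift_rf k (A i))"
    by (rule pf.expansion_hom[OF ring_hom_shift_rf shift_P shift_V _ A]) (simp_all add: delta assms(2))
  then show ?thesis
    unfolding pf.numerator_at_eq[OF A] by (rule pf.numerator_at_eq)
qed

lemma numerator_base: "a \<in> pf.V \<Longrightarrow> pf.numerator_at i (a / rf d ^ Suc i) = a"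
  using pf.numerator_at_eq[OF pf.expansion_term[of a i], of i] by (simp add: delta)

text \<open>If the shift moves \<open>d\<close>, the new denominator is a power of a polynomial not
  divisible by \<open>d\<close>, so no pole at \<open>d\<close> remains.\<close>

lemma numerator_shift_other:
  assumes "a \<in> pf.V" "shift_rf k (rf d) \<noteq> rf d"
  shows "pf.numerator_at i (shift_rf k (a / rf d ^ j)) = 0"
proof (rule pf.numerator_at_Loc)
  have "\<not> d dvd shift_poly k d"
    using dvd_shift_poly_imp_eq assms(2) by (metis shift_rf_rf)
  then have "pf.cop (shift_rf k (rf d))"
    unfolding shift_rf_rf by (intro cop_rf shift_poly_in d_in)
  then have "pf.cop (shift_rf k (rf d) ^ j)"
    by (induction j) (simp_all add: pf.cop_1 pf.cop_mult)
  then show "shift_rf k (a / rf d ^ j) \<in> pf.Loc"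
    unfolding shift_rf_divide ring_hom_onD(9)[OF ring_hom_shift_rf]
    by (intro pf.LocI pf.V_subset_P shift_V assms(1))
qed

lemma numerator_nonzero:
  assumes "p \<in> mpolys_in {0..m}" "q \<in> mpolys_in {0..m}" "q \<noteq> 0"
    and "pf.numerator_at i (Fract p q) \<noteq> 0"
  shows "d dvd q"
proof (rule ccontr)
  assume "\<not> d dvd q"
  then have "rf p / rf q \<in> pf.Loc"
    using assms by (intro pf.LocI rf_in_P cop_rf)
  then have "Fract p q \<in> pf.Loc" unfolding Fract_divide[OF assms(3), symmetric] .
  then show False using assms(4) pf.numerator_at_Loc by blast
qed

text \<open>Different shifts of \<open>d\<close> are non-associated irreducible polynomials of
  positive degree in x_1, so dividing \<open>q\<close> by one of them keeps the others as divisors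
  and lowers \<open>degx1\<close>.\<close>

lemma finite_shifted_divisors:
  assumes "q \<in> mpolys_in {0..m}" "q \<noteq> 0" "inj_on (\<lambda>r. shift_poly r d) C"
  shows "finite {r\<in>C. shift_poly r d dvd q}"
  using assms(1,2)
proof (induction "degx1 q" arbitrary: q rule: less_induct)
  case less
  show ?case
  proof (cases "\<exists>r\<in>C. shift_poly r d dvd q")
    case True
    then obtain r where r: "r \<in> C" "shift_poly r d dvd q" by blast
    define p where "p = shift_poly r d"
    have p: "p \<in> mpolys_in {0..m}" unfolding p_def by (intro shift_poly_in d_in)
    obtain c where c: "c \<in> mpolys_in {0..m}" "q = p * c"
      using rdvd_mpolys_in[OF p less.prems(1)] r unfolding rdvd_def p_def by blast
    have "c \<noteq> 0" "p \<noteq> 0" using less.prems c by auto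
    then have "degx1 q = degx1 p + degx1 c"
      unfolding c degree_sep[symmetric] ring_hom_onD[OF ring_hom_sep]
      by (metis degree_mult_eq poly_0 poly_sep)
    \<comment> \<open>Otherwise \<open>p\<close> would avoid variable 1, and so would
      \<open>d\<close> after shifting back.\<close>
    moreover have "degx1 p > 0"
    proof (rule ccontr)
      assume "\<not> degx1 p > 0"
      then have "degree (sep 1 p) = 0" unfolding degree_sep by simp
      then obtain s where "sep 1 p = [:s:]" by (auto elim: degree_eq_zeroE)
      then have "p = s" using poly_sep[of 1 p] by simp
      have "sep 1 p \<in> polys_over (mpolys_in V0)"
        using sep_in_polys_over[of p 1 V0] p unfolding insert_V0 by simp
      then have "coeff (sep 1 p) 0 \<in> mpolys_in V0" by (rule polys_overD)
      then have "p \<in> mpolys_in V0" using \<open>p = s\<close> \<open>sep 1 p = [:s:]\<close> by simp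
      then have "shift_poly (\<lambda>w. - r w) p \<in> mpolys_in V0" by (rule shift_poly_in)
      then have "d \<in> mpolys_in V0" by (simp add: p_def shift_poly_uminus)
      then have "sep 1 d = [:d:]" by (rule sep_const) simp
      then show False using d_deg degree_sep[of d] by simp
    qed
    ultimately have "finite {r\<in>C. shift_poly r d dvd c}"
      using less.hyps[OF _ c(1) \<open>c \<noteq> 0\<close>] by simp
    moreover have "{r\<in>C. shift_poly r d dvd q} \<subseteq> insert r {r\<in>C. shift_poly r d dvd c}"
    proof (intro subsetI, rule ccontr)
      fix s assume "s \<in> {r\<in>C. shift_poly r d dvd q}" "s \<notin> insert r {r\<in>C. shift_poly r d dvd c}"
      then have s: "s \<in> C" "shift_poly s d dvd q" "\<not> shift_poly s d dvd c" "s \<noteq> r" by auto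
      have "shift_poly s d dvd p"
        using irreducible_dvd_mult[OF _ shift_poly_in[OF d_in] irreducible_shift_poly[OF d_irr] p c(1)]
          s c(2) by blast
      then have "shift_poly (\<lambda>w. - s w) (shift_poly s d) dvd shift_poly (\<lambda>w. - s w) p"
        by simp
      then have "d dvd shift_poly (\<lambda>w. - s w + r w) d"
        by (simp only: shift_poly_uminus p_def shift_poly_add)
      then have "shift_poly (\<lambda>w. - s w + r w) d = d" by (rule dvd_shift_poly_imp_eq)
      then have "shift_poly s (shift_poly (\<lambda>w. - s w + r w) d) = shift_poly s d" by simp
      then have "shift_poly r d = shift_poly s d" by (simp add: shift_poly_add)
      then have "s = r" using assms(3) s(1) r(1) by (metis inj_onD)
      with s(4) show False ..
    qed
    ultimately show ?thesis using finite_subset by blast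
  next
    case False
    then have "{r\<in>C. shift_poly r d dvd q} = {}" by blast
    then show ?thesis by (simp only: finite.emptyI)
  qed
qed

end

section \<open>Difference spans and coset representatives\<close>

lemma shift_rf_cong: "(\<And>w. k w = k' w) \<Longrightarrow> shift_rf k f = shift_rf k' f"
  by (metis ext)

lemma shift_rf_uminus: "shift_rf (\<lambda>w. - k w) (shift_rf k f) = f"
  by (simp add: shift_rf_add)

lemma shift_rf_commute: "shift_rf k (shift_rf k' f) = shift_rf k' (shift_rf k f)"
  by (simp add: shift_rf_add add.commute)

lemma shift_rf_Delta: "shift_rf k (Delta k' g) = Delta k' (shift_rf k g)"
  unfolding Delta_def by (simp add: ring_hom_onD(6)[OF ring_hom_shift_rf] shift_rf_commute[of k])

lemma Delta_scale: "shift_rf k e = e \<Longrightarrow> e * Delta k g = Delta k (e * g)"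
  by (simp add: Delta_def ring_hom_onD(4)[OF ring_hom_shift_rf] right_diff_distrib)

text \<open>Used twice: with numerators of low degree and a basis of \<open>G_d\<close> it is the
  right-hand side of the operator equation, with all rational functions and the unit vectors it is
  the telescoping condition.\<close>

definition delta_span :: "'k::field rfun set \<Rightarrow> nat \<Rightarrow> (nat \<Rightarrow> nat \<Rightarrow> int) \<Rightarrow> 'k rfun set" where
  "delta_span M r tau = {\<Sum>i=1..r. Delta (tau i) (b i) | b. \<forall>i\<in>{1..r}. b i \<in> M}"

lemma delta_spanI:
  "u = (\<Sum>i=1..r. Delta (tau i) (b i)) \<Longrightarrow> \<forall>i\<in>{1..r}. b i \<in> M \<Longrightarrow> u \<in> delta_span M r tau"
  unfolding delta_span_def by blast

locale shift_module =
  fixes M :: "'k::field rfun set"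
  assumes M_0: "0 \<in> M"
    and M_diff: "u \<in> M \<Longrightarrow> v \<in> M \<Longrightarrow> u - v \<in> M"
    and M_shift: "u \<in> M \<Longrightarrow> shift_rf k u \<in> M"
    and M_scale: "rf_in {0} e \<Longrightarrow> u \<in> M \<Longrightarrow> e * u \<in> M"
begin

lemma span_0: "0 \<in> delta_span M r tau"
proof -
  have "(0 :: 'k rfun) = (\<Sum>i=1..r. Delta (tau i) 0)"
    by (simp add: Delta_def ring_hom_onD(1)[OF ring_hom_shift_rf])
  then show ?thesis by (rule delta_spanI) (simp add: M_0)
qed

lemma span_diff:
  assumes "u \<in> delta_span M r tau" "v \<in> delta_span M r tau"
  shows "u - v \<in> delta_span M r tau"
proof -
  obtain b c where bc: "\<forall>i\<in>{1..r}. b i \<in> M" "\<forall>i\<in>{1..r}. c i \<in> M"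
      "u = (\<Sum>i=1..r. Delta (tau i) (b i))" "v = (\<Sum>i=1..r. Delta (tau i) (c i))"
    using assms unfolding delta_span_def by blast
  have "u - v = (\<Sum>i=1..r. Delta (tau i) (b i - c i))"
    unfolding bc(3,4) sum_subtractf[symmetric]
    by (intro sum.cong refl) (simp add: Delta_def ring_hom_onD(6)[OF ring_hom_shift_rf])
  moreover have "\<forall>i\<in>{1..r}. b i - c i \<in> M" using bc M_diff by blast
  ultimately show ?thesis by (rule delta_spanI)
qed

lemma span_uminus: "u \<in> delta_span M r tau \<Longrightarrow> - u \<in> delta_span M r tau"
  using span_diff[OF span_0] by fastforce

lemma span_add:
  assumes "u \<in> delta_span M r tau" "v \<in> delta_span M r tau"
  shows "u + v \<in> delta_span M r tau"
  using span_diff[OF assms(1) span_uminus[OF assms(2)]] by simp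

lemma span_sum: "(\<And>i. i \<in> I \<Longrightarrow> f i \<in> delta_span M r tau) \<Longrightarrow> sum f I \<in> delta_span M r tau"
  by (induction I rule: infinite_finite_induct) (simp_all add: span_0 span_add)

lemma span_shift:
  assumes "u \<in> delta_span M r tau"
  shows "shift_rf k u \<in> delta_span M r tau"
proof -
  obtain b where b: "\<forall>i\<in>{1..r}. b i \<in> M" "u = (\<Sum>i=1..r. Delta (tau i) (b i))"
    using assms unfolding delta_span_def by blast
  have "shift_rf k u = (\<Sum>i=1..r. Delta (tau i) (shift_rf k (b i)))"
    unfolding b(2) ring_hom_onD(7)[OF ring_hom_shift_rf] shift_rf_Delta ..
  moreover have "\<forall>i\<in>{1..r}. shift_rf k (b i) \<in> M" using b M_shift by blast
  ultimately show ?thesis by (rule delta_spanI)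
qed

text \<open>Shifts with t-component 0 fix K(t), so the factor \<open>e\<close> can be moved inside
  the differences.\<close>

lemma span_scale:
  assumes "u \<in> delta_span M r tau" "rf_in {0} e" "\<And>i. i \<in> {1..r} \<Longrightarrow> tau i 0 = 0"
  shows "e * u \<in> delta_span M r tau"
proof -
  obtain b where b: "\<forall>i\<in>{1..r}. b i \<in> M" "u = (\<Sum>i=1..r. Delta (tau i) (b i))"
    using assms(1) unfolding delta_span_def by blast
  have "shift_rf (tau i) e = e" if "i \<in> {1..r}" for i
    by (rule shift_rf_id[OF assms(2)]) (use assms(3)[OF that] in simp)
  then have "e * u = (\<Sum>i=1..r. Delta (tau i) (e * b i))"
    unfolding b(2) sum_distrib_left by (intro sum.cong refl Delta_scale)
  moreover have "\<forall>i\<in>{1..r}. e * b i \<in> M" using b M_scale assms(2) by blast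
  ultimately show ?thesis by (rule delta_spanI)
qed

lemma Delta_in_span:
  assumes "i \<in> {1..r}" "u \<in> M"
  shows "Delta (tau i) u \<in> delta_span M r tau"
proof -
  have "Delta (tau i) u = (\<Sum>l=1..r. Delta (tau l) (if l = i then u else 0))"
  proof -
    have "(\<Sum>l=1..r. Delta (tau l) (if l = i then u else 0)) = (\<Sum>l=1..r. if l = i then Delta (tau i) u else 0)"
      by (intro sum.cong refl) (simp add: Delta_def ring_hom_onD(1)[OF ring_hom_shift_rf])
    then show ?thesis using assms(1) by simp
  qed
  moreover have "\<forall>l\<in>{1..r}. (if l = i then u else 0) \<in> M" using assms M_0 by simp
  ultimately show ?thesis by (rule delta_spanI)
qed

text \<open>The exponent vectors \<open>h\<close> for which \<open>Delta h\<close> maps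
  \<open>M\<close> into the span form a group: the difference at \<open>h + k\<close> is
  \<open>Delta h (shift_rf k u) + Delta k u\<close>, and \<open>M\<close> is stable under
  shifts.\<close>

lemma Delta_zlin_in_span:
  assumes "I \<subseteq> {1..r}" "u \<in> M"
  shows "Delta (zlin c I tau) u \<in> delta_span M r tau"
proof -
  define H where "H = {h. \<forall>u\<in>M. Delta h u \<in> delta_span M r tau}"
  have H0: "(\<lambda>_. 0) \<in> H" by (simp add: H_def Delta_def span_0)
  have Hadd: "(\<lambda>w. h w + k w) \<in> H" if "h \<in> H" "k \<in> H" for h k
  proof -
    have "Delta (\<lambda>w. h w + k w) u = Delta h (shift_rf k u) + Delta k u" for u :: "'k rfun"
      by (simp add: Delta_def shift_rf_add)
    then show ?thesis using that M_shift span_add by (simp add: H_def)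
  qed
  have Hneg: "(\<lambda>w. - h w) \<in> H" if "h \<in> H" for h
  proof -
    have "Delta (\<lambda>w. - h w) u = - Delta h (shift_rf (\<lambda>w. - h w) u)" for u :: "'k rfun"
      by (simp add: Delta_def shift_rf_add)
    then show ?thesis using that M_shift span_uminus by (simp add: H_def)
  qed
  have Hnat: "(\<lambda>w. int z * h w) \<in> H" if "h \<in> H" for h z
  proof (induction z)
    case (Suc z)
    from Hadd[OF that this] show ?case by (simp add: algebra_simps)
  qed (simp add: H0)
  have Hint: "(\<lambda>w. z * h w) \<in> H" if "h \<in> H" for h z
  proof (cases z)
    case (nonneg y)
    with Hnat[OF that, of y] show ?thesis by simp
  next
    case (neg y)
    from Hneg[OF Hnat[OF that, of "Suc y"]] show ?thesis by (simp only: neg minus_mult_left)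
  qed
  have "finite I" using assms(1) finite_subset by blast
  then have "zlin c I tau \<in> H"
    using assms(1)
  proof (induction I rule: finite_induct)
    case empty
    then show ?case using H0 by (simp add: zlin_def)
  next
    case (insert i I)
    have "tau i \<in> H" using insert.prems Delta_in_span by (simp add: H_def)
    then have "(\<lambda>w. c i * tau i w + zlin c I tau w) \<in> H"
      using Hadd[OF Hint] insert by simp
    moreover have "zlin c (insert i I) tau = (\<lambda>w. c i * tau i w + zlin c I tau w)"
      using insert.hyps by (simp add: zlin_def fun_eq_iff)
    ultimately show ?case by simp
  qed
  then show ?thesis using assms(2) by (simp add: H_def)
qed

end

lemma shift_module_rf_in:
  assumes "0 \<in> V"
  shows "shift_module {f :: 'k::field rfun. rf_in V f}"
proof -
  interpret E: sub_ring "{f :: 'k rfun. rf_in V f}" by (rule sub_ring_rf_in)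
  have "rf_in V (e * u)" if "rf_in {0} e" "rf_in V u" for e u :: "'k rfun"
    using E.mult_closed[of e u] rf_in_mono[of "{0}" V e] that assms by simp
  then show ?thesis
    using E.zero_closed E.diff_closed by (auto simp: shift_module_def rf_in_shift_rf)
qed

text \<open>Reindexes an operator with possibly negative, sparse exponents.\<close>
lemma reindex_coefficients:
  fixes x y :: "nat \<Rightarrow> 'a::comm_ring_1"
  assumes "finite A" "inj_on p A" "p ` A \<subseteq> {..N}"
  obtains x' where "\<And>l. l \<in> A \<Longrightarrow> x' (p l) = x l" "\<And>i. i \<notin> p ` A \<Longrightarrow> x' i = 0"
    "(\<Sum>i\<le>N. x' i * y i) = (\<Sum>l\<in>A. x l * y (p l))"
proof -
  define x' where "x' = (\<lambda>i. if i \<in> p ` A then x (the_inv_into A p i) else 0)"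
  have x': "x' (p l) = x l" if "l \<in> A" for l
    using that assms(2) by (simp add: x'_def the_inv_into_f_f)
  have "(\<Sum>i\<le>N. x' i * y i) = (\<Sum>i\<in>p ` A. x' i * y i)"
    by (rule sum.mono_neutral_right) (use assms in \<open>auto simp: x'_def\<close>)
  also have "\<dots> = (\<Sum>l\<in>A. x l * y (p l))"
    by (subst sum.reindex[OF assms(2)]) (auto intro!: sum.cong simp: x')
  finally show ?thesis using that[of x'] x' by (simp add: x'_def)
qed

section \<open>Stabilisers, coset representatives and supports\<close>

context shift_setting
begin

lemma V_rf_in: "a \<in> pf.V \<Longrightarrow> rf_in {0..m} a"
proof -
  interpret E: sub_ring "{f :: 'k rfun. rf_in {0..m} f}" by (rule sub_ring_rf_in)
  assume "a \<in> pf.V"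
  then obtain p where p: "p \<in> polys_over F" "a = poly p x1"
    unfolding pf.V_def by blast
  have "rf_in {0..m} x1" by (rule rf_in_rf) (use n in simp)
  moreover have "rf_in {0..m} (coeff p i)" for i
    using polys_overD[OF p(1), of i] rf_in_mono[of V0 "{0..m}"] by auto
  ultimately have "(\<Sum>i\<le>degree p. coeff p i * x1 ^ i) \<in> {f. rf_in {0..m} f}"
    by (intro E.sum_closed E.mult_closed E.power_closed) simp_all
  then show ?thesis unfolding p(2) poly_altdef by simp
qed

lemma in_V0: "rf_in {0} e \<Longrightarrow> rf_in V0 e"
  by (rule rf_in_mono[of "{0}"]) auto

sublocale V: shift_module pf.V
proof
  show "e * u \<in> pf.V" if "rf_in {0} e" "u \<in> pf.V" for e u
    by (rule pf.V_scale) (use that in_V0 in auto)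
qed (simp_all add: pf.V_diff shift_V)

sublocale E: shift_module "{f. rf_in {0..m} f}"
  by (rule shift_module_rf_in) simp

lemma Gtd_iff: "k \<in> Gtd n d \<longleftrightarrow> in_Gt n k \<and> shift_poly k d = d"
  by (simp add: Gtd_def shift_rf_rf)

lemma Gtd_add: "k \<in> Gtd n d \<Longrightarrow> k' \<in> Gtd n d \<Longrightarrow> (\<lambda>w. k w + k' w) \<in> Gtd n d"
  by (simp add: Gtd_iff in_Gt_def flip: shift_poly_add)

lemma Gtd_uminus: "k \<in> Gtd n d \<Longrightarrow> (\<lambda>w. - k w) \<in> Gtd n d"
  unfolding Gtd_iff in_Gt_def using shift_poly_uminus(2)[of k d] by simp

lemma Gd_add: "k \<in> Gd n d \<Longrightarrow> k' \<in> Gd n d \<Longrightarrow> (\<lambda>w. k w + k' w) \<in> Gd n d"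
  using Gtd_add by (simp add: Gd_def)

lemma Gd_uminus: "k \<in> Gd n d \<Longrightarrow> (\<lambda>w. - k w) \<in> Gd n d"
  using Gtd_uminus by (simp add: Gd_def)

lemma Gd_0: "(\<lambda>_. 0) \<in> Gd n d"
  by (simp add: Gd_def Gtd_iff in_Gt_def shift_poly_id)

lemma Gtd_mult: "k \<in> Gtd n d \<Longrightarrow> (\<lambda>w. z * k w) \<in> Gtd n d"
proof -
  assume k: "k \<in> Gtd n d"
  have nat: "(\<lambda>w. int y * k w) \<in> Gtd n d" for y
  proof (induction y)
    case 0
    then show ?case using Gd_0 by (simp add: Gd_def)
  next
    case (Suc y)
    from Gtd_add[OF k this] show ?case by (simp add: algebra_simps)
  qed
  show ?thesis
  proof (cases z)
    case (nonneg y)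
    with nat[of y] show ?thesis by simp
  next
    case (neg y)
    from Gtd_uminus[OF nat[of "Suc y"]] show ?thesis by (simp only: neg minus_mult_left)
  qed
qed

definition G :: "(nat \<Rightarrow> int) set" where "G = {k. in_Gt n k \<and> k 0 = 0}"

definition rep :: "(nat \<Rightarrow> int) \<Rightarrow> nat \<Rightarrow> int" where
  "rep h = (SOME c. (\<lambda>w. h w - c w) \<in> Gd n d)"

lemma rep_Gd: "(\<lambda>w. h w - rep h w) \<in> Gd n d"
  unfolding rep_def by (rule someI[of _ h]) (use Gd_0 in simp)

text \<open>The predicate inside \<open>SOME\<close> is the same for all members of a coset, so the
  choice is constant on cosets of \<open>G_d\<close>.\<close>

lemma rep_cong:
  assumes "(\<lambda>w. h w - h' w) \<in> Gd n d"
  shows "rep h = rep h'"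
proof -
  have "(\<lambda>w. h w - c w) \<in> Gd n d \<longleftrightarrow> (\<lambda>w. h' w - c w) \<in> Gd n d" for c
    using Gd_add[OF assms, of "\<lambda>w. h' w - c w"] Gd_add[OF Gd_uminus[OF assms], of "\<lambda>w. h w - c w"]
    by auto
  then show ?thesis by (simp add: rep_def)
qed

lemma rep_Gd': "(\<lambda>w. rep h w - h w) \<in> Gd n d"
  using Gd_uminus[OF rep_Gd[of h]] by simp

lemma rep_G: "h \<in> G \<Longrightarrow> rep h \<in> G"
  using rep_Gd[of h] by (auto simp: G_def Gd_def Gtd_def in_Gt_def)

definition C :: "(nat \<Rightarrow> int) set" where "C = rep ` G"

lemma C_G: "r \<in> C \<Longrightarrow> r \<in> G"
  using rep_G by (auto simp: C_def)

lemma rep_C: "r \<in> C \<Longrightarrow> rep r = r"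
  unfolding C_def using rep_cong[OF rep_Gd'] by auto

lemma rep_in_C: "h \<in> G \<Longrightarrow> rep h \<in> C"
  by (auto simp: C_def)

lemma inj_shift_C: "inj_on (\<lambda>r. shift_poly r d) C"
proof (rule inj_onI)
  fix r r' assume r: "r \<in> C" "r' \<in> C" "shift_poly r d = shift_poly r' d"
  have "shift_poly (\<lambda>w. - r' w + r w) d = d"
    unfolding shift_poly_add[symmetric] r(3) shift_poly_uminus ..
  then have "(\<lambda>w. r w - r' w) \<in> Gd n d"
    using C_G[OF r(1)] C_G[OF r(2)] by (simp add: Gd_def Gtd_iff G_def in_Gt_def algebra_simps)
  then have "rep r = rep r'" by (rule rep_cong)
  then show "r = r'" using rep_C r by simp
qed

lemma G_add: "h \<in> G \<Longrightarrow> k \<in> G \<Longrightarrow> (\<lambda>w. h w + k w) \<in> G"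
  by (auto simp: G_def in_Gt_def)

lemma G_diff: "h \<in> G \<Longrightarrow> k \<in> G \<Longrightarrow> (\<lambda>w. h w - k w) \<in> G"
  by (auto simp: G_def in_Gt_def)

lemma G_zlin:
  assumes "s \<in> G"
  shows "s = zlin s {1..n} (\<lambda>i. unitv i 1)"
proof
  fix w
  have "zlin s {1..n} (\<lambda>i. unitv i 1) w = (\<Sum>i=1..n. if w = i then s w else 0)"
    unfolding zlin_def by (intro sum.cong) (auto simp: unitv_def)
  also have "\<dots> = s w"
    using assms by (cases "w = 0") (auto simp: G_def in_Gt_def)
  finally show "s w = zlin s {1..n} (\<lambda>i. unitv i 1) w" ..
qed

lemma shift_G_in_span:
  assumes "s \<in> G" "rf_in {0..m} g"
  shows "Delta s g \<in> delta_span {f. rf_in {0..m} f} n (\<lambda>i. unitv i 1)"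
proof -
  have "Delta (zlin s {1..n} (\<lambda>i. unitv i 1)) g \<in> delta_span {f. rf_in {0..m} f} n (\<lambda>i. unitv i 1)"
    by (rule E.Delta_zlin_in_span) (use assms in auto)
  then show ?thesis unfolding G_zlin[OF assms(1), symmetric] .
qed

text \<open>The numerator attached to the conjugate of d by r, transported back to d.\<close>
definition num :: "nat \<Rightarrow> (nat \<Rightarrow> int) \<Rightarrow> 'k rfun \<Rightarrow> 'k rfun" where
  "num i r g = pf.numerator_at i (shift_rf (\<lambda>w. - r w) g)"

definition supp :: "nat \<Rightarrow> 'k rfun \<Rightarrow> (nat \<Rightarrow> int) set" where
  "supp i g = {r \<in> C. num i r g \<noteq> 0}"

lemma num_in_V: "rf_in {0..m} g \<Longrightarrow> num i r g \<in> pf.V"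
  unfolding num_def by (intro numerator_in_V rf_in_shift_rf)

text \<open>A nonzero numerator at \<open>r\<close> forces the conjugate
  \<open>shift_poly r d\<close> to divide the denominator, and distinct representatives give
  distinct conjugates.\<close>

lemma finite_supp:
  assumes "rf_in {0..m} g"
  shows "finite (supp i g)"
proof -
  obtain p q where pq: "p \<in> mpolys_in {0..m}" "q \<in> mpolys_in {0..m}" "q \<noteq> 0" "g = Fract p q"
    using assms by (rule rf_inE)
  have "supp i g \<subseteq> {r\<in>C. shift_poly r d dvd q}"
  proof
    fix r assume r: "r \<in> supp i g"
    then have "pf.numerator_at i (Fract (shift_poly (\<lambda>w. - r w) p) (shift_poly (\<lambda>w. - r w) q)) \<noteq> 0"
      by (simp add: supp_def num_def pq(4) shift_rf_Fract[OF pq(3)])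
    then have "d dvd shift_poly (\<lambda>w. - r w) q"
      using pq by (intro numerator_nonzero[of "shift_poly (\<lambda>w. - r w) p" _ i] shift_poly_in) simp_all
    then have "shift_poly r d dvd shift_poly r (shift_poly (\<lambda>w. - r w) q)" by simp
    then have "shift_poly r d dvd q" unfolding shift_poly_uminus .
    then show "r \<in> {r\<in>C. shift_poly r d dvd q}" using r by (simp add: supp_def)
  qed
  then show ?thesis
    using finite_shifted_divisors[OF pq(2,3) inj_shift_C] finite_subset by blast
qed

end

section \<open>Necessity of the difference equation for the numerator\<close>

text \<open>The assumptions are common to both forms of the basis hypothesis, so trivial
  \<open>G_d\<close> requires no separate treatment below. The denominator is
  \<open>rf d ^ Suc i\<close> because numerators are indexed from 0.\<close>

locale telescoping = shift_setting m n d for m n :: nat and d :: "'k::field mpoly" +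
  fixes r :: nat and tau :: "nat \<Rightarrow> nat \<Rightarrow> int" and i :: nat and a :: "'k rfun"
  assumes tau_Gd: "\<And>l. l \<in> {1..r} \<Longrightarrow> tau l \<in> Gd n d"
    and tau_gen: "\<And>h. h \<in> Gd n d \<Longrightarrow> \<exists>c. h = zlin c {1..r} tau"
    and tau0: "tau 0 \<in> Gtd n d" "tau 0 0 \<noteq> 0"
    and quotient: "\<And>h. h \<in> Gtd n d \<Longrightarrow> \<exists>c. (\<lambda>w. h w - c * tau 0 w) \<in> Gd n d"
    and a_V: "a \<in> pf.V"
begin

abbreviation W :: "'k rfun set" where "W \<equiv> delta_span pf.V r tau"
abbreviation S :: "'k rfun set" where
  "S \<equiv> delta_span {f. rf_in {0..m} f} n (\<lambda>i. unitv i 1)"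

definition f :: "'k rfun" where "f = a / rf d ^ Suc i"

lemma f_in: "rf_in {0..m} f"
proof -
  interpret E: sub_ring "{f :: 'k rfun. rf_in {0..m} f}" by (rule sub_ring_rf_in)
  have "rf_in {0..m} (rf d ^ Suc i)"
    using E.power_closed[of "rf d" "Suc i"] rf_in_rf[OF d_in] by blast
  then show ?thesis
    unfolding f_def by (intro rf_in_divide V_rf_in[OF a_V])
qed

lemma Gd_W: "h \<in> Gd n d \<Longrightarrow> u \<in> pf.V \<Longrightarrow> Delta h u \<in> W"
  using tau_gen[of h] V.Delta_zlin_in_span[of "{1..r}" r u _ tau] by blast

text \<open>Translation by \<open>s\<close> permutes the cosets: \<open>\<phi> c\<close> represents
  \<open>c - s\<close>, and the defect \<open>h c\<close> lies in \<open>G_d\<close>, which acts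
  trivially modulo \<open>W\<close>. Hence the coset sums of \<open>g\<close> and of its shift agree
  modulo \<open>W\<close>.\<close>

lemma num_Delta:
  assumes s: "s \<in> G" and g: "rf_in {0..m} g"
    and T: "finite T" "T \<subseteq> C" "supp i g \<subseteq> T" "supp i (shift_rf s g) \<subseteq> T"
  shows "(\<Sum>c\<in>T. num i c (Delta s g)) \<in> W"
proof -
  let ?g = "shift_rf s g"
  define \<phi> where "\<phi> c = rep (\<lambda>w. c w - s w)" for c
  define \<psi> where "\<psi> c = rep (\<lambda>w. c w + s w)" for c
  define h where "h c = (\<lambda>w. \<phi> c w - (c w - s w))" for c
  have g': "rf_in {0..m} ?g" by (rule rf_in_shift_rf[OF g])
  have h: "h c \<in> Gd n d" for c
    unfolding h_def \<phi>_def by (rule rep_Gd')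
  have num: "num i c ?g = shift_rf (h c) (num i (\<phi> c) g)" for c
  proof -
    have "shift_rf (\<lambda>w. - c w) ?g = shift_rf (h c) (shift_rf (\<lambda>w. - \<phi> c w) g)"
      unfolding shift_rf_add by (rule shift_rf_cong) (simp add: h_def)
    moreover have "shift_rf (h c) (rf d) = rf d"
      using h[of c] by (simp add: Gd_def Gtd_def)
    ultimately show ?thesis
      unfolding num_def by (simp only: numerator_shift[OF rf_in_shift_rf[OF g]])
  qed
  \<comment> \<open>\<open>T\<close> need not be stable under \<open>\<phi>\<close>, so the
    reindexing takes place on the supports, which \<open>\<phi>\<close> matches bijectively.\<close>
  have num0: "num i c ?g = 0 \<longleftrightarrow> num i (\<phi> c) g = 0" for c
  proof
    assume "num i c ?g = 0"
    then have "shift_rf (\<lambda>w. - h c w) (shift_rf (h c) (num i (\<phi> c) g)) = 0"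
      by (simp add: num ring_hom_onD(1)[OF ring_hom_shift_rf] flip: num)
    then show "num i (\<phi> c) g = 0" by (simp only: shift_rf_uminus)
  qed (simp add: num ring_hom_onD(1)[OF ring_hom_shift_rf])
  have \<phi>\<psi>: "\<phi> (\<psi> c) = c" if "c \<in> C" for c
  proof -
    have "\<phi> (\<psi> c) = rep c"
      unfolding \<phi>_def by (rule rep_cong) (use rep_Gd'[of "\<lambda>w. c w + s w"] in \<open>simp add: \<psi>_def algebra_simps\<close>)
    then show ?thesis using rep_C that by simp
  qed
  have \<psi>\<phi>: "\<psi> (\<phi> c) = c" if "c \<in> C" for c
  proof -
    have "\<psi> (\<phi> c) = rep c"
      unfolding \<psi>_def by (rule rep_cong) (use rep_Gd'[of "\<lambda>w. c w - s w"] in \<open>simp add: \<phi>_def algebra_simps\<close>)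
    then show ?thesis using rep_C that by simp
  qed
  have \<phi>C: "\<phi> c \<in> C" and \<psi>C: "\<psi> c \<in> C" if "c \<in> C" for c
    unfolding \<phi>_def \<psi>_def by (intro rep_in_C G_diff G_add C_G that s)+
  have reindex: "(\<Sum>c\<in>supp i ?g. num i (\<phi> c) g) = (\<Sum>c\<in>supp i g. num i c g)"
  proof (rule sum.reindex_bij_witness[of _ \<psi> \<phi>])
    fix c assume c: "c \<in> supp i ?g"
    then have "c \<in> C" by (simp add: supp_def)
    then show "\<psi> (\<phi> c) = c" by (rule \<psi>\<phi>)
    show "\<phi> c \<in> supp i g" using c \<phi>C num0[of c] by (simp add: supp_def)
    show "num i (\<phi> c) g = num i (\<phi> c) g" ..
  next
    fix c assume c: "c \<in> supp i g"
    then have "c \<in> C" by (simp add: supp_def)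
    then show "\<phi> (\<psi> c) = c" by (rule \<phi>\<psi>)
    then show "\<psi> c \<in> supp i ?g" using c \<psi>C num0[of "\<psi> c"] by (simp add: supp_def)
  qed
  have restrict: "(\<Sum>c\<in>T. num i c u) = (\<Sum>c\<in>supp i u. num i c u)" if "supp i u \<subseteq> T" for u
    by (rule sum.mono_neutral_right) (use that T(1,2) in \<open>auto simp: supp_def\<close>)
  have "num i c (Delta s g) = num i c ?g - num i c g" for c
    unfolding num_def Delta_def ring_hom_onD(6)[OF ring_hom_shift_rf]
    by (intro numerator_diff rf_in_shift_rf g)
  then have "(\<Sum>c\<in>T. num i c (Delta s g)) = (\<Sum>c\<in>T. num i c ?g) - (\<Sum>c\<in>T. num i c g)"
    by (simp add: sum_subtractf)
  also have "\<dots> = (\<Sum>c\<in>supp i ?g. num i c ?g) - (\<Sum>c\<in>supp i ?g. num i (\<phi> c) g)"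
    unfolding reindex restrict[OF T(3)] restrict[OF T(4)] ..
  also have "\<dots> = (\<Sum>c\<in>supp i ?g. Delta (h c) (num i (\<phi> c) g))"
    unfolding sum_subtractf[symmetric] Delta_def num[symmetric] ..
  also have "\<dots> \<in> W"
    by (intro V.span_sum Gd_W h num_in_V g)
  finally show ?thesis .
qed

text \<open>The complement of a power of \<open>\<tau>_0\<close> in \<open>\<sigma>_t^z\<close>: if
  \<open>tau 0 0\<close> divides \<open>z\<close>, it lies in \<open>G\<close> and the other factor
  lies in \<open>G_{t,d}\<close>.\<close>

definition offset :: "int \<Rightarrow> nat \<Rightarrow> int" where
  "offset z = (\<lambda>w. unitv 0 z w - (z div tau 0 0) * tau 0 w)"

lemma unitv_in_Gt: "in_Gt n (unitv 0 z)"
  by (simp add: in_Gt_def unitv_def)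

lemma tau0_in_Gt: "in_Gt n (tau 0)"
  using tau0 by (simp add: Gtd_def)

lemma offset_G: "tau 0 0 dvd z \<Longrightarrow> offset z \<in> G"
  using tau0_in_Gt by (auto simp: G_def offset_def in_Gt_def unitv_def)

lemma num_shift_f:
  assumes r: "c \<in> C"
  shows "num i c (shift_rf (unitv 0 z) f) =
    (if tau 0 0 dvd z \<and> rep (offset z) = c
     then shift_rf (\<lambda>w. offset z w - c w) (shift_rf (\<lambda>w. (z div tau 0 0) * tau 0 w) a) else 0)"
proof -
  define k where "k = (\<lambda>w. - c w + unitv 0 z w)"
  have c0: "c 0 = 0" and cG: "in_Gt n c" using C_G[OF r] by (auto simp: G_def)
  have kG: "in_Gt n k" using cG unitv_in_Gt by (simp add: k_def in_Gt_def)
  have num: "num i c (shift_rf (unitv 0 z) f) = pf.numerator_at i (shift_rf k f)"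
    by (simp add: num_def shift_rf_add k_def)
  show ?thesis
  proof (cases "tau 0 0 dvd z \<and> rep (offset z) = c")
    case True
    then have v: "(\<lambda>w. offset z w - c w) \<in> Gd n d"
      using rep_Gd[of "offset z"] by simp
    have k: "k = (\<lambda>w. (offset z w - c w) + (z div tau 0 0) * tau 0 w)"
      by (auto simp: k_def offset_def)
    have "k \<in> Gtd n d"
      unfolding k by (intro Gtd_add Gtd_mult tau0) (use v in \<open>simp add: Gd_def\<close>)
    then have "pf.numerator_at i (shift_rf k f) = shift_rf k (pf.numerator_at i f)"
      by (intro numerator_shift f_in) (simp add: Gtd_def)
    also have "pf.numerator_at i f = a"
      unfolding f_def by (rule numerator_base[OF a_V])
    finally show ?thesis using True unfolding num by (simp add: shift_rf_add k)
  next
    case False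
    \<comment> \<open>Modulo \<open>G_d\<close>, a member \<open>k\<close> would be a multiple
      \<open>q\<close> of \<open>tau 0\<close>. Comparing t-components gives
      \<open>z = q * tau 0 0\<close>, and then \<open>c\<close> represents
      \<open>offset z\<close>.\<close>
    have "k \<notin> Gtd n d"
    proof
      assume "k \<in> Gtd n d"
      then obtain q where q: "(\<lambda>w. k w - q * tau 0 w) \<in> Gd n d" using quotient by blast
      then have "k 0 = q * tau 0 0" by (simp add: Gd_def)
      then have z: "z = q * tau 0 0" by (simp add: k_def c0 unitv_def)
      then have "z div tau 0 0 = q" using tau0(2) by simp
      then have "(\<lambda>w. offset z w - c w) \<in> Gd n d"
        using q by (simp add: offset_def k_def algebra_simps)
      then have "rep (offset z) = c" using rep_cong rep_C[OF r] by metis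
      then show False using False z by simp
    qed
    then have "shift_rf k (rf d) \<noteq> rf d" using kG by (simp add: Gtd_def)
    then show ?thesis
      unfolding num if_not_P[OF False] unfolding f_def by (rule numerator_shift_other[OF a_V])
  qed
qed

text \<open>At most one coset contributes, and its term differs from a power of
  \<open>\<tau>_0\<close> applied to \<open>a\<close> only by a shift in \<open>G_d\<close>.\<close>

lemma sum_num_shift_f:
  assumes T: "finite T" "T \<subseteq> C" "tau 0 0 dvd z \<Longrightarrow> rep (offset z) \<in> T"
  shows "(if tau 0 0 dvd z then shift_rf (\<lambda>w. (z div tau 0 0) * tau 0 w) a else 0) -
    (\<Sum>c\<in>T. num i c (shift_rf (unitv 0 z) f)) \<in> W"
proof (cases "tau 0 0 dvd z")
  case True
  let ?u = "shift_rf (\<lambda>w. (z div tau 0 0) * tau 0 w) a"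
  let ?h = "\<lambda>w. offset z w - rep (offset z) w"
  have "(\<Sum>c\<in>T. num i c (shift_rf (unitv 0 z) f)) = (\<Sum>c\<in>T. if rep (offset z) = c then shift_rf ?h ?u else 0)"
    by (intro sum.cong refl, subst num_shift_f) (use T(2) True in auto)
  also have "\<dots> = shift_rf ?h ?u"
    using T True by simp
  finally have "?u - (\<Sum>c\<in>T. num i c (shift_rf (unitv 0 z) f)) = - Delta ?h ?u"
    by (simp add: Delta_def)
  also have "\<dots> \<in> W"
    by (intro V.span_uminus Gd_W rep_Gd shift_V a_V)
  finally show ?thesis using True by simp
next
  case False
  have "(\<Sum>c\<in>T. num i c (shift_rf (unitv 0 z) f)) = 0"
    by (rule sum.neutral) (use T(2) False num_shift_f in auto)
  then show ?thesis using False V.span_0 by simp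
qed

text \<open>The coset sum of numerators is applied to a telescoping relation. The exponents
  \<open>z l\<close> are integers because the telescoper is shifted backwards in t before this is
  used.\<close>

lemma W_if_S:
  fixes A :: "nat set"
  assumes S: "(\<Sum>l\<in>A. e l * shift_rf (unitv 0 (z l)) f) \<in> S" and A: "finite A"
    and e: "\<And>l. l \<in> A \<Longrightarrow> rf_in {0} (e l)"
  shows "(\<Sum>l\<in>{l\<in>A. tau 0 0 dvd z l}. e l * shift_rf (\<lambda>w. (z l div tau 0 0) * tau 0 w) a) \<in> W"
proof -
  obtain g where g: "\<forall>l\<in>{1..n}. rf_in {0..m} (g l)"
    "(\<Sum>l\<in>A. e l * shift_rf (unitv 0 (z l)) f) = (\<Sum>l=1..n. Delta (unitv l 1) (g l))"
    using S unfolding delta_span_def by blast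
  have unitv_G: "unitv l 1 \<in> G" if "l \<in> {1..n}" for l
    using that by (auto simp: G_def in_Gt_def unitv_def)
  \<comment> \<open>Contains the supports required by \<open>num_Delta\<close> for every certificate
    and its shift, and the single coset at which each surviving power of \<open>\<sigma>_t\<close>
    is seen.\<close>
  define T where "T = (\<Union>l\<in>{1..n}. supp i (g l) \<union> supp i (shift_rf (unitv l 1) (g l))) \<union>
    (\<lambda>l. rep (offset (z l))) ` {l\<in>A. tau 0 0 dvd z l}"
  have T_fin: "finite T"
    unfolding T_def using g A by (intro finite_UnI finite_UN_I finite_supp rf_in_shift_rf) auto
  have T_C: "T \<subseteq> C"
    unfolding T_def by (auto simp: supp_def intro!: rep_in_C offset_G)
  have num_sum: "num i c (\<Sum>l\<in>B. u l) = (\<Sum>l\<in>B. num i c (u l))"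
    if "\<And>l. l \<in> B \<Longrightarrow> rf_in {0..m} (u l)" for c B and u :: "nat \<Rightarrow> 'k rfun"
    unfolding num_def ring_hom_onD(7)[OF ring_hom_shift_rf]
    by (rule numerator_sum) (simp add: that rf_in_shift_rf)
  \<comment> \<open>Representatives have t-component 0 and so fix the coefficients in K(t).\<close>
  have num_scale: "num i c (e l * u) = e l * num i c u"
    if "l \<in> A" "c \<in> T" "rf_in {0..m} u" for l c u
  proof -
    have "c 0 = 0" using that(2) T_C C_G by (auto simp: G_def)
    then have "shift_rf (\<lambda>w. - c w) (e l) = e l" by (intro shift_rf_id[OF e[OF that(1)]]) simp
    then show ?thesis
      unfolding num_def ring_hom_onD(4)[OF ring_hom_shift_rf]
      by (simp add: numerator_scale rf_in_shift_rf that in_V0 e)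
  qed
  have Delta_in: "rf_in {0..m} (Delta (unitv l 1) (g l))" if "l \<in> {1..n}" for l
    unfolding Delta_def using E.M_diff[of "shift_rf (unitv l 1) (g l)" "g l"] g(1) that
    by (simp add: rf_in_shift_rf)
  have term_in: "rf_in {0..m} (e l * shift_rf (unitv 0 (z l)) f)" if "l \<in> A" for l
    using E.M_scale[OF e[OF that], of "shift_rf (unitv 0 (z l)) f"] f_in by (simp add: rf_in_shift_rf)
  have "(\<Sum>c\<in>T. num i c (\<Sum>l=1..n. Delta (unitv l 1) (g l))) =
      (\<Sum>l=1..n. \<Sum>c\<in>T. num i c (Delta (unitv l 1) (g l)))"
    by (subst sum.swap, intro sum.cong refl num_sum Delta_in)
  also have "\<dots> \<in> W"
  proof (rule V.span_sum)
    fix l assume l: "l \<in> {1..n}"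
    then have "rf_in {0..m} (g l)" "supp i (g l) \<subseteq> T" "supp i (shift_rf (unitv l 1) (g l)) \<subseteq> T"
      using g by (auto simp: T_def)
    then show "(\<Sum>c\<in>T. num i c (Delta (unitv l 1) (g l))) \<in> W"
      by (intro num_Delta unitv_G[OF l] T_fin T_C)
  qed
  finally have 1: "(\<Sum>c\<in>T. num i c (\<Sum>l\<in>A. e l * shift_rf (unitv 0 (z l)) f)) \<in> W"
    unfolding g(2) .
  have 2: "(\<Sum>c\<in>T. num i c (\<Sum>l\<in>A. e l * shift_rf (unitv 0 (z l)) f)) =
      (\<Sum>l\<in>A. e l * (\<Sum>c\<in>T. num i c (shift_rf (unitv 0 (z l)) f)))"
  proof -
    have "num i c (\<Sum>l\<in>A. e l * shift_rf (unitv 0 (z l)) f) =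
        (\<Sum>l\<in>A. e l * num i c (shift_rf (unitv 0 (z l)) f))" if "c \<in> T" for c
      by (subst num_sum) (auto intro!: term_in sum.cong num_scale that rf_in_shift_rf f_in)
    then have "(\<Sum>c\<in>T. num i c (\<Sum>l\<in>A. e l * shift_rf (unitv 0 (z l)) f)) =
        (\<Sum>c\<in>T. \<Sum>l\<in>A. e l * num i c (shift_rf (unitv 0 (z l)) f))"
      by (intro sum.cong refl)
    also have "\<dots> = (\<Sum>l\<in>A. \<Sum>c\<in>T. e l * num i c (shift_rf (unitv 0 (z l)) f))"
      by (rule sum.swap)
    finally show ?thesis by (simp add: sum_distrib_left)
  qed
  let ?u = "\<lambda>l. if tau 0 0 dvd z l then shift_rf (\<lambda>w. (z l div tau 0 0) * tau 0 w) a else 0"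
  have "(\<Sum>l\<in>A. e l * (?u l - (\<Sum>c\<in>T. num i c (shift_rf (unitv 0 (z l)) f)))) \<in> W"
  proof (intro V.span_sum V.span_scale e sum_num_shift_f T_fin T_C)
    fix l assume "l \<in> A"
    then show "tau 0 0 dvd z l \<Longrightarrow> rep (offset (z l)) \<in> T" by (auto simp: T_def)
  next
    fix l assume "l \<in> {1..r}"
    then show "tau l 0 = 0" using tau_Gd by (simp add: Gd_def)
  qed
  then have "(\<Sum>l\<in>A. e l * (?u l - (\<Sum>c\<in>T. num i c (shift_rf (unitv 0 (z l)) f)))) +
      (\<Sum>l\<in>A. e l * (\<Sum>c\<in>T. num i c (shift_rf (unitv 0 (z l)) f))) \<in> W"
    using V.span_add 1 unfolding 2 by blast
  then have "(\<Sum>l\<in>A. e l * ?u l) \<in> W"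
    by (simp add: sum.distrib[symmetric] right_diff_distrib)
  moreover have "(\<Sum>l\<in>A. e l * ?u l) =
      (\<Sum>l\<in>{l\<in>A. tau 0 0 dvd z l}. e l * shift_rf (\<lambda>w. (z l div tau 0 0) * tau 0 w) a)"
    using A by (auto simp: sum.inter_filter intro!: sum.cong)
  ultimately show ?thesis by simp
qed

end

section \<open>Telescopers\<close>

context telescoping
begin

lemma S_iff:
  "u \<in> S \<longleftrightarrow> (\<exists>g. (\<forall>l\<in>{1..n}. rf_in {0..m} (g l)) \<and> u = (\<Sum>l=1..n. Delta (unitv l 1) (g l)))"
  unfolding delta_span_def mem_Collect_eq by (intro ex_cong1 conj_commute)

lemma has_telescoper_iff:
  "has_telescoper m n g \<longleftrightarrow> (\<exists>e N. (\<forall>l\<le>N. rf_in {0} (e l)) \<and> (\<exists>l\<le>N. e l \<noteq> 0) \<and>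
    (\<Sum>l\<le>N. e l * shift_rf (unitv 0 (int l)) g) \<in> S)"
  unfolding has_telescoper_def S_iff ..

lemma W_iff:
  "u \<in> W \<longleftrightarrow> (\<exists>b. (\<forall>l\<in>{1..r}. x1poly_deg_lt m (degx1 d) (b l)) \<and> u = (\<Sum>l=1..r. Delta (tau l) (b l)))"
  unfolding delta_span_def x1poly_deg_lt_iff mem_Collect_eq by (intro ex_cong1 conj_commute)

lemma operator_if_telescoper:
  assumes "has_telescoper m n f"
  shows "\<exists>l \<rho>. (\<forall>i\<le>\<rho>. rf_in {0} (l i)) \<and> (\<exists>i\<le>\<rho>. l i \<noteq> 0) \<and>
    (\<Sum>i\<le>\<rho>. l i * shift_rf (\<lambda>w. int i * tau 0 w) a) \<in> W"
proof -
  obtain e N l0 where e: "\<And>l. l \<le> N \<Longrightarrow> rf_in {0} (e l)" and l0: "l0 \<le> N" "e l0 \<noteq> 0"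
    and S: "(\<Sum>l\<le>N. e l * shift_rf (unitv 0 (int l)) f) \<in> S"
    using assms unfolding has_telescoper_iff by blast
  \<comment> \<open>The shift by \<open>- int l0\<close> moves a nonzero coefficient to exponent 0,
    which \<open>tau 0 0\<close> divides, so this coefficient survives the passage to
    \<open>A\<close>.\<close>
  define e' where "e' l = shift_rf (unitv 0 (- int l0)) (e l)" for l
  define z where "z l = int l - int l0" for l
  define q where "q l = z l div tau 0 0" for l
  define A where "A = {l\<in>{..N}. tau 0 0 dvd z l}"
  \<comment> \<open>All quotients satisfy \<open>\<bar>q l\<bar> \<le> int N\<close>, as
    \<open>tau 0 0\<close> is a nonzero integer. Applying \<open>\<tau>_0^N\<close> therefore moves
    the exponents of \<open>\<tau>_0\<close> into the range from 0 to \<open>2 * N\<close>, and it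
    acts on the coefficients as well.\<close>
  define x where "x l = shift_rf (\<lambda>w. int N * tau 0 w) (e' l)" for l
  define p where "p l = nat (q l + int N)" for l
  define y where "y k = shift_rf (\<lambda>w. int k * tau 0 w) a" for k
  have eq: "shift_rf (unitv 0 (- int l0)) (\<Sum>l\<le>N. e l * shift_rf (unitv 0 (int l)) f) =
      (\<Sum>l\<le>N. e' l * shift_rf (unitv 0 (z l)) f)"
    unfolding ring_hom_onD(7)[OF ring_hom_shift_rf] ring_hom_onD(4)[OF ring_hom_shift_rf] e'_def shift_rf_add
    by (intro sum.cong refl arg_cong2[where f = "(*)"] shift_rf_cong) (simp add: unitv_def z_def)
  have "(\<Sum>l\<in>{..N}. e' l * shift_rf (unitv 0 (z l)) f) \<in> S"
    unfolding eq[symmetric] by (rule E.span_shift[OF S])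
  then have "(\<Sum>l\<in>A. e' l * shift_rf (\<lambda>w. q l * tau 0 w) a) \<in> W"
    unfolding A_def q_def by (rule W_if_S) (simp_all add: e'_def rf_in_shift_rf e)
  then have W: "shift_rf (\<lambda>w. int N * tau 0 w) (\<Sum>l\<in>A. e' l * shift_rf (\<lambda>w. q l * tau 0 w) a) \<in> W"
    by (rule V.span_shift)
  have q: "\<bar>q l\<bar> \<le> int N" if "l \<in> A" for l
  proof -
    have "z l = tau 0 0 * q l" using that tau0(2) by (simp add: A_def q_def)
    then have "\<bar>q l\<bar> * 1 \<le> \<bar>z l\<bar>"
      using tau0(2) mult_left_mono[of 1 "\<bar>tau 0 0\<bar>" "\<bar>q l\<bar>"] by (simp add: abs_mult mult.commute)
    also have "\<bar>z l\<bar> \<le> int N" using that l0 by (auto simp: z_def A_def)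
    finally show ?thesis by simp
  qed
  have eqN: "shift_rf (\<lambda>w. int N * tau 0 w) (\<Sum>l\<in>A. e' l * shift_rf (\<lambda>w. q l * tau 0 w) a) =
      (\<Sum>l\<in>A. x l * y (p l))"
    unfolding ring_hom_onD(7)[OF ring_hom_shift_rf] ring_hom_onD(4)[OF ring_hom_shift_rf] x_def y_def shift_rf_add
  proof (intro sum.cong refl arg_cong2[where f = "(*)"] shift_rf_cong)
    fix l w assume "l \<in> A"
    then have "int (p l) = q l + int N" using q[of l] by (simp add: p_def)
    then show "int N * tau 0 w + q l * tau 0 w = int (p l) * tau 0 w" by (simp add: algebra_simps)
  qed
  have inj: "inj_on p A"
  proof (rule inj_onI)
    fix l k assume lk: "l \<in> A" "k \<in> A" "p l = p k"
    moreover have "0 \<le> q l + int N" "0 \<le> q k + int N"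
      using q[OF lk(1)] q[OF lk(2)] by linarith+
    ultimately have "q l = q k" by (simp add: p_def)
    moreover have "z l = tau 0 0 * q l" "z k = tau 0 0 * q k"
      using lk tau0(2) by (simp_all add: A_def q_def)
    ultimately have "z l = z k" by simp
    then show "l = k" by (simp add: z_def)
  qed
  have pA: "p ` A \<subseteq> {..2 * N}" using q by (force simp: p_def)
  have finA: "finite A" by (simp add: A_def)
  obtain x' where x': "\<And>l. l \<in> A \<Longrightarrow> x' (p l) = x l" "\<And>k. k \<notin> p ` A \<Longrightarrow> x' k = 0"
    "(\<Sum>k\<le>2 * N. x' k * y k) = (\<Sum>l\<in>A. x l * y (p l))"
    by (rule reindex_coefficients[OF finA inj pA, of x y]) blast
  have "rf_in {0} (x' k)" for k
  proof (cases "k \<in> p ` A")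
    case True
    then show ?thesis using x'(1) e by (auto simp: x_def e'_def A_def rf_in_shift_rf)
  next
    case False
    then show ?thesis using x'(2) sub_ring.zero_closed[OF sub_ring_rf_in, of "{0}"] by simp
  qed
  moreover have "x' (p l0) \<noteq> 0" "p l0 \<le> 2 * N"
  proof -
    have "l0 \<in> A" using l0 by (simp add: A_def z_def)
    then show "p l0 \<le> 2 * N" using pA by auto
    have nz: "shift_rf k u \<noteq> 0" if "u \<noteq> 0" for k and u :: "'k rfun"
      using shift_rf_uminus[of k u] that ring_hom_onD(1)[OF ring_hom_shift_rf] by metis
    have "x l0 \<noteq> 0" unfolding x_def e'_def by (intro nz l0)
    then show "x' (p l0) \<noteq> 0" using x'(1)[OF \<open>l0 \<in> A\<close>] by simp
  qed
  moreover have "(\<Sum>k\<le>2 * N. x' k * y k) \<in> W"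
    using W unfolding eqN x'(3) .
  ultimately show ?thesis
    unfolding y_def by blast
qed

text \<open>Elements of \<open>G_d\<close> fix \<open>d\<close>, so the division passes through
  their differences; each of these then decomposes into differences along the generators of
  \<open>G\<close>.\<close>

lemma W_divide:
  assumes "u \<in> W"
  shows "u / rf d ^ Suc i \<in> S"
proof -
  obtain b where b: "\<forall>l\<in>{1..r}. b l \<in> pf.V" "u = (\<Sum>l=1..r. Delta (tau l) (b l))"
    using assms unfolding delta_span_def by blast
  have d_in_E: "rf_in {0..m} (rf d ^ Suc i)"
    using sub_ring.power_closed[OF sub_ring_rf_in[of "{0..m}"], of "rf d" "Suc i"] rf_in_rf[OF d_in] by blast
  have "u / rf d ^ Suc i = (\<Sum>l=1..r. Delta (tau l) (b l / rf d ^ Suc i))"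
    unfolding b(2) sum_divide_distrib
  proof (intro sum.cong refl)
    fix l assume "l \<in> {1..r}"
    then have "shift_rf (tau l) (rf d) = rf d" using tau_Gd by (simp add: Gd_def Gtd_def)
    then show "Delta (tau l) (b l) / rf d ^ Suc i = Delta (tau l) (b l / rf d ^ Suc i)"
      unfolding Delta_def shift_rf_divide ring_hom_onD(9)[OF ring_hom_shift_rf]
      by (simp only: diff_divide_distrib)
  qed
  also have "\<dots> \<in> S"
  proof (rule E.span_sum, rule shift_G_in_span)
    fix l assume l: "l \<in> {1..r}"
    then show "tau l \<in> G" using tau_Gd[OF l] by (simp add: Gd_def Gtd_def G_def)
    show "rf_in {0..m} (b l / rf d ^ Suc i)" by (intro rf_in_divide V_rf_in d_in_E) (use b l in blast)
  qed
  finally show ?thesis .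
qed

lemma telescoper_if_operator:
  assumes l: "\<And>k. k \<le> \<rho> \<Longrightarrow> rf_in {0} (l k)" "k0 \<le> \<rho>" "l k0 \<noteq> 0"
    and W: "(\<Sum>k\<le>\<rho>. l k * shift_rf (\<lambda>w. int k * tau 0 w) a) \<in> W"
  shows "has_telescoper m n f"
proof -
  \<comment> \<open>\<open>M\<close> bounds the absolute values of all exponents
    \<open>int k * tau 0 0\<close>, which are negative if \<open>tau 0 0\<close> is; adding
    \<open>M\<close> puts them between 0 and \<open>2 * M\<close>.\<close>
  define M where "M = int \<rho> * \<bar>tau 0 0\<bar>"
  define x where "x k = shift_rf (unitv 0 M) (l k)" for k
  define y where "y k = shift_rf (unitv 0 (int k)) f" for k
  define p where "p k = nat (int k * tau 0 0 + M)" for k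
  have unit0: "unitv k 1 0 = 0" if "k \<in> {1..n}" for k
    using that by (simp add: unitv_def)
  have "shift_rf (\<lambda>w. int k * tau 0 w) f = shift_rf (\<lambda>w. int k * tau 0 w) a / rf d ^ Suc i" for k
    using Gtd_mult[OF tau0(1), of "int k"]
    unfolding f_def shift_rf_divide ring_hom_onD(9)[OF ring_hom_shift_rf] by (simp add: Gtd_def)
  then have "(\<Sum>k\<le>\<rho>. l k * shift_rf (\<lambda>w. int k * tau 0 w) f) =
      (\<Sum>k\<le>\<rho>. l k * shift_rf (\<lambda>w. int k * tau 0 w) a) / rf d ^ Suc i"
    by (simp add: sum_divide_distrib)
  also have "\<dots> \<in> S" by (rule W_divide[OF W])
  finally have 1: "(\<Sum>k\<le>\<rho>. l k * shift_rf (\<lambda>w. int k * tau 0 w) f) \<in> S" .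
  \<comment> \<open>\<open>\<tau>_0^k\<close> and its t-part differ by an element of
    \<open>G\<close>, so replacing one by the other changes the sum only by an element of
    \<open>S\<close>.\<close>
  have "(\<Sum>k\<le>\<rho>. l k * Delta (\<lambda>w. int k * tau 0 w - unitv 0 (int k * tau 0 0) w)
      (shift_rf (unitv 0 (int k * tau 0 0)) f)) \<in> S"
  proof (intro E.span_sum E.span_scale shift_G_in_span rf_in_shift_rf f_in l(1) unit0)
    show "(\<lambda>w. int k * tau 0 w - unitv 0 (int k * tau 0 0) w) \<in> G" for k
      using tau0_in_Gt by (auto simp: G_def in_Gt_def unitv_def)
  qed simp_all
  moreover have "Delta (\<lambda>w. int k * tau 0 w - unitv 0 (int k * tau 0 0) w)
      (shift_rf (unitv 0 (int k * tau 0 0)) f) =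
      shift_rf (\<lambda>w. int k * tau 0 w) f - shift_rf (unitv 0 (int k * tau 0 0)) f" for k
    by (simp add: Delta_def shift_rf_add)
  ultimately have "(\<Sum>k\<le>\<rho>. l k * shift_rf (\<lambda>w. int k * tau 0 w) f) -
      (\<Sum>k\<le>\<rho>. l k * shift_rf (unitv 0 (int k * tau 0 0)) f) \<in> S"
    by (simp add: right_diff_distrib sum_subtractf)
  from E.span_diff[OF 1 this] have "(\<Sum>k\<le>\<rho>. l k * shift_rf (unitv 0 (int k * tau 0 0)) f) \<in> S"
    by simp
  then have S: "shift_rf (unitv 0 M) (\<Sum>k\<le>\<rho>. l k * shift_rf (unitv 0 (int k * tau 0 0)) f) \<in> S"
    by (rule E.span_shift)
  have M: "\<bar>int k * tau 0 0\<bar> \<le> M" if "k \<le> \<rho>" for k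
    using that by (simp add: M_def abs_mult mult_right_mono)
  have eqM: "shift_rf (unitv 0 M) (\<Sum>k\<le>\<rho>. l k * shift_rf (unitv 0 (int k * tau 0 0)) f) =
      (\<Sum>k\<in>{..\<rho>}. x k * y (p k))"
    unfolding ring_hom_onD(7)[OF ring_hom_shift_rf] ring_hom_onD(4)[OF ring_hom_shift_rf] x_def y_def shift_rf_add
  proof (intro sum.cong refl arg_cong2[where f = "(*)"] shift_rf_cong)
    fix k w assume "k \<in> {..\<rho>}"
    then have "int (p k) = int k * tau 0 0 + M" using M[of k] by (simp add: p_def)
    then show "unitv 0 M w + unitv 0 (int k * tau 0 0) w = unitv 0 (int (p k)) w"
      by (simp add: unitv_def)
  qed
  have inj: "inj_on p {..\<rho>}"
  proof (rule inj_onI)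
    fix k k' assume k: "k \<in> {..\<rho>}" "k' \<in> {..\<rho>}" "p k = p k'"
    moreover have "0 \<le> int k * tau 0 0 + M" "0 \<le> int k' * tau 0 0 + M"
      using M[of k] M[of k'] k by simp_all
    ultimately have "int k * tau 0 0 = int k' * tau 0 0"
      unfolding p_def by (simp only: eq_nat_nat_iff add_right_cancel)
    then show "k = k'" using tau0(2) by simp
  qed
  have p: "p ` {..\<rho>} \<subseteq> {..nat (2 * M)}" using M by (force simp: p_def)
  obtain x' where x': "\<And>k. k \<in> {..\<rho>} \<Longrightarrow> x' (p k) = x k" "\<And>k. k \<notin> p ` {..\<rho>} \<Longrightarrow> x' k = 0"
    "(\<Sum>k\<le>nat (2 * M). x' k * y k) = (\<Sum>k\<in>{..\<rho>}. x k * y (p k))"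
    by (rule reindex_coefficients[OF finite_atMost inj p, of x y]) blast
  have "rf_in {0} (x' k)" for k
  proof (cases "k \<in> p ` {..\<rho>}")
    case True
    then show ?thesis using x'(1) l(1) by (auto simp: x_def rf_in_shift_rf)
  next
    case False
    then show ?thesis using x'(2) sub_ring.zero_closed[OF sub_ring_rf_in, of "{0}"] by simp
  qed
  moreover have "x' (p k0) \<noteq> 0" "p k0 \<le> nat (2 * M)"
  proof -
    show "p k0 \<le> nat (2 * M)" using p l(2) by auto
    have "x k0 \<noteq> 0"
      unfolding x_def using shift_rf_uminus[of "unitv 0 M" "l k0"] l(3)
        ring_hom_onD(1)[OF ring_hom_shift_rf] by metis
    then show "x' (p k0) \<noteq> 0" using x'(1)[of k0] l(2) by simp
  qed
  moreover have "(\<Sum>k\<le>nat (2 * M). x' k * y k) \<in> S"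
    using S unfolding eqM x'(3) .
  ultimately show ?thesis
    unfolding has_telescoper_iff y_def by blast
qed

end

theorem theorem1p4:
  fixes m n j r :: nat
    and a f :: "'k::field_char_0 rfun"
    and d :: "'k mpoly"
    and tau :: "nat \<Rightarrow> nat \<Rightarrow> int"
  assumes "1 \<le> n" "n \<le> m" "1 \<le> j"
    and "vars d \<subseteq> {0..m}" "irreducible d" "degx1 d > 0"
    and "x1poly_deg_lt m (degx1 d) a"
    and "f = a / rf (d ^ j)"
    and "quot_rank (Gtd n d) (Gd n d) = 1"
    and "(Gd n d \<noteq> {\<lambda>_. 0} \<and> 1 \<le> r \<and> is_basis (Gtd n d) {0..r} tau \<and> is_basis (Gd n d) {1..r} tau)
         \<or> (Gd n d = {\<lambda>_. 0} \<and> r = 1 \<and> tau 1 = (\<lambda>_. 0) \<and> is_basis (Gtd n d) {0} tau)"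
    and "\<forall>g\<in>Gtd n d. \<exists>c::int. (\<lambda>w. g w - c * tau 0 w) \<in> Gd n d"
  shows "has_telescoper m n f \<longleftrightarrow>
    (\<exists>(l :: nat \<Rightarrow> 'k rfun) \<rho>. (\<forall>i\<le>\<rho>. rf_in {0} (l i)) \<and> (\<exists>i\<le>\<rho>. l i \<noteq> 0) \<and>
       (\<exists>b. (\<forall>i\<in>{1..r}. x1poly_deg_lt m (degx1 d) (b i)) \<and>
          (\<Sum>i\<le>\<rho>. l i * shift_rf (\<lambda>w. int i * tau 0 w) a) = (\<Sum>i=1..r. Delta (tau i) (b i))))"
proof -
  interpret shift_setting m n d
    using assms(1,2,4-6) by (simp add: shift_setting_def mpolys_in_def)
  have a: "a \<in> pf.V" using assms(7) unfolding x1poly_deg_lt_iff .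
  \<comment> \<open>Independence of the basis gives \<open>tau 0 0 \<noteq> 0\<close>: with
    t-component 0, \<open>tau 0\<close> would lie in \<open>G_d\<close> and be a combination of the
    other basis elements.\<close>
  have tau: "(\<forall>l\<in>{1..r}. tau l \<in> Gd n d) \<and> (\<forall>h\<in>Gd n d. \<exists>c. h = zlin c {1..r} tau) \<and>
      tau 0 \<in> Gtd n d \<and> tau 0 0 \<noteq> 0"
    using assms(10)
  proof (elim disjE conjE)
    assume b: "is_basis (Gtd n d) {0..r} tau" "is_basis (Gd n d) {1..r} tau"
    have "\<forall>l\<in>{0..r}. tau l \<in> Gtd n d"
      and indep: "\<And>c. zlin c {0..r} tau = (\<lambda>_. 0) \<Longrightarrow> \<forall>l\<in>{0..r}. c l = 0"
      using b(1) unfolding is_basis_def by blast+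
    then have tau0: "tau 0 \<in> Gtd n d" by simp
    have gen: "\<exists>c. h = zlin c {1..r} tau" if "h \<in> Gd n d" for h
      using b(2) that unfolding is_basis_def by blast
    have "tau 0 0 \<noteq> 0"
    proof
      assume "tau 0 0 = 0"
      with tau0 have "tau 0 \<in> Gd n d" by (simp add: Gd_def)
      then obtain c where c: "tau 0 = zlin c {1..r} tau" using gen by blast
      \<comment> \<open>The entry -1 at index 0 turns the expression of \<open>tau 0\<close> by the
        others into a linear relation.\<close>
      define c' where "c' k = (if k = 0 then - 1 else c k)" for k
      have "{0..r} = insert 0 {1..r}" by auto
      moreover have "(\<Sum>k=1..r. c' k * tau k w) = (\<Sum>k=1..r. c k * tau k w)" for w
        by (intro sum.cong) (auto simp: c'_def)
      ultimately have "zlin c' {0..r} tau w = - tau 0 w + zlin c {1..r} tau w" for w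
        by (simp add: zlin_def c'_def)
      then have "zlin c' {0..r} tau = (\<lambda>_. 0)" using c by (auto simp: fun_eq_iff)
      then have "c' 0 = 0" using indep[of c'] by simp
      then show False by (simp add: c'_def)
    qed
    moreover have "\<forall>l\<in>{1..r}. tau l \<in> Gd n d" using b(2) unfolding is_basis_def by blast
    ultimately show ?thesis using tau0 gen by blast
  next
    assume b: "Gd n d = {\<lambda>_. 0}" "r = 1" "tau 1 = (\<lambda>_. 0)" "is_basis (Gtd n d) {0} tau"
    have "\<forall>l\<in>{0}. tau l \<in> Gtd n d"
      and indep: "\<And>c. zlin c {0} tau = (\<lambda>_. 0) \<Longrightarrow> \<forall>l\<in>{0}. c l = 0"
      using b(4) unfolding is_basis_def by blast+
    then have tau0: "tau 0 \<in> Gtd n d" by simp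
    have "tau 0 0 \<noteq> 0"
    proof
      assume "tau 0 0 = 0"
      with tau0 have "tau 0 \<in> Gd n d" by (simp add: Gd_def)
      then have "zlin (\<lambda>_. 1) {0} tau = (\<lambda>_. 0)" using b(1) by (simp add: zlin_def)
      then show False using indep[of "\<lambda>_. 1"] by simp
    qed
    then show ?thesis using tau0 b by (auto simp: zlin_def)
  qed
  \<comment> \<open>Since \<open>j\<close> is positive, \<open>Suc i = j\<close>, which matches the
    indexing of numerators from 0.\<close>
  define i where "i = j - 1"
  interpret telescoping m n d r tau i a
  proof (intro telescoping.intro telescoping_axioms.intro shift_setting_axioms a)
    show "tau l \<in> Gd n d" if "l \<in> {1..r}" for l using tau that by blast
    show "\<exists>c. h = zlin c {1..r} tau" if "h \<in> Gd n d" for h using tau that by blast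
    show "\<exists>c. (\<lambda>w. h w - c * tau 0 w) \<in> Gd n d" if "h \<in> Gtd n d" for h
      using assms(11) that by blast
    show "tau 0 \<in> Gtd n d" "tau 0 0 \<noteq> 0" using tau by blast+
  qed
  have f: "f = telescoping.f d i a"
    using assms(3,8)
    by (simp add: telescoping.f_def[OF telescoping_axioms] i_def ring_hom_onD(9)[OF ring_hom_rf])
  show ?thesis
    unfolding f W_iff[symmetric] using operator_if_telescoper telescoper_if_operator by blast
qed

end
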